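(* Let $P=\sum_{|k|\le\alpha}a_kD^k$ be a non-homogeneous elliptic differential operator on $\mathbb R^n$ with constant real coefficients, of (even) order $\alpha$ with $\frac n2\le\alpha<n$, and let $p(\xi)=\sum_{|k|\le\alpha}a_k(2\pi i\xi)^k$. Suppose that for some $c_1>0$ $$|p(\xi)|\ge c_1|\xi|^\alpha\qquad\forall\xi\in\mathbb R^n .$$ Then the fundamental solution $K_P$ of $P$ is in $L^{\frac n{n-\alpha}}(\{|x|\ge1\})$.
   Context: Here $k=(k_1,\dots,k_n)$ are nonnegative multiindices. $P$ is homogeneous if $a_k=0$ whenever $|k|<\alpha$, and non-homogeneous otherwise. Elliptic means $|p_\alpha(\xi)|\ge c_0|\xi|^\alpha$ for some $c_0>0$, where $p_\alpha(\xi)=(2\pi i)^\alpha\sum_{|k|=\alpha}a_k\xi^k$ is the strictly homogeneous principal symbol. The fundamental solution $K_P$ is the inverse Fourier transform of $1/p$, formally $K_P(x)=\int_{\mathbb R^n}\frac{e^{2\pi ix\cdot\xi}}{p(\xi)}d\xi$ (in the sense of distributions); it is given by a function, $C^\infty$ away from the origin, and for $x\ne0$ $$K_P(x)=\int_{\mathbb R^n}\frac{\eta(\xi)}{p(\xi)}e^{2\pi ix\cdot\xi}d\xi+\frac{(-1)^\ell}{(2\pi|x|)^{2\ell}}\int_{\mathbb R^n}\Delta^\ell\Big(\frac{1-\eta(\xi)}{p(\xi)}\Big)e^{2\pi ix\cdot\xi}d\xi,$$ where $\eta$ is a smooth cutoff equal to $1$ for $|\xi|\le1$ and $0$ for $|\xi|\ge2$,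 and $\ell$ is any sufficiently large integer. *)

theory Defs
  imports "HOL-Analysis.Analysis"
begin

text \<open>
  A multiindex is a function \<open>'n \<Rightarrow> nat\<close> on the finite index type of \<open>real ^ 'n\<close>. The operator
  \<open>P = (\<Sum>|k| \<le> \<alpha>. a k D^k)\<close> is given by the bound \<open>\<alpha>\<close> and its coefficient family \<open>a\<close>; the values
  of \<open>a\<close> at multiindices of length greater than \<open>\<alpha>\<close> play no role.
\<close>

type_synonym 'n multiindex = "'n \<Rightarrow> nat"

definition mi_length :: "'n::finite multiindex \<Rightarrow> nat" where
  "mi_length k = (\<Sum>i\<in>UNIV. k i)"

definition symbol :: "nat \<Rightarrow> ('n::finite multiindex \<Rightarrow> real) \<Rightarrow> real ^ 'n \<Rightarrow> complex" where
  "symbol \<alpha> a \<xi> =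
     (\<Sum>k | mi_length k \<le> \<alpha>. of_real (a k) * (\<Prod>i\<in>UNIV. (2 * of_real pi * \<i> * of_real (\<xi> $ i)) ^ k i))"

definition principal_symbol :: "nat \<Rightarrow> ('n::finite multiindex \<Rightarrow> real) \<Rightarrow> real ^ 'n \<Rightarrow> complex" where
  "principal_symbol \<alpha> a \<xi> =
     (2 * of_real pi * \<i>) ^ \<alpha> * of_real (\<Sum>k | mi_length k = \<alpha>. a k * (\<Prod>i\<in>UNIV. (\<xi> $ i) ^ k i))"

text \<open>Ellipticity makes the principal part nonzero, so that \<open>\<alpha>\<close> is then the exact order of \<open>P\<close>.\<close>

definition elliptic :: "nat \<Rightarrow> ('n::finite multiindex \<Rightarrow> real) \<Rightarrow> bool" where
  "elliptic \<alpha> a \<longleftrightarrow> (\<exists>c0>0. \<forall>\<xi>. norm (principal_symbol \<alpha> a \<xi>) \<ge> c0 * norm \<xi> ^ \<alpha>)"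

definition homogeneous :: "nat \<Rightarrow> ('n::finite multiindex \<Rightarrow> real) \<Rightarrow> bool" where
  "homogeneous \<alpha> a \<longleftrightarrow> (\<forall>k. mi_length k < \<alpha> \<longrightarrow> a k = 0)"

definition partial_deriv :: "'n::finite \<Rightarrow> (real ^ 'n \<Rightarrow> complex) \<Rightarrow> real ^ 'n \<Rightarrow> complex" where
  "partial_deriv i f x = frechet_derivative f (at x) (axis i 1)"

definition test_function :: "(real ^ 'n::finite \<Rightarrow> complex) \<Rightarrow> bool" where
  "test_function \<phi> \<longleftrightarrow>
     (\<forall>js x. foldr partial_deriv js \<phi> differentiable (at x)) \<and> compact (closure {x. \<phi> x \<noteq> 0})"

definition inverse_fourier :: "(real ^ 'n::finite \<Rightarrow> complex) \<Rightarrow> real ^ 'n \<Rightarrow> complex" where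
  "inverse_fourier \<phi> x = (LINT \<xi>|lebesgue. \<phi> \<xi> * exp (2 * of_real pi * \<i> * of_real (x \<bullet> \<xi>)))"

type_synonym 'n distr = "(real ^ 'n \<Rightarrow> complex) \<Rightarrow> complex"

definition distr_of :: "(real ^ 'n::finite \<Rightarrow> complex) \<Rightarrow> 'n distr" where
  "distr_of f = (\<lambda>\<phi>. LINT x|lebesgue. f x * \<phi> x)"

definition inverse_fourier_distr :: "'n::finite distr \<Rightarrow> 'n distr" where
  "inverse_fourier_distr T = (\<lambda>\<phi>. T (inverse_fourier \<phi>))"

definition locally_integrable :: "(real ^ 'n::finite \<Rightarrow> complex) \<Rightarrow> bool" where
  "locally_integrable f \<longleftrightarrow> (\<forall>C. compact C \<longrightarrow> f absolutely_integrable_on C)"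

definition distr_given_by :: "'n::finite distr \<Rightarrow> (real ^ 'n \<Rightarrow> complex) \<Rightarrow> bool" where
  "distr_given_by T f \<longleftrightarrow> locally_integrable f \<and> (\<forall>\<phi>. test_function \<phi> \<longrightarrow> T \<phi> = distr_of f \<phi>)"

text \<open>
  \<open>K\<close> is the function, unique up to null sets, that gives the inverse Fourier transform of
  \<open>1 / p\<close>. Testing on compactly supported smooth functions suffices, as these are dense in the
  Schwartz space. If \<open>p\<close> vanishes at the origin, the value \<open>1 / 0 = 0\<close> there is irrelevant.
\<close>

definition fundamental_solution ::
    "nat \<Rightarrow> ('n::finite multiindex \<Rightarrow> real) \<Rightarrow> (real ^ 'n \<Rightarrow> complex) \<Rightarrow> bool" where
  "fundamental_solution \<alpha> a K \<longleftrightarrow>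
     distr_given_by (inverse_fourier_distr (distr_of (\<lambda>\<xi>. 1 / symbol \<alpha> a \<xi>))) K"

definition in_Lp :: "real \<Rightarrow> (real ^ 'n::finite) set \<Rightarrow> (real ^ 'n \<Rightarrow> complex) \<Rightarrow> bool" where
  "in_Lp q S f \<longleftrightarrow>
     set_borel_measurable lebesgue S f \<and> set_integrable lebesgue S (\<lambda>x. norm (f x) powr q)"

end

theory Submission
  imports Defs "HOL-Computational_Algebra.Fundamental_Theorem_Algebra"
begin

text \<open>
  Write \<open>1/p = f + g\<close> with \<open>g = cnj p / (1 + |p|\<^sup>2)\<close> and \<open>f = 1 / (p (1 + |p|\<^sup>2))\<close>.
  The function \<open>g\<close> is smooth and its derivatives of order \<open>n\<close> are integrable, so its inverse Fourier
  transform is \<open>O(|x|\<^sup>-\<^sup>n)\<close> away from the origin. The function \<open>f\<close> decays like \<open>|\<xi>|\<^sup>-\<^sup>3\<^sup>\<alpha>\<close>, and it lies in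
  \<open>L\<^sup>n\<^sup>/\<^sup>\<alpha>\<close> near the origin: there \<open>p\<close> is dominated by its lowest homogeneous part \<open>P\<close>, of degree
  less than \<open>\<alpha>\<close> because the operator is non-homogeneous, except on the set where \<open>P\<close> is small. A small negative
  power of \<open>|P|\<close> is locally integrable, as one sees by integrating along lines in a direction in which
  \<open>P\<close> does not vanish. Since \<open>n/\<alpha> \<le> 2\<close>, the Hausdorff-Young inequality puts the inverse Fourier
  transform of \<open>f\<close> in the conjugate space \<open>L\<^sup>n\<^sup>/\<^sup>(\<^sup>n\<^sup>-\<^sup>\<alpha>\<^sup>)\<close>.
\<close>

subsection \<open>Integrals over dyadic shells\<close>

text \<open>The exponent \<open>n/\<alpha>\<close> is critical: the lower bound on \<open>p\<close>
  alone only bounds \<open>|p|\<close> to the power \<open>-n/\<alpha>\<close> by a multiple of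
  \<open>|\<xi>|\<close> to the power \<open>-n\<close>, which diverges logarithmically at the
  origin and at infinity. At infinity the cure is to subtract \<open>g\<close>, which leaves a
  function of size \<open>|p|\<close> to the power \<open>-3\<close>. At the origin the gain must
  come from \<open>P\<close>, which may itself vanish in some directions; hence a small power
  \<open>\<delta>\<close> is traded, the gain \<open>|\<xi>|\<close> to the power
  \<open>\<delta>\<close> being paid for by \<open>|P|\<close> to the power
  \<open>-\<delta>\<close>. The denominator \<open>1 + |p|^2\<close> plays the role of a smooth
  cutoff: \<open>g\<close> is rational without poles, so its derivatives are controlled by counting
  degrees. \<open>K\<close> is known only through its action on test functions. Identities are
  therefore tested on an explicit class of bumps, stable under differentiation and multiplication by
  coordinates, and hold for \<open>K\<close> almost everywhere. The Plancherel inequality enters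
  with some constant, obtained from the multiplication formula and a Schur test; interpolation with
  the trivial bound from \<open>L^1\<close> yields Hausdorff-Young.\<close>

lemma nn_integral_lborel_affine:
  fixes f :: "'a::euclidean_space \<Rightarrow> ennreal"
  assumes [measurable]: "f \<in> borel_measurable borel" and c: "c \<noteq> 0"
  shows "(\<integral>\<^sup>+x. f x \<partial>lborel) = ennreal (\<bar>c\<bar> ^ DIM('a)) * (\<integral>\<^sup>+x. f (t + c *\<^sub>R x) \<partial>lborel)"
  by (subst lborel_affine[OF c, of t])
     (simp add: nn_integral_density nn_integral_distr nn_integral_cmult)

text \<open>The dilates of \<open>A\<close> by the powers of \<open>c\<close> cover
  \<open>S\<close>, and pulling the \<open>k\<close>-th dilate back to \<open>A\<close> multiplies
  the integral by at most \<open>r^k\<close>, so a geometric series bounds the total. With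
  \<open>c = 2\<close> this controls the behaviour at infinity, with \<open>c = 1/2\<close> the
  behaviour at the origin.\<close>

lemma nn_integral_shells_finite:
  fixes h :: "'a::euclidean_space \<Rightarrow> ennreal"
  assumes [measurable]: "h \<in> borel_measurable borel" "A \<in> sets borel"
    and c: "c > 0" and r: "0 \<le> r" "r < 1"
    and scale: "\<And>x. ennreal (c ^ DIM('a)) * h (c *\<^sub>R x) \<le> ennreal r * h x"
    and cover: "\<And>x. x \<in> S \<Longrightarrow> \<exists>k. (1 / c) ^ k *\<^sub>R x \<in> A"
    and fin: "(\<integral>\<^sup>+x\<in>A. h x \<partial>lborel) < \<infinity>"
  shows "(\<integral>\<^sup>+x\<in>S. h x \<partial>lborel) < \<infinity>"
proof -
  define I where "I = (\<integral>\<^sup>+x\<in>A. h x \<partial>lborel)"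
  have scale_k: "ennreal ((c ^ k) ^ DIM('a)) * h (c ^ k *\<^sub>R x) \<le> ennreal (r ^ k) * h x" for k x
  proof (induction k)
    case (Suc k)
    have "ennreal ((c ^ Suc k) ^ DIM('a)) * h (c ^ Suc k *\<^sub>R x)
        = ennreal ((c ^ k) ^ DIM('a)) * (ennreal (c ^ DIM('a)) * h (c *\<^sub>R (c ^ k *\<^sub>R x)))"
      using c by (simp add: ennreal_mult' mult_ac power_mult_distrib)
    also have "\<dots> \<le> ennreal ((c ^ k) ^ DIM('a)) * (ennreal r * h (c ^ k *\<^sub>R x))"
      by (intro mult_left_mono scale) auto
    also have "\<dots> = ennreal r * (ennreal ((c ^ k) ^ DIM('a)) * h (c ^ k *\<^sub>R x))"
      by (simp add: mult_ac)
    also have "\<dots> \<le> ennreal r * (ennreal (r ^ k) * h x)"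
      by (intro mult_left_mono Suc) auto
    also have "\<dots> = ennreal (r ^ Suc k) * h x"
      using r by (simp add: ennreal_mult' mult_ac)
    finally show ?case .
  qed simp
  have shell: "(\<integral>\<^sup>+x. h x * indicator A ((1 / c) ^ k *\<^sub>R x) \<partial>lborel) \<le> ennreal (r ^ k) * I" for k
  proof -
    have "(\<integral>\<^sup>+x. h x * indicator A ((1 / c) ^ k *\<^sub>R x) \<partial>lborel)
      = ennreal (\<bar>c ^ k\<bar> ^ DIM('a)) * (\<integral>\<^sup>+x. h (0 + c ^ k *\<^sub>R x) * indicator A ((1 / c) ^ k *\<^sub>R (0 + c ^ k *\<^sub>R x)) \<partial>lborel)"
      using c by (intro nn_integral_lborel_affine) auto
    also have "\<dots> = (\<integral>\<^sup>+x\<in>A. ennreal ((c ^ k) ^ DIM('a)) * h (c ^ k *\<^sub>R x) \<partial>lborel)"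
      using c by (subst nn_integral_cmult[symmetric]) (auto simp: field_simps power_one_over mult.assoc)
    also have "\<dots> \<le> (\<integral>\<^sup>+x\<in>A. ennreal (r ^ k) * h x \<partial>lborel)"
      by (intro nn_integral_mono mult_right_mono scale_k) auto
    also have "\<dots> = ennreal (r ^ k) * I"
      unfolding I_def by (subst nn_integral_cmult[symmetric]) (auto simp: mult_ac)
    finally show ?thesis .
  qed
  have "(\<integral>\<^sup>+x\<in>S. h x \<partial>lborel) \<le> (\<integral>\<^sup>+x. (\<Sum>k. h x * indicator A ((1 / c) ^ k *\<^sub>R x)) \<partial>lborel)"
  proof (intro nn_integral_mono)
    fix x :: 'a
    show "h x * indicator S x \<le> (\<Sum>k. h x * indicator A ((1 / c) ^ k *\<^sub>R x))"
    proof (cases "x \<in> S")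
      case True
      then obtain k where k: "(1 / c) ^ k *\<^sub>R x \<in> A" using cover by blast
      have "(\<Sum>j\<in>{k}. h x * indicator A ((1 / c) ^ j *\<^sub>R x)) \<le> (\<Sum>k. h x * indicator A ((1 / c) ^ k *\<^sub>R x))"
        by (intro sum_le_suminf) auto
      then show ?thesis using k True by simp
    qed simp
  qed
  also have "\<dots> = (\<Sum>k. (\<integral>\<^sup>+x. h x * indicator A ((1 / c) ^ k *\<^sub>R x) \<partial>lborel))"
    by (intro nn_integral_suminf) auto
  also have "\<dots> \<le> (\<Sum>k. ennreal (r ^ k) * I)"
    by (intro suminf_le shell) auto
  also have "\<dots> = (\<Sum>k. ennreal (r ^ k)) * I"
    by simp
  also have "(\<Sum>k. ennreal (r ^ k)) = ennreal (\<Sum>k. r ^ k)"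
    using r by (intro suminf_ennreal2) (auto intro: summable_geometric)
  also have "ennreal (\<Sum>k. r ^ k) * I < \<infinity>"
    using fin by (simp add: I_def ennreal_mult_less_top)
  finally show ?thesis .
qed

lemma exists_shell_index:
  fixes y :: real assumes "y \<ge> 1"
  shows "\<exists>k. 1 \<le> (1 / 2) ^ k * y \<and> (1 / 2) ^ k * y < 2"
proof -
  obtain m where "y < 2 ^ m"
    using real_arch_pow[of 2 y] by auto
  then have ex: "\<exists>m. y < 2 ^ m" by blast
  define m where "m = (LEAST m. y < 2 ^ m)"
  have m: "y < 2 ^ m" unfolding m_def using ex by (rule LeastI_ex)
  have "m \<noteq> 0" using m assms by (intro notI) auto
  then obtain k where k: "m = Suc k" by (cases m) auto
  have "\<not> y < 2 ^ k" unfolding m_def using not_less_Least[of k "\<lambda>m. y < 2 ^ m"] k m_def by simp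
  then show ?thesis using m k by (intro exI[of _ k]) (auto simp: field_simps)
qed

lemma nn_integral_indicator_finite:
  fixes h :: "'a::euclidean_space \<Rightarrow> ennreal"
  assumes "\<And>x. x \<in> A \<Longrightarrow> h x \<le> ennreal B" "bounded A" "A \<in> sets borel"
  shows "(\<integral>\<^sup>+x\<in>A. h x \<partial>lborel) < \<infinity>"
proof -
  have "(\<integral>\<^sup>+x\<in>A. h x \<partial>lborel) \<le> (\<integral>\<^sup>+x\<in>A. ennreal B \<partial>lborel)"
    using assms(1) by (intro nn_integral_mono) (auto simp: indicator_def)
  also have "\<dots> = ennreal B * emeasure lborel A"
    using assms(3) by (simp add: nn_integral_cmult_indicator)
  also have "\<dots> < \<infinity>"
    using emeasure_bounded_finite[OF assms(2)] by (simp add: ennreal_mult_less_top)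
  finally show ?thesis .
qed

lemma nn_integral_norm_powr_infinity:
  assumes s: "s > real DIM('a)"
  shows "(\<integral>\<^sup>+x. ennreal (norm x powr - s) * indicator {x. norm x \<ge> 1} x \<partial>(lborel :: 'a::euclidean_space measure)) < \<infinity>"
proof (rule nn_integral_shells_finite[where c = 2 and r = "2 powr (real DIM('a) - s)" and A = "{x. 1 \<le> norm x \<and> norm x < 2}"])
  show "2 powr (real DIM('a) - s) < 1" using s by (simp add: powr_less_one)
  show "ennreal (2 ^ DIM('a)) * ennreal (norm (2 *\<^sub>R x) powr - s)
      \<le> ennreal (2 powr (real DIM('a) - s)) * ennreal (norm x powr - s)" for x :: 'a
    by (simp add: ennreal_mult'[symmetric] powr_mult powr_diff powr_minus powr_realpow field_simps)
  show "\<exists>k. (1 / 2) ^ k *\<^sub>R x \<in> {x. 1 \<le> norm x \<and> norm x < 2}" if "x \<in> {x. 1 \<le> norm x}" for x :: 'a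
    using exists_shell_index[of "norm x"] that by (auto simp: power_one_over)
  have "{x::'a. 1 \<le> norm x \<and> norm x < 2} \<subseteq> ball 0 2" by auto
  then have "bounded {x::'a. 1 \<le> norm x \<and> norm x < 2}" using bounded_ball bounded_subset by blast
  moreover have "norm x powr - s \<le> 1" if "norm x \<ge> 1" for x :: 'a
    using powr_mono[of "-s" 0 "norm x"] s that by (auto split: if_splits)
  ultimately show "(\<integral>\<^sup>+x. ennreal (norm x powr - s) * indicator {x. 1 \<le> norm x \<and> norm x < 2} x \<partial>(lborel :: 'a measure)) < \<infinity>"
    by (intro nn_integral_indicator_finite[where B = 1]) (auto intro: ennreal_leI)
qed auto

text \<open>The hypothesis \<open>hom\<close> is homogeneity of degree \<open>d - n\<close>, with
  \<open>n\<close> the dimension, tested on the factor \<open>1/2\<close> only. Halving a shell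
  divides the volume by \<open>2^n\<close> and multiplies \<open>h\<close> by at most
  \<open>2^(n-d)\<close>, so consecutive shells contribute with ratio \<open>2^(-d)\<close>.\<close>

lemma nn_integral_homogeneous_origin:
  fixes h :: "'a::euclidean_space \<Rightarrow> ennreal"
  assumes [measurable]: "h \<in> borel_measurable borel" and d: "d > 0"
    and hom: "\<And>x. h ((1 / 2) *\<^sub>R x) \<le> ennreal (2 powr (real DIM('a) - d)) * h x"
    and fin: "(\<integral>\<^sup>+x\<in>{x. 1 / 2 \<le> norm x \<and> norm x \<le> 1}. h x \<partial>lborel) < \<infinity>"
  shows "(\<integral>\<^sup>+x\<in>{x. 0 < norm x \<and> norm x \<le> 1}. h x \<partial>lborel) < \<infinity>"
proof (rule nn_integral_shells_finite[where c = "1/2" and r = "2 powr - d", OF _ _ _ _ _ _ _ fin])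
  show "2 powr - d < 1" using d by (simp add: powr_less_one)
  show "ennreal ((1/2) ^ DIM('a)) * h ((1/2) *\<^sub>R x) \<le> ennreal (2 powr - d) * h x" for x
  proof -
    have "ennreal ((1/2) ^ DIM('a)) * h ((1/2) *\<^sub>R x) \<le> ennreal ((1/2) ^ DIM('a)) * (ennreal (2 powr (real DIM('a) - d)) * h x)"
      by (intro mult_left_mono hom) auto
    also have "\<dots> = ennreal (2 powr - d) * h x"
      by (simp add: mult.assoc[symmetric] ennreal_mult'[symmetric] powr_diff powr_minus powr_realpow field_simps)
    finally show ?thesis .
  qed
  show "\<exists>k. (1 / (1/2)) ^ k *\<^sub>R x \<in> {x. 1 / 2 \<le> norm x \<and> norm x \<le> 1}" if "x \<in> {x. 0 < norm x \<and> norm x \<le> 1}" for x :: 'a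
  proof -
    \<comment> \<open>Doubling moves \<open>x\<close> outwards, so the index is the one found for
      the reciprocal of the norm.\<close>
    have "1 \<le> 1 / norm x" using that by (auto simp: field_simps)
    from exists_shell_index[OF this] obtain k where k: "1 \<le> (1 / 2) ^ k * (1 / norm x)" "(1 / 2) ^ k * (1 / norm x) < 2"
      by blast
    with that show ?thesis by (intro exI[of _ k]) (auto simp: field_simps)
  qed
qed auto

lemma nn_integral_norm_powr_origin:
  assumes s: "s < real DIM('a)"
  shows "(\<integral>\<^sup>+x. ennreal (norm x powr - s) * indicator {x. 0 < norm x \<and> norm x \<le> 1} x \<partial>(lborel :: 'a::euclidean_space measure)) < \<infinity>"
proof (rule nn_integral_homogeneous_origin[where d = "real DIM('a) - s"])
  show "ennreal (norm ((1 / 2) *\<^sub>R x) powr - s) \<le> ennreal (2 powr (real DIM('a) - (real DIM('a) - s))) * ennreal (norm x powr - s)" for x :: 'a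
    by (simp add: ennreal_mult'[symmetric] powr_minus powr_divide field_simps)
  have "{x::'a. 1 / 2 \<le> norm x \<and> norm x \<le> 1} \<subseteq> ball 0 2" by auto
  then have "bounded {x::'a. 1 / 2 \<le> norm x \<and> norm x \<le> 1}" using bounded_ball bounded_subset by blast
  moreover have "norm x powr - s \<le> 2 powr \<bar>s\<bar>" if "norm x \<ge> 1/2" "norm x \<le> 1" for x :: 'a
  proof -
    have "norm x powr - s \<le> norm x powr - \<bar>s\<bar>" using that by (intro powr_mono') auto
    also have "\<dots> \<le> (1/2) powr - \<bar>s\<bar>" using that by (intro powr_mono2') auto
    finally show ?thesis by (simp add: powr_minus powr_divide)
  qed
  ultimately show "(\<integral>\<^sup>+x. ennreal (norm x powr - s) * indicator {x. 1 / 2 \<le> norm x \<and> norm x \<le> 1} x \<partial>(lborel :: 'a measure)) < \<infinity>"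
    by (intro nn_integral_indicator_finite[where B = "2 powr \<bar>s\<bar>"]) (auto intro: ennreal_leI)
qed (use s in auto)

text \<open>By translation invariance the integral over the unit ball equals its average over the
  shifts \<open>t *\<^sub>R v\<close> with \<open>\<bar>t\<bar> \<le> 1\<close>. Exchanging the
  integrals leaves integrals along segments in direction \<open>v\<close>, with base points in the
  ball of radius 2.\<close>

lemma nn_integral_line_average_finite:
  fixes h :: "'a::euclidean_space \<Rightarrow> ennreal"
  assumes [measurable]: "h \<in> borel_measurable borel" and v: "norm v \<le> 1"
    and line: "\<And>x. norm x \<le> 2 \<Longrightarrow> (\<integral>\<^sup>+t\<in>{-1..1}. h (x + t *\<^sub>R v) \<partial>lborel) \<le> ennreal C"
  shows "(\<integral>\<^sup>+x\<in>cball 0 1. h x \<partial>lborel) < \<infinity>"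
proof -
  define I where "I = (\<integral>\<^sup>+x\<in>cball 0 1. h x \<partial>lborel)"
  have [measurable]: "cball (0::'a) r \<in> sets borel" for r
    by (intro borel_closed closed_cball)
  have "I = (\<integral>\<^sup>+x. h (t *\<^sub>R v + x) * indicator (cball 0 1) (t *\<^sub>R v + x) \<partial>lborel)" for t
    unfolding I_def by (subst nn_integral_lborel_affine[where c = 1 and t = "t *\<^sub>R v"]) auto
  \<comment> \<open>The factor 2 is the length of the interval of shifts.\<close>
  then have "2 * I = (\<integral>\<^sup>+t. (\<integral>\<^sup>+x. h (t *\<^sub>R v + x) * indicator (cball 0 1) (t *\<^sub>R v + x) \<partial>lborel) * indicator {-1..1::real} t \<partial>lborel)"
    by (simp add: nn_integral_cmult mult.commute)
  also have "\<dots> \<le> (\<integral>\<^sup>+t. (\<integral>\<^sup>+x. h (x + t *\<^sub>R v) * indicator (cball 0 2) x * indicator {-1..1} t \<partial>lborel) \<partial>lborel)"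
  proof (intro nn_integral_mono)
    fix t :: real
    have *: "indicator (cball 0 1) (t *\<^sub>R v + x) \<le> (indicator (cball 0 2) x :: ennreal)" if "t \<in> {-1..1}" for x
    proof -
      have "norm x \<le> norm (t *\<^sub>R v + x) + norm (t *\<^sub>R v)"
        by (metis add_diff_cancel_left' norm_triangle_ineq4 add.commute)
      moreover have "norm (t *\<^sub>R v) \<le> 1" using v that by (auto simp: abs_le_iff intro!: mult_le_one)
      ultimately show ?thesis by (auto simp: indicator_def)
    qed
    show "(\<integral>\<^sup>+x. h (t *\<^sub>R v + x) * indicator (cball 0 1) (t *\<^sub>R v + x) \<partial>lborel) * indicator {-1..1} t
       \<le> (\<integral>\<^sup>+x. h (x + t *\<^sub>R v) * indicator (cball 0 2) x * indicator {-1..1} t \<partial>lborel)"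
      by (cases "t \<in> {-1..1}") (auto simp: add.commute[of "t *\<^sub>R v"] intro!: nn_integral_mono mult_left_mono *[unfolded add.commute[of "t *\<^sub>R v"]])
  qed
  also have "\<dots> = (\<integral>\<^sup>+x. (\<integral>\<^sup>+t\<in>{-1..1}. h (x + t *\<^sub>R v) * indicator (cball 0 2) x \<partial>lborel) \<partial>lborel)"
    by (rule lborel_pair.Fubini') measurable
  also have "\<dots> = (\<integral>\<^sup>+x. (\<integral>\<^sup>+t\<in>{-1..1}. h (x + t *\<^sub>R v) \<partial>lborel) * indicator (cball 0 2) x \<partial>lborel)"
    by (intro nn_integral_cong, subst nn_integral_multc[symmetric]) (auto simp: mult_ac)
  also have "\<dots> < \<infinity>"
    using line by (intro nn_integral_indicator_finite[where B = C]) auto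
  finally show ?thesis unfolding I_def by (auto simp: ennreal_mult_less_top)
qed

subsection \<open>Polynomial functions and homogeneous parts of the symbol\<close>

text \<open>Polynomial functions with an upper bound \<open>d\<close> for the degree, not the exact
  degree. The bound is an integer so that differentiation lowers it by exactly 1, constants
  included: their derivative 0 carries every degree.\<close>

inductive polyf :: "int \<Rightarrow> (real ^ 'n::finite \<Rightarrow> complex) \<Rightarrow> bool" where
  polyf_zero: "polyf d (\<lambda>_. 0)"
| polyf_const: "0 \<le> d \<Longrightarrow> polyf d (\<lambda>_. c)"
| polyf_coord: "1 \<le> d \<Longrightarrow> polyf d (\<lambda>x. of_real (x $ i))"
| polyf_add: "polyf d f \<Longrightarrow> polyf d g \<Longrightarrow> polyf d (\<lambda>x. f x + g x)"
| polyf_mult: "polyf d f \<Longrightarrow> polyf e g \<Longrightarrow> polyf (d + e) (\<lambda>x. f x * g x)"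

lemma polyf_mono: "polyf d f \<Longrightarrow> d \<le> e \<Longrightarrow> polyf e f"
proof (induction arbitrary: e rule: polyf.induct)
  case (polyf_mult d f d' g)
  have "polyf ((e - d') + d') (\<lambda>x. f x * g x)"
    using polyf_mult by (intro polyf.polyf_mult polyf_mult.IH) auto
  then show ?case by simp
qed (auto intro: polyf.intros)

lemma polyf_cmult: "polyf d f \<Longrightarrow> polyf d (\<lambda>x. c * f x)"
  using polyf_mult[OF polyf_const[of 0 c]] by force

lemma polyf_diff: "polyf d f \<Longrightarrow> polyf d g \<Longrightarrow> polyf d (\<lambda>x. f x - g x)"
  using polyf_add[OF _ polyf_cmult[of d g "-1"]] by simp

lemma polyf_power: "polyf d f \<Longrightarrow> polyf (int m * d) (\<lambda>x. f x ^ m)"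
proof (induction m)
  case (Suc m)
  then have "polyf (d + int m * d) (\<lambda>x. f x * f x ^ m)" by (intro polyf_mult) auto
  then show ?case by (simp add: algebra_simps)
qed (auto intro: polyf_const)

lemma polyf_sum: "(\<And>k. k \<in> A \<Longrightarrow> polyf d (f k)) \<Longrightarrow> polyf d (\<lambda>x. \<Sum>k\<in>A. f k x)"
  by (induction A rule: infinite_finite_induct) (auto intro: polyf_zero polyf_add)

lemma polyf_prod: "finite A \<Longrightarrow> (\<And>k. k \<in> A \<Longrightarrow> polyf (d k) (f k)) \<Longrightarrow> polyf (\<Sum>k\<in>A. d k) (\<lambda>x. \<Prod>k\<in>A. f k x)"
  by (induction A rule: finite_induct) (auto intro: polyf_const polyf_mult)

lemma polyf_cnj: "polyf d f \<Longrightarrow> polyf d (\<lambda>x. cnj (f x))"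
  by (induction rule: polyf.induct) (auto intro: polyf.intros)

text \<open>The weight uses \<open>1 + norm x\<close>, which is at least 1, so that it grows with
  the exponent; \<open>powr\<close> admits the negative degree bounds of derivatives.\<close>

lemma polyf_bound: "polyf d f \<Longrightarrow> \<exists>C. \<forall>x. cmod (f x) \<le> C * (1 + norm x) powr of_int d"
proof (induction rule: polyf.induct)
  case (polyf_zero d)
  show ?case by (intro exI[of _ 0]) auto
next
  case (polyf_const d c)
  have "1 \<le> (1 + norm (x :: real ^ 'a)) powr real_of_int d" for x
    using polyf_const by (intro ge_one_powr_ge_zero) auto
  then have "cmod c * 1 \<le> cmod c * (1 + norm (x :: real ^ 'a)) powr real_of_int d" for x
    by (intro mult_left_mono) auto
  then show ?case by auto
next
  case (polyf_coord d i)
  have "\<bar>x $ i\<bar> \<le> (1 + norm x) powr real_of_int d" for x :: "real ^ 'a"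
  proof -
    have "\<bar>x $ i\<bar> \<le> (1 + norm x) powr 1" using component_le_norm_cart[of x i] by simp
    also have "\<dots> \<le> (1 + norm x) powr real_of_int d" using polyf_coord by (intro powr_mono) auto
    finally show ?thesis .
  qed
  then show ?case by (intro exI[of _ 1]) simp
next
  case (polyf_add d f g)
  then obtain C C' where "\<forall>x. cmod (f x) \<le> C * (1 + norm x) powr of_int d" "\<forall>x. cmod (g x) \<le> C' * (1 + norm x) powr of_int d"
    by blast
  then have "cmod (f x + g x) \<le> (C + C') * (1 + norm x) powr of_int d" for x
    using norm_triangle_ineq[of "f x" "g x"] by (simp add: distrib_right) (meson add_mono order_trans)
  then show ?case by blast
next
  case (polyf_mult d f e g)
  then obtain C C' where CC: "\<forall>x. cmod (f x) \<le> C * (1 + norm x) powr of_int d" "\<forall>x. cmod (g x) \<le> C' * (1 + norm x) powr of_int e"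
    by blast
  have "cmod (f x * g x) \<le> (C * C') * (1 + norm x) powr of_int (d + e)" for x
  proof -
    have "cmod (f x * g x) \<le> (C * (1 + norm x) powr of_int d) * (C' * (1 + norm x) powr of_int e)"
      unfolding norm_mult using CC by (intro mult_mono) (auto intro: order_trans[OF norm_ge_zero])
    then show ?thesis by (simp add: powr_add mult_ac)
  qed
  then show ?case by blast
qed

lemma polyf_derivative:
  "polyf d f \<Longrightarrow> \<exists>D. (\<forall>x. (f has_derivative D x) (at x)) \<and> (\<forall>v. polyf (d - 1) (\<lambda>x. D x v))"
proof (induction rule: polyf.induct)
  case (polyf_coord d i)
  have "((\<lambda>x::real ^ 'a. complex_of_real (x $ i)) has_derivative (\<lambda>v. of_real (v $ i))) (at x)" for x
    by (intro derivative_intros bounded_linear.has_derivative[OF bounded_linear_of_real]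
      bounded_linear.has_derivative[OF bounded_linear_vec_nth] has_derivative_ident)
  moreover have "polyf (d - 1) (\<lambda>x::real ^ 'a. complex_of_real (v $ i))" for v :: "real ^ 'a"
    using polyf_coord by (intro polyf_const) auto
  ultimately show ?case by (intro exI[of _ "\<lambda>x v. of_real (v $ i)"]) auto
next
  case (polyf_add d f g)
  then obtain D E where "\<forall>x. (f has_derivative D x) (at x)" "\<forall>v. polyf (d - 1) (\<lambda>x. D x v)"
    "\<forall>x. (g has_derivative E x) (at x)" "\<forall>v. polyf (d - 1) (\<lambda>x. E x v)" by blast
  then show ?case
    by (intro exI[of _ "\<lambda>x v. D x v + E x v"]) (auto intro!: has_derivative_add polyf.polyf_add)
next
  case (polyf_mult d f e g)
  then obtain D E where *: "\<forall>x. (f has_derivative D x) (at x)" "\<forall>v. polyf (d - 1) (\<lambda>x. D x v)"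
    "\<forall>x. (g has_derivative E x) (at x)" "\<forall>v. polyf (e - 1) (\<lambda>x. E x v)" by blast
  have "polyf (d + e - 1) (\<lambda>x. f x * E x v + D x v * g x)" for v
  proof (intro polyf_add)
    show "polyf (d + e - 1) (\<lambda>x. f x * E x v)"
      using polyf.polyf_mult[OF polyf_mult.hyps(1), of "e - 1" "\<lambda>x. E x v"] * by (simp add: algebra_simps)
    show "polyf (d + e - 1) (\<lambda>x. D x v * g x)"
      using polyf.polyf_mult[of "d - 1" "\<lambda>x. D x v", OF _ polyf_mult.hyps(2)] * by (simp add: algebra_simps)
  qed
  then show ?case
    using * by (intro exI[of _ "\<lambda>x v. f x * E x v + D x v * g x"]) (auto intro!: has_derivative_mult)
qed (auto intro!: exI[of _ "\<lambda>_ _. 0"] polyf.polyf_zero)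

lemma polyf_continuous: "polyf d f \<Longrightarrow> continuous_on S f"
  by (meson polyf_derivative continuous_at_imp_continuous_on has_derivative_continuous)

section \<open>Decomposition of the symbol into homogeneous parts, and independence of
  monomials\<close>

lemma finite_mi_length_le: "finite {k :: 'n::finite multiindex. mi_length k \<le> m}"
proof (rule finite_subset)
  show "{k :: 'n multiindex. mi_length k \<le> m} \<subseteq> Pi\<^sub>E UNIV (\<lambda>_. {..m})"
  proof (intro subsetI PiE_I)
    fix k :: "'n multiindex" and i assume "k \<in> {k. mi_length k \<le> m}"
    then show "k i \<in> {..m}"
      using member_le_sum[of i UNIV k] by (auto simp: mi_length_def)
  qed auto
qed (auto intro: finite_PiE)

lemma finite_mi_length_eq: "finite {k :: 'n::finite multiindex. mi_length k = m}"
  by (rule finite_subset[OF _ finite_mi_length_le[of m]]) auto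

text \<open>\<open>principal_symbol j\<close> is used for every \<open>j\<close>, not just for the
  order of the operator: it is the homogeneous part of degree \<open>j\<close> of the symbol. The
  proof groups the multiindices by length.\<close>

lemma symbol_eq_sum_homogeneous: "symbol \<alpha> a \<xi> = (\<Sum>j\<le>\<alpha>. principal_symbol j a \<xi>)"
proof -
  have mono: "(\<Prod>i\<in>UNIV. (2 * of_real pi * \<i> * of_real (\<xi> $ i)) ^ k i)
      = (2 * of_real pi * \<i>) ^ mi_length k * complex_of_real (\<Prod>i\<in>UNIV. (\<xi> $ i) ^ k i)" for k
    by (simp add: power_mult_distrib prod.distrib mi_length_def power_sum)
  have "principal_symbol j a \<xi> = (\<Sum>k\<in>{k \<in> {k. mi_length k \<le> \<alpha>}. mi_length k = j}. of_real (a k) * (\<Prod>i\<in>UNIV. (2 * of_real pi * \<i> * of_real (\<xi> $ i)) ^ k i))"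
    if "j \<le> \<alpha>" for j
  proof -
    have "{k \<in> {k. mi_length k \<le> \<alpha>}. mi_length k = j} = {k :: 'a multiindex. mi_length k = j}" using that by auto
    then show ?thesis
      unfolding principal_symbol_def of_real_sum sum_distrib_left mono by (auto intro!: sum.cong)
  qed
  then have "(\<Sum>j\<le>\<alpha>. principal_symbol j a \<xi>) = (\<Sum>j\<le>\<alpha>. \<Sum>k\<in>{k \<in> {k. mi_length k \<le> \<alpha>}. mi_length k = j}. of_real (a k) * (\<Prod>i\<in>UNIV. (2 * of_real pi * \<i> * of_real (\<xi> $ i)) ^ k i))"
    by (intro sum.cong) auto
  also have "\<dots> = symbol \<alpha> a \<xi>"
    unfolding symbol_def by (rule sum.group) (auto simp: finite_mi_length_le)
  finally show ?thesis by simp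
qed

lemma polyf_principal_symbol: "polyf (int j) (principal_symbol j a)"
proof -
  have "polyf (int j) (\<lambda>\<xi>. complex_of_real (a k) * (\<Prod>i\<in>UNIV. complex_of_real (\<xi> $ i) ^ k i))" if "mi_length k = j" for k
  proof (rule polyf_cmult)
    have "polyf (\<Sum>i\<in>UNIV. int (k i) * 1) (\<lambda>\<xi>. \<Prod>i\<in>UNIV. complex_of_real (\<xi> $ i) ^ k i)"
      by (intro polyf_prod polyf_power polyf_coord) auto
    then show "polyf (int j) (\<lambda>\<xi>. \<Prod>i\<in>UNIV. complex_of_real (\<xi> $ i) ^ k i)"
      using that by (simp add: mi_length_def flip: of_nat_sum)
  qed
  then have "polyf (int j) (\<lambda>\<xi>. (2 * of_real pi * \<i>) ^ j * (\<Sum>k | mi_length k = j. complex_of_real (a k) * (\<Prod>i\<in>UNIV. complex_of_real (\<xi> $ i) ^ k i)))"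
    by (intro polyf_cmult[where c = "(2 * of_real pi * \<i>) ^ j"] polyf_sum) auto
  then show ?thesis by (simp add: principal_symbol_def[abs_def])
qed

lemma polyf_symbol: "polyf (int \<alpha>) (symbol \<alpha> a)"
  unfolding symbol_eq_sum_homogeneous[abs_def]
  by (intro polyf_sum polyf_mono[OF polyf_principal_symbol]) auto

lemma principal_symbol_scaleR: "principal_symbol j a (r *\<^sub>R \<xi>) = of_real r ^ j * principal_symbol j a \<xi>"
proof -
  have "(\<Prod>i\<in>UNIV. ((r *\<^sub>R \<xi>) $ i) ^ k i) = r ^ j * (\<Prod>i\<in>UNIV. (\<xi> $ i) ^ k i)" if "mi_length k = j" for k
    using that by (auto simp: power_mult_distrib prod.distrib mi_length_def power_sum)
  then have "(\<Sum>k | mi_length k = j. a k * (\<Prod>i\<in>UNIV. ((r *\<^sub>R \<xi>) $ i) ^ k i))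
      = r ^ j * (\<Sum>k | mi_length k = j. a k * (\<Prod>i\<in>UNIV. (\<xi> $ i) ^ k i))"
    unfolding sum_distrib_left by (intro sum.cong) (auto simp: mult_ac)
  then show ?thesis by (simp add: principal_symbol_def)
qed

text \<open>By homogeneity it suffices to bound the part on the unit sphere, where the growth bound
  of \<open>polyf_bound\<close> reads \<open>C * 2 ^ j\<close>.\<close>

lemma principal_symbol_bound: "\<exists>C\<ge>0. \<forall>\<xi>. cmod (principal_symbol j a \<xi>) \<le> C * norm \<xi> ^ j"
proof -
  obtain C where C: "\<forall>x. cmod (principal_symbol j a x) \<le> C * (1 + norm x) powr of_int (int j)"
    using polyf_bound[OF polyf_principal_symbol] by blast
  have "cmod (principal_symbol j a \<xi>) \<le> (\<bar>C\<bar> * 2 ^ j) * norm \<xi> ^ j" for \<xi>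
  proof (cases "\<xi> = 0")
    case True
    \<comment> \<open>Scaling by 0 gives the value 0 in positive degree; in degree 0 the convention
      \<open>0 ^ 0 = 1\<close> keeps both sides in agreement.\<close>
    have "cmod (principal_symbol j a 0) = 0 ^ j * cmod (principal_symbol j a \<xi>)"
      using arg_cong[OF principal_symbol_scaleR[of j a 0 \<xi>], of cmod] by (simp add: norm_power norm_mult)
    moreover have "cmod (principal_symbol j a 0) \<le> \<bar>C\<bar> * 1" using C[rule_format, of 0] by simp
    ultimately show ?thesis using True by (cases j) (auto simp: zero_power)
  next
    case False
    have "principal_symbol j a \<xi> = of_real (norm \<xi>) ^ j * principal_symbol j a ((1 / norm \<xi>) *\<^sub>R \<xi>)"
      using False by (subst principal_symbol_scaleR[symmetric]) simp
    then have "cmod (principal_symbol j a \<xi>) = norm \<xi> ^ j * cmod (principal_symbol j a ((1 / norm \<xi>) *\<^sub>R \<xi>))"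
      by (simp add: norm_mult norm_power)
    also have "\<dots> \<le> norm \<xi> ^ j * (\<bar>C\<bar> * 2 ^ j)"
    proof (intro mult_left_mono)
      have "cmod (principal_symbol j a ((1 / norm \<xi>) *\<^sub>R \<xi>)) \<le> C * 2 ^ j"
        using C[rule_format, of "(1 / norm \<xi>) *\<^sub>R \<xi>"] False by (simp add: powr_realpow)
      also have "\<dots> \<le> \<bar>C\<bar> * 2 ^ j" by (intro mult_right_mono) auto
      finally show "cmod (principal_symbol j a ((1 / norm \<xi>) *\<^sub>R \<xi>)) \<le> \<bar>C\<bar> * 2 ^ j" .
    qed auto
    finally show ?thesis by (simp add: mult_ac)
  qed
  then show ?thesis by (intro exI[of _ "\<bar>C\<bar> * 2 ^ j"]) auto
qed

text \<open>Induction on the number of variables. Freezing all variables but \<open>j\<close> leaves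
  a polynomial in one variable that vanishes on all reals, so all its coefficients vanish; the one
  belonging to \<open>k j\<close> is a combination of monomials in the remaining variables.
  Distinctness of exponents passes to \<open>T\<close>, since its members already agree at
  \<open>j\<close>.\<close>

lemma monomials_independent:
  fixes c :: "('i \<Rightarrow> nat) \<Rightarrow> real"
  assumes "finite I" "finite S"
    and "\<And>k k'. k \<in> S \<Longrightarrow> k' \<in> S \<Longrightarrow> (\<And>i. i \<in> I \<Longrightarrow> k i = k' i) \<Longrightarrow> k = k'"
    and "\<And>x :: 'i \<Rightarrow> real. (\<Sum>k\<in>S. c k * (\<Prod>i\<in>I. x i ^ k i)) = 0"
    and "k \<in> S"
  shows "c k = 0"
  using assms
proof (induction I arbitrary: S k rule: finite_induct)
  case empty
  then have "S = {k}" by auto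
  then show ?case using empty(3)[of undefined] by simp
next
  case (insert j I)
  define T where "T = {k' \<in> S. k' j = k j}"
  have "(\<Sum>k\<in>T. c k * (\<Prod>i\<in>I. x i ^ k i)) = 0" for x :: "'i \<Rightarrow> real"
  proof -
    define q where "q = (\<Sum>k\<in>S. monom (c k * (\<Prod>i\<in>I. x i ^ k i)) (k j))"
    have "poly q t = 0" for t
    proof -
      have "(\<Prod>i\<in>insert j I. (x(j := t)) i ^ k i) = t ^ k j * (\<Prod>i\<in>I. x i ^ k i)" for k :: "'i \<Rightarrow> nat"
      proof -
        have "(\<Prod>i\<in>I. (x(j := t)) i ^ k i) = (\<Prod>i\<in>I. x i ^ k i)"
          using insert.hyps by (intro prod.cong) auto
        then show ?thesis using insert.hyps by simp
      qed
      then have "poly q t = (\<Sum>k\<in>S. c k * (\<Prod>i\<in>insert j I. (x(j := t)) i ^ k i))"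
        unfolding q_def poly_sum by (auto simp: poly_monom mult_ac intro!: sum.cong)
      then show ?thesis using insert.prems(3) by simp
    qed
    then have "q = 0" using poly_all_0_iff_0 by blast
    then have "0 = coeff q (k j)" by simp
    also have "\<dots> = (\<Sum>k'\<in>S. if k' j = k j then c k' * (\<Prod>i\<in>I. x i ^ k' i) else 0)"
      unfolding q_def coeff_sum by simp
    also have "\<dots> = (\<Sum>k\<in>T. c k * (\<Prod>i\<in>I. x i ^ k i))"
      unfolding T_def using insert.prems(1) by (rule sum.inter_filter[symmetric])
    finally show ?thesis by simp
  qed
  moreover have "k' = k''" if "k' \<in> T" "k'' \<in> T" "\<And>i. i \<in> I \<Longrightarrow> k' i = k'' i" for k' k''
    using that by (intro insert.prems(2)) (auto simp: T_def)
  ultimately show ?case using insert.IH[of T k] insert.prems(1,4) by (auto simp: T_def)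
qed

lemma principal_symbol_nonzero:
  assumes "a k \<noteq> 0" "mi_length k = j"
  shows "\<exists>\<xi>. principal_symbol j a \<xi> \<noteq> 0"
proof (rule ccontr)
  assume *: "\<nexists>\<xi>. principal_symbol j a \<xi> \<noteq> 0"
  have "(\<Sum>k\<in>{k. mi_length k = j}. a k * (\<Prod>i\<in>UNIV. x i ^ k i)) = 0" for x :: "'a \<Rightarrow> real"
  proof -
    have "principal_symbol j a (\<chi> i. x i) = 0" using * by blast
    then show ?thesis by (simp add: principal_symbol_def del: of_real_sum of_real_mult of_real_prod)
  qed
  then have "a k = 0"
    using assms by (intro monomials_independent[of UNIV "{k. mi_length k = j}" a k]) (auto simp: finite_mi_length_eq)
  then show False using assms by simp
qed

subsection \<open>Negative powers of polynomials\<close>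

text \<open>In HOL \<open>0 powr - \<delta>\<close> is 0, which would hide the singularity on a zero
  set. The value there is set to infinity, so that for \<open>\<delta> \<ge> 0\<close> the function
  is decreasing on the nonnegative reals, zero included.\<close>

definition inv_powr :: "real \<Rightarrow> real \<Rightarrow> ennreal" where
  "inv_powr \<delta> y = (if y = 0 then \<infinity> else ennreal (y powr - \<delta>))"

lemma measurable_inv_powr [measurable]: "inv_powr \<delta> \<in> borel_measurable borel"
  unfolding inv_powr_def[abs_def] by measurable

lemma inv_powr_antimono: "\<delta> \<ge> 0 \<Longrightarrow> 0 \<le> y \<Longrightarrow> y \<le> z \<Longrightarrow> inv_powr \<delta> z \<le> inv_powr \<delta> y"
  by (auto simp: inv_powr_def intro!: ennreal_leI powr_mono2')

lemma inv_powr_mult: "c > 0 \<Longrightarrow> y \<ge> 0 \<Longrightarrow> inv_powr \<delta> (c * y) = ennreal (c powr - \<delta>) * inv_powr \<delta> y"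
  by (auto simp: inv_powr_def powr_mult ennreal_mult ennreal_mult_top)

lemma inv_powr_power: "n > 0 \<Longrightarrow> y \<ge> 0 \<Longrightarrow> inv_powr \<delta> (y ^ n) = inv_powr (\<delta> * real n) y"
  by (auto simp: inv_powr_def powr_realpow[symmetric] powr_powr mult.commute)

text \<open>The bound is uniform in the position of the singularity: within distance 1 of
  \<open>a\<close> the integral is at most that of \<open>\<bar>u\<bar> powr - s\<close> around the
  origin; farther away the integrand is at most 1, which adds at most 2. The infinite value sits on
  the null set \<open>{a}\<close>.\<close>

lemma nn_integral_inv_powr_real:
  assumes s: "0 \<le> s" "s < 1"
  shows "\<exists>J\<ge>0. \<forall>a. (\<integral>\<^sup>+t\<in>{-1..1}. inv_powr s \<bar>t - a\<bar> \<partial>lborel) \<le> ennreal J"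
proof -
  let ?K = "\<lambda>u::real. ennreal (norm u powr - s) * indicator {x. 0 < norm x \<and> norm x \<le> 1} u"
  define J0 where "J0 = (\<integral>\<^sup>+u. ?K u \<partial>lborel)"
  have J0: "J0 < \<infinity>" unfolding J0_def using s by (intro nn_integral_norm_powr_origin) auto
  have "(\<integral>\<^sup>+t\<in>{-1..1}. inv_powr s \<bar>t - a\<bar> \<partial>lborel) \<le> J0 + 2" for a
  proof -
    have "(\<integral>\<^sup>+t\<in>{-1..1}. inv_powr s \<bar>t - a\<bar> \<partial>lborel)
        \<le> (\<integral>\<^sup>+t. (?K (-a + 1 *\<^sub>R t) + indicator {-1..1} t) + \<infinity> * indicator {a} t \<partial>lborel)"
    proof (intro nn_integral_mono)
      fix t :: real
      have "\<bar>t - a\<bar> powr - s \<le> 1" if "\<bar>t - a\<bar> > 1"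
        using powr_mono[of "-s" 0 "\<bar>t - a\<bar>"] s that by (auto split: if_splits)
      then show "inv_powr s \<bar>t - a\<bar> * indicator {-1..1} t
          \<le> (?K (-a + 1 *\<^sub>R t) + indicator {-1..1} t) + \<infinity> * indicator {a} t"
        by (auto simp: inv_powr_def indicator_def intro: ennreal_leI)
    qed
    also have "\<dots> = (\<integral>\<^sup>+t. ?K (-a + 1 *\<^sub>R t) \<partial>lborel) + 2 + 0"
      by (simp add: nn_integral_add nn_integral_cmult)
    also have "(\<integral>\<^sup>+t. ?K (-a + 1 *\<^sub>R t) \<partial>lborel) = J0"
      unfolding J0_def using nn_integral_lborel_affine[of ?K 1 "-a"] by simp
    finally show ?thesis by simp
  qed
  moreover have "J0 + 2 = ennreal (enn2real J0 + 2)"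
    using J0 by (simp add: ennreal_plus)
  ultimately show ?thesis by (intro exI[of _ "enn2real J0 + 2"]) auto
qed

text \<open>The smallest factor works. It lets the nearest root of a polynomial stand for all of its
  roots.\<close>

lemma exists_power_le_prod:
  fixes x :: "nat \<Rightarrow> real"
  assumes "n > 0" "\<And>i. x i \<ge> 0"
  shows "\<exists>i<n. x i ^ n \<le> (\<Prod>i<n. x i)"
proof -
  have "Min (x ` {..<n}) \<in> x ` {..<n}" using assms by (intro Min_in) auto
  then obtain i where i: "i < n" "Min (x ` {..<n}) = x i" by auto
  have "x i \<le> x j" if "j < n" for j
    using that unfolding i(2)[symmetric] by (intro Min_le) auto
  then have "(\<Prod>j<n. x i) \<le> (\<Prod>j<n. x j)"
    using assms(2) by (intro prod_mono) auto
  then show ?thesis using i by auto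
qed

text \<open>The distances to the roots multiply to at least the \<open>d\<close>-th power of the
  smallest one, and passing to the real part of a root only decreases the distance. The nearest root
  varies with \<open>t\<close>, so the sum over all roots serves as the bound. The constant depends
  on \<open>q\<close> only through its degree and the modulus of its leading coefficient, which
  allows all parallel lines to be treated at once.\<close>

lemma nn_integral_inv_powr_poly:
  fixes m \<delta> :: real and d :: nat
  assumes "m > 0" "\<delta> \<ge> 0" "\<delta> * real d < 1"
  shows "\<exists>C\<ge>0. \<forall>q :: complex poly. degree q = d \<longrightarrow> cmod (lead_coeff q) = m \<longrightarrow>
    (\<integral>\<^sup>+t\<in>{-1..1}. inv_powr \<delta> (cmod (poly q (of_real t))) \<partial>lborel) \<le> ennreal C"
proof -
  obtain J where J: "J \<ge> 0" "\<And>a. (\<integral>\<^sup>+t\<in>{-1..1}. inv_powr (\<delta> * real d) \<bar>t - a\<bar> \<partial>lborel) \<le> ennreal J"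
    using nn_integral_inv_powr_real[of "\<delta> * real d"] assms by auto
  have "(\<integral>\<^sup>+t\<in>{-1..1}. inv_powr \<delta> (cmod (poly q (of_real t))) \<partial>lborel)
      \<le> ennreal (m powr - \<delta> * (2 + real d * J))"
    if q: "degree q = d" "cmod (lead_coeff q) = m" for q :: "complex poly"
  proof -
    obtain root where dec: "smult (lead_coeff q) (\<Prod>i<degree q. [:- root i, 1:]) = q"
      using complex_poly_decompose' by blast
    let ?R = "\<lambda>i t. inv_powr (\<delta> * real d) \<bar>t - Re (root i)\<bar>"
    from dec have "cmod (poly q (of_real t)) = cmod (poly (smult (lead_coeff q) (\<Prod>i<degree q. [:- root i, 1:])) (of_real t))" for t
      by simp
    then have eq: "cmod (poly q (of_real t)) = m * (\<Prod>i<d. cmod (of_real t - root i))" for t :: real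
      using q by (simp add: norm_mult poly_prod prod_norm[symmetric] add.commute)
    have le: "inv_powr \<delta> (cmod (poly q (of_real t)))
        \<le> ennreal (m powr - \<delta>) * (1 + (\<Sum>i<d. ?R i t))" for t
    proof (cases "d = 0")
      case True
      then show ?thesis using assms by (simp add: eq inv_powr_def)
    next
      case False
      obtain i where i: "i < d" "cmod (of_real t - root i) ^ d \<le> (\<Prod>i<d. cmod (of_real t - root i))"
        using exists_power_le_prod[of d "\<lambda>i. cmod (of_real t - root i)"] False by auto
      have "\<bar>t - Re (root i)\<bar> \<le> cmod (of_real t - root i)"
        using abs_Re_le_cmod[of "of_real t - root i"] by simp
      then have "m * \<bar>t - Re (root i)\<bar> ^ d \<le> cmod (poly q (of_real t))"
        unfolding eq using assms i by (intro mult_left_mono order_trans[OF power_mono i(2)]) auto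
      then have "inv_powr \<delta> (cmod (poly q (of_real t))) \<le> inv_powr \<delta> (m * \<bar>t - Re (root i)\<bar> ^ d)"
        using assms by (intro inv_powr_antimono) auto
      also have "\<dots> = ennreal (m powr - \<delta>) * ?R i t"
        using assms False by (simp add: inv_powr_mult inv_powr_power)
      also have "?R i t \<le> (\<Sum>i<d. ?R i t)"
        using i by (intro member_le_sum[of i "{..<d}" "\<lambda>i. ?R i t"]) auto
      also have "\<dots> \<le> 1 + (\<Sum>i<d. ?R i t)" by simp
      finally show ?thesis by (simp add: mult_left_mono)
    qed
    have "(\<integral>\<^sup>+t\<in>{-1..1}. inv_powr \<delta> (cmod (poly q (of_real t))) \<partial>lborel)
      \<le> (\<integral>\<^sup>+t. ennreal (m powr - \<delta>) * (indicator {-1..1} t + (\<Sum>i<d. ?R i t * indicator {-1..1} t)) \<partial>lborel)"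
      using le by (intro nn_integral_mono) (auto simp: indicator_def)
    also have "\<dots> = ennreal (m powr - \<delta>) * (\<integral>\<^sup>+t. indicator {-1..1} t + (\<Sum>i<d. ?R i t * indicator {-1..1} t) \<partial>lborel)"
      by (intro nn_integral_cmult) measurable
    also have "(\<integral>\<^sup>+t. indicator {-1..1} t + (\<Sum>i<d. ?R i t * indicator {-1..1} t) \<partial>lborel)
      = (\<integral>\<^sup>+t. indicator {-1..1::real} t \<partial>lborel) + (\<integral>\<^sup>+t. (\<Sum>i<d. ?R i t * indicator {-1..1} t) \<partial>lborel)"
      by (intro nn_integral_add) measurable
    also have "(\<integral>\<^sup>+t. indicator {-1..1::real} t \<partial>lborel) = 2"
      by simp
    also have "(\<integral>\<^sup>+t. (\<Sum>i<d. ?R i t * indicator {-1..1} t) \<partial>lborel)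
      = (\<Sum>i<d. (\<integral>\<^sup>+t\<in>{-1..1}. ?R i t \<partial>lborel))"
      by (intro nn_integral_sum) measurable
    also have "ennreal (m powr - \<delta>) * (2 + (\<Sum>i<d. (\<integral>\<^sup>+t\<in>{-1..1}. ?R i t \<partial>lborel)))
      \<le> ennreal (m powr - \<delta>) * (2 + (\<Sum>i<d. ennreal J))"
      by (intro mult_left_mono add_left_mono sum_mono J) auto
    also have "\<dots> = ennreal (m powr - \<delta> * (2 + real d * J))"
      using J by (simp add: ennreal_mult ennreal_plus ennreal_of_nat_eq_real_of_nat)
    finally show ?thesis .
  qed
  then show ?thesis using J by (intro exI[of _ "m powr - \<delta> * (2 + real d * J)"]) auto
qed

text \<open>Degree bounds are propagated instead of exact degrees: the coordinates along a line are
  polynomials of degree at most 1 that become constant when the direction has a zero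
  component.\<close>

lemma degree_le_coeff_mult:
  fixes p q :: "'a::comm_semiring_0 poly"
  assumes "degree p \<le> d" "degree q \<le> e"
  shows "degree (p * q) \<le> d + e \<and> coeff (p * q) (d + e) = coeff p d * coeff q e"
proof
  show "degree (p * q) \<le> d + e" using degree_mult_le[of p q] assms by simp
  have "coeff (p * q) (d + e) = (\<Sum>i\<le>d + e. if i = d then coeff p d * coeff q e else 0)"
    unfolding coeff_mult
  proof (intro sum.cong refl)
    fix i assume "i \<in> {..d + e}"
    then show "coeff p i * coeff q (d + e - i) = (if i = d then coeff p d * coeff q e else 0)"
      using assms by (cases "i < d"; cases "i > d") (auto simp: coeff_eq_0)
  qed
  then show "coeff (p * q) (d + e) = coeff p d * coeff q e" by simp
qed

text \<open>Restricted to the line through \<open>x\<close> in direction \<open>v\<close>, the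
  homogeneous part is a polynomial whose coefficient at \<open>t^j\<close> is its value at
  \<open>v\<close>, whatever \<open>x\<close> is. If that value is nonzero, all parallel lines share
  degree and leading coefficient.\<close>

lemma principal_symbol_on_line:
  obtains q :: "complex poly"
  where "degree q \<le> j" "coeff q j = principal_symbol j a v"
    "\<And>t. poly q (of_real t) = principal_symbol j a (x + t *\<^sub>R v)"
proof -
  define l where "l i = [:complex_of_real (x $ i), of_real (v $ i):]" for i
  have pow: "degree (l i ^ k) \<le> k \<and> coeff (l i ^ k) k = of_real (v $ i) ^ k" for i k
  proof (induction k)
    case (Suc k)
    then show ?case using degree_le_coeff_mult[of "l i" 1 "l i ^ k" k] by (simp add: l_def)
  qed simp
  have prod: "degree (\<Prod>i\<in>A. l i ^ k i) \<le> (\<Sum>i\<in>A. k i) \<and> coeff (\<Prod>i\<in>A. l i ^ k i) (\<Sum>i\<in>A. k i) = (\<Prod>i\<in>A. of_real (v $ i) ^ k i)"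
    if "finite A" for A k using that
  proof (induction A rule: finite_induct)
    case (insert i A)
    then show ?case using degree_le_coeff_mult[of "l i ^ k i" "k i" "\<Prod>i\<in>A. l i ^ k i" "\<Sum>i\<in>A. k i"] pow[of i "k i"] by simp
  qed simp
  define q where "q = smult ((2 * of_real pi * \<i>) ^ j) (\<Sum>k | mi_length k = j. smult (of_real (a k)) (\<Prod>i\<in>UNIV. l i ^ k i))"
  have 1: "degree (\<Prod>i\<in>UNIV. l i ^ k i) \<le> j" "coeff (\<Prod>i\<in>UNIV. l i ^ k i) j = (\<Prod>i\<in>UNIV. of_real (v $ i) ^ k i)"
    if "mi_length k = j" for k using prod[of UNIV k] that by (auto simp: mi_length_def)
  show thesis
  proof
    show "degree q \<le> j"
      unfolding q_def using 1(1)
      by (intro order_trans[OF degree_smult_le] degree_sum_le finite_mi_length_eq) (auto intro: order_trans[OF degree_smult_le])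
    show "coeff q j = principal_symbol j a v"
      by (simp add: q_def coeff_sum principal_symbol_def 1(2))
    show "poly q (of_real t) = principal_symbol j a (x + t *\<^sub>R v)" for t
      by (simp add: q_def poly_sum principal_symbol_def poly_prod l_def)
  qed
qed

lemma principal_symbol_measurable [measurable]: "principal_symbol j a \<in> borel_measurable borel"
  by (intro borel_measurable_continuous_onI polyf_continuous[OF polyf_principal_symbol])

lemma symbol_measurable [measurable]: "symbol \<alpha> a \<in> borel_measurable borel"
  by (intro borel_measurable_continuous_onI polyf_continuous[OF polyf_symbol])

lemma nn_integral_inv_powr_principal_symbol:
  assumes "principal_symbol j a \<xi>0 \<noteq> 0" "\<delta> \<ge> 0" "\<delta> * real j < 1"
  shows "(\<integral>\<^sup>+\<xi>\<in>cball 0 1. inv_powr \<delta> (cmod (principal_symbol j a \<xi>)) \<partial>lborel) < \<infinity>"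
proof -
  \<comment> \<open>Shrinking \<open>\<xi>0\<close> into the unit ball keeps the value nonzero by
    homogeneity; the denominator is safe even for \<open>\<xi>0 = 0\<close>, which can occur in
    degree 0.\<close>
  define v where "v = (1 / (1 + norm \<xi>0)) *\<^sub>R \<xi>0"
  have v: "norm v \<le> 1" unfolding v_def by (auto simp: divide_le_eq add_pos_nonneg)
  have "complex_of_real (1 / (1 + norm \<xi>0)) \<noteq> 0"
    using add_pos_nonneg[of 1 "norm \<xi>0"] by (auto simp del: of_real_divide of_real_add)
  then have nz: "principal_symbol j a v \<noteq> 0"
    unfolding v_def principal_symbol_scaleR using assms(1) by (auto simp del: of_real_divide of_real_add)
  obtain C where C: "C \<ge> 0" "\<And>q :: complex poly. degree q = j \<Longrightarrow> cmod (lead_coeff q) = cmod (principal_symbol j a v) \<Longrightarrow>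
    (\<integral>\<^sup>+t\<in>{-1..1}. inv_powr \<delta> (cmod (poly q (of_real t))) \<partial>lborel) \<le> ennreal C"
    using nn_integral_inv_powr_poly[of "cmod (principal_symbol j a v)" \<delta> j] nz assms by auto
  show ?thesis
  proof (rule nn_integral_line_average_finite[OF _ v, of _ C])
    fix x :: "real ^ 'a"
    obtain q where q: "degree q \<le> j" "coeff q j = principal_symbol j a v"
      "\<And>t. poly q (of_real t) = principal_symbol j a (x + t *\<^sub>R v)"
      using principal_symbol_on_line by metis
    have "degree q = j" using q nz by (metis le_antisym le_degree)
    then show "(\<integral>\<^sup>+t\<in>{-1..1}. inv_powr \<delta> (cmod (principal_symbol j a (x + t *\<^sub>R v))) \<partial>lborel) \<le> ennreal C"
      using C(2)[of q] q by simp
  qed simp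
qed

subsection \<open>The symbol near the origin\<close>

abbreviation symbol_bound :: "real \<Rightarrow> nat \<Rightarrow> ('n::finite multiindex \<Rightarrow> real) \<Rightarrow> bool" where
  "symbol_bound c1 \<alpha> a \<equiv> \<forall>\<xi>. norm (symbol \<alpha> a \<xi>) \<ge> c1 * norm \<xi> ^ \<alpha>"

lemma nonhomogeneous_lower_term:
  assumes "\<not> homogeneous \<alpha> a"
  obtains j \<xi> where "j < \<alpha>" "principal_symbol j a \<xi> \<noteq> 0" "\<And>i \<zeta>. i < j \<Longrightarrow> principal_symbol i a \<zeta> = 0"
proof -
  define j where "j = (LEAST j. \<exists>k. mi_length k = j \<and> a k \<noteq> 0)"
  obtain k0 where k0: "mi_length k0 < \<alpha>" "a k0 \<noteq> 0" using assms by (auto simp: homogeneous_def)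
  then have ex: "\<exists>k. mi_length k = mi_length k0 \<and> a k \<noteq> 0" by blast
  have "\<exists>k. mi_length k = j \<and> a k \<noteq> 0" unfolding j_def using ex by (rule LeastI)
  then obtain k where k: "mi_length k = j" "a k \<noteq> 0" by blast
  have "j \<le> mi_length k0" unfolding j_def using ex by (rule Least_le)
  then have "j < \<alpha>" using k0 by simp
  moreover obtain \<xi> where "principal_symbol j a \<xi> \<noteq> 0" using principal_symbol_nonzero[of a k j] k by auto
  moreover have "principal_symbol i a \<zeta> = 0" if "i < j" for i \<zeta>
  proof -
    have "\<not> (\<exists>k. mi_length k = i \<and> a k \<noteq> 0)"
      using that unfolding j_def by (rule not_less_Least)
    then have "a k = 0" if "mi_length k = i" for k using that by blast
    then show ?thesis by (simp add: principal_symbol_def)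
  qed
  ultimately show thesis using that by blast
qed

text \<open>On the unit ball every part of degree above \<open>j\<close> is bounded by a multiple of
  the power \<open>j + 1\<close> of the norm. The 1 added to the sum of constants secures
  \<open>C \<ge> 1\<close>, used later to compare the radius with the size of the lowest
  part.\<close>

lemma symbol_near_origin:
  assumes "j < \<alpha>" "\<And>i \<zeta>. i < j \<Longrightarrow> principal_symbol i a \<zeta> = 0"
  obtains C where "C \<ge> 1" "\<And>\<xi>. norm \<xi> \<le> 1 \<Longrightarrow> cmod (symbol \<alpha> a \<xi> - principal_symbol j a \<xi>) \<le> C * norm \<xi> ^ (j + 1)"
proof -
  obtain C where C: "\<And>i. C i \<ge> 0" "\<And>i \<xi>. cmod (principal_symbol i a \<xi>) \<le> C i * norm \<xi> ^ i"
    using principal_symbol_bound[of _ a] by metis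
  have "cmod (symbol \<alpha> a \<xi> - principal_symbol j a \<xi>) \<le> (1 + (\<Sum>i\<le>\<alpha>. C i)) * norm \<xi> ^ (j + 1)" if "norm \<xi> \<le> 1" for \<xi>
  proof -
    have "symbol \<alpha> a \<xi> = principal_symbol j a \<xi> + (\<Sum>i\<in>{..\<alpha>} - {j}. principal_symbol i a \<xi>)"
      unfolding symbol_eq_sum_homogeneous using assms(1) by (intro sum.remove) auto
    then have "cmod (symbol \<alpha> a \<xi> - principal_symbol j a \<xi>) \<le> (\<Sum>i\<in>{..\<alpha>} - {j}. cmod (principal_symbol i a \<xi>))"
      by (simp add: norm_sum)
    also have "\<dots> \<le> (\<Sum>i\<in>{..\<alpha>} - {j}. C i * norm \<xi> ^ (j + 1))"
    proof (intro sum_mono)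
      fix i assume i: "i \<in> {..\<alpha>} - {j}"
      show "cmod (principal_symbol i a \<xi>) \<le> C i * norm \<xi> ^ (j + 1)"
      proof (cases "i < j")
        case False
        then have "norm \<xi> ^ i \<le> norm \<xi> ^ (j + 1)" using i that by (intro power_decreasing) auto
        then show ?thesis using C(2)[of i \<xi>] mult_left_mono[OF _ C(1)[of i]] by (meson order_trans)
      qed (use assms(2) C in auto)
    qed
    also have "\<dots> \<le> (\<Sum>i\<le>\<alpha>. C i * norm \<xi> ^ (j + 1))"
      using C(1) by (intro sum_mono2) auto
    also have "\<dots> \<le> (1 + (\<Sum>i\<le>\<alpha>. C i)) * norm \<xi> ^ (j + 1)"
      by (simp add: sum_distrib_right distrib_right)
    finally show ?thesis .
  qed
  then show thesis using that[of "1 + (\<Sum>i\<le>\<alpha>. C i)"] C(1) by (simp add: sum_nonneg)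
qed

text \<open>Read \<open>r\<close> as the norm of \<open>\<xi>\<close>, \<open>t\<close> as the size
  of the lowest part at the normalised point and \<open>y\<close> as the modulus of the symbol. If
  \<open>t\<close> is at least \<open>2 * C * r\<close>, the lowest part dominates the error and
  \<open>near\<close> gives \<open>y \<ge> r ^ j * t / 2\<close>. Otherwise \<open>lower\<close> is
  used, and the ratio \<open>2 * C * r / t\<close>, now above 1, is inserted to the power
  \<open>\<delta>\<close>. Both cases gain \<open>r powr \<delta>\<close> over the critical power,
  at the price of \<open>t powr - \<delta>\<close>.\<close>

lemma singular_weight_bound:
  fixes r t s \<delta> C c y :: real
  assumes r: "0 < r" "r \<le> 1" and t: "t > 0" and s: "0 < \<delta>" "\<delta> \<le> s" and C: "C \<ge> 1" and c: "c > 0"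
    and j: "j < \<alpha>" and lower: "y \<ge> c * r ^ \<alpha>" and near: "y \<ge> r ^ j * t - C * r ^ (j + 1)"
  shows "y powr - s \<le> (2 powr s + c powr - s * (2 * C) powr \<delta>) * (r powr (\<delta> - s * real \<alpha>) * t powr - \<delta>)" (is "_ \<le> ?R")
proof (cases "2 * C * r \<le> t")
  case True
  have "r ^ j * t / 2 \<le> r ^ j * t - C * r ^ (j + 1)"
  proof -
    have "r ^ j * (2 * C * r) \<le> r ^ j * t" using True r by (intro mult_left_mono) auto
    then show ?thesis by (simp add: algebra_simps)
  qed
  then have "r ^ j * t / 2 \<le> y" using near by linarith
  moreover have "r ^ j * t / 2 > 0" "- s \<le> 0" using r t s by auto
  ultimately have "y powr - s \<le> (r ^ j * t / 2) powr - s" by (intro powr_mono2')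
  also have "\<dots> = 2 powr s * (r powr (- s * real j) * t powr - s)"
    using r t by (simp add: powr_def ln_mult ln_div ln_realpow mult_exp_exp algebra_simps)
  also have "\<dots> \<le> 2 powr s * (r powr (\<delta> - s * real \<alpha>) * t powr - \<delta>)"
  proof (intro mult_left_mono)
    have "r \<le> t"
      using True C r mult_right_mono[of 1 "2 * C" r] by linarith
    then have "(t / r) powr - s \<le> (t / r) powr - \<delta>" using r s by (intro powr_mono) auto
    \<comment> \<open>Once \<open>r powr (- s * real j) * t powr - s\<close> is written through the
      ratio \<open>t / r \<ge> 1\<close>, the exponent \<open>- s\<close> of the ratio may be raised
      to \<open>- \<delta>\<close>.\<close>
    then have "r powr (- s * real j - s) * (t / r) powr - s \<le> r powr (- s * real j - s) * (t / r) powr - \<delta>"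
      by (intro mult_left_mono) auto
    moreover have "r powr (- s * real j - s) * (t / r) powr - s = r powr (- s * real j) * t powr - s"
      using r t by (simp add: powr_def ln_div mult_exp_exp algebra_simps)
    moreover have "r powr (- s * real j - s) * (t / r) powr - \<delta> = r powr (\<delta> - s * real (j + 1)) * t powr - \<delta>"
      using r t by (simp add: powr_def ln_div mult_exp_exp algebra_simps)
    ultimately have "r powr (- s * real j) * t powr - s \<le> r powr (\<delta> - s * real (j + 1)) * t powr - \<delta>"
      by simp
    \<comment> \<open>Here \<open>j + 1 \<le> \<alpha>\<close> enters, that is, the presence of a
      term of lower order; since \<open>r \<le> 1\<close>, the smaller exponent gives the larger
      power.\<close>
    also have "\<dots> \<le> r powr (\<delta> - s * real \<alpha>) * t powr - \<delta>"
      using r j s by (intro mult_right_mono powr_mono') auto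
    finally show "r powr (- s * real j) * t powr - s \<le> r powr (\<delta> - s * real \<alpha>) * t powr - \<delta>" .
  qed auto
  also have "\<dots> \<le> ?R"
    by (intro mult_right_mono) auto
  finally show ?thesis .
next
  case False
  have "c * r ^ \<alpha> > 0" "- s \<le> 0" using c r s by auto
  with lower have "y powr - s \<le> (c * r ^ \<alpha>) powr - s" by (intro powr_mono2')
  also have "\<dots> = c powr - s * r powr (- s * real \<alpha>) * 1"
    using r c by (simp add: powr_def ln_mult ln_realpow mult_exp_exp algebra_simps)
  also have "\<dots> \<le> c powr - s * r powr (- s * real \<alpha>) * (2 * C * r / t) powr \<delta>"
    using False t s by (intro mult_left_mono ge_one_powr_ge_zero) (auto simp: field_simps)
  also have "\<dots> = c powr - s * (2 * C) powr \<delta> * (r powr (\<delta> - s * real \<alpha>) * t powr - \<delta>)"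
    using r C t by (simp add: powr_def ln_mult ln_div mult_exp_exp algebra_simps)
  also have "\<dots> \<le> ?R"
    by (intro mult_right_mono) auto
  finally show ?thesis .
qed

text \<open>Since the lowest homogeneous part \<open>P\<close> of the symbol \<open>p\<close> has degree \<open>j < \<alpha>\<close>, \<open>|p|\<^sup>-\<^sup>n\<^sup>/\<^sup>\<alpha>\<close> is dominated by \<open>|\<xi>|\<^sup>\<delta>\<^sup>-\<^sup>n |P(\<xi>/|\<xi>|)|\<^sup>-\<^sup>\<delta>\<close>, which is homogeneous of degree above
  \<open>-n\<close> and, for small \<open>\<delta>\<close>, integrable on shells.\<close>

lemma nn_integral_symbol_origin:
  fixes a :: "'n::finite multiindex \<Rightarrow> real"
  assumes nonhom: "\<not> homogeneous \<alpha> a" and c: "c1 > 0" "symbol_bound c1 \<alpha> a"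
  shows "(\<integral>\<^sup>+\<xi>\<in>{\<xi>. norm \<xi> \<le> 1}. ennreal (cmod (symbol \<alpha> a \<xi>) powr - (real CARD('n) / real \<alpha>)) \<partial>lborel) < \<infinity>"
proof -
  define n where "n = real CARD('n)"
  define s where "s = n / real \<alpha>"
  obtain j \<xi>0 where j: "j < \<alpha>" "principal_symbol j a \<xi>0 \<noteq> 0" "\<And>i \<zeta>. i < j \<Longrightarrow> principal_symbol i a \<zeta> = 0"
    using nonhomogeneous_lower_term[OF nonhom] by blast
  obtain C where C: "C \<ge> 1" "\<And>\<xi>. norm \<xi> \<le> 1 \<Longrightarrow> cmod (symbol \<alpha> a \<xi> - principal_symbol j a \<xi>) \<le> C * norm \<xi> ^ (j + 1)"
    using symbol_near_origin[OF j(1,3)] by blast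
  have s: "s > 0" "s * real \<alpha> = n" using j by (auto simp: s_def n_def)
  \<comment> \<open>\<open>\<delta> \<le> s\<close> is required by the weight estimate; the second
    bound gives \<open>\<delta> * real j < 1\<close>, the condition for integrating
    \<open>|P|\<close> to the power \<open>-\<delta>\<close> along lines.\<close>
  define \<delta> where "\<delta> = min s (1 / (2 * (1 + real j)))"
  have \<delta>: "\<delta> > 0" "\<delta> \<le> s" using s by (auto simp: \<delta>_def)
  have "\<delta> * real j \<le> 1 / (2 * (1 + real j)) * real j" by (intro mult_right_mono) (auto simp: \<delta>_def)
  also have "\<dots> < 1" by (auto simp: field_simps)
  finally have \<delta>j: "\<delta> * real j < 1" .
  define P where "P \<xi> = cmod (principal_symbol j a \<xi>)" for \<xi>
  have [measurable]: "P \<in> borel_measurable borel" unfolding P_def[abs_def] by measurable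
  \<comment> \<open>This is the dominating function expressed by \<open>P \<xi>\<close> itself;
    passing from the normalised point to \<open>\<xi>\<close> produces the extra exponent
    \<open>\<delta> * real j\<close>.\<close>
  define G where "G \<xi> = ennreal (norm \<xi> powr (\<delta> + \<delta> * real j - n)) * inv_powr \<delta> (P \<xi>)" for \<xi>
  have [measurable]: "G \<in> borel_measurable borel" unfolding G_def[abs_def] by measurable
  let ?A = "{\<xi>. 0 < norm \<xi> \<and> norm \<xi> \<le> 1} :: (real ^ 'n) set" and ?B = "{\<xi>. 1 / 2 \<le> norm \<xi> \<and> norm \<xi> \<le> 1} :: (real ^ 'n) set"
  have G: "(\<integral>\<^sup>+\<xi>\<in>?A. G \<xi> \<partial>lborel) < \<infinity>"
  proof (rule nn_integral_homogeneous_origin[OF _ \<delta>(1)])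
    show "G ((1 / 2) *\<^sub>R \<xi>) \<le> ennreal (2 powr (real DIM(real ^ 'n) - \<delta>)) * G \<xi>" for \<xi>
    proof -
      have "P ((1 / 2) *\<^sub>R \<xi>) = (1 / 2) ^ j * P \<xi>"
        by (simp add: P_def principal_symbol_scaleR norm_mult norm_power norm_divide)
      then have "G ((1 / 2) *\<^sub>R \<xi>) = ennreal ((norm \<xi> / 2) powr (\<delta> + \<delta> * real j - n)) * (ennreal (((1 / 2) ^ j) powr - \<delta>) * inv_powr \<delta> (P \<xi>))"
        by (simp add: G_def inv_powr_mult P_def)
      also have "\<dots> = ennreal ((norm \<xi> / 2) powr (\<delta> + \<delta> * real j - n) * ((1 / 2) ^ j) powr - \<delta>) * inv_powr \<delta> (P \<xi>)"
        by (simp add: mult.assoc ennreal_mult')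
      also have "(norm \<xi> / 2) powr (\<delta> + \<delta> * real j - n) * ((1 / 2) ^ j) powr - \<delta> = 2 powr (n - \<delta>) * norm \<xi> powr (\<delta> + \<delta> * real j - n)"
        by (cases "\<xi> = 0") (simp_all add: powr_def ln_div ln_realpow mult_exp_exp algebra_simps)
      also have "ennreal (2 powr (n - \<delta>) * norm \<xi> powr (\<delta> + \<delta> * real j - n)) * inv_powr \<delta> (P \<xi>) = ennreal (2 powr (n - \<delta>)) * G \<xi>"
        by (simp add: G_def mult.assoc[symmetric] ennreal_mult')
      finally show ?thesis by (simp add: n_def)
    qed
    define e where "e = \<delta> + \<delta> * real j - n"
    have "norm \<xi> powr e \<le> 2 powr \<bar>e\<bar>" if "1/2 \<le> norm \<xi>" "norm \<xi> \<le> 1" for \<xi> :: "real ^ 'n"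
    proof -
      have "norm \<xi> powr e \<le> norm \<xi> powr - \<bar>e\<bar>" using that by (intro powr_mono') auto
      also have "\<dots> \<le> (1/2) powr - \<bar>e\<bar>" using that by (intro powr_mono2') auto
      finally show ?thesis by (simp add: powr_minus powr_divide)
    qed
    then have "(\<integral>\<^sup>+\<xi>\<in>?B. G \<xi> \<partial>lborel)
      \<le> (\<integral>\<^sup>+\<xi>. ennreal (2 powr \<bar>e\<bar>) * (inv_powr \<delta> (P \<xi>) * indicator (cball 0 1) \<xi>) \<partial>lborel)"
      by (intro nn_integral_mono) (auto simp: G_def e_def[symmetric] indicator_def intro!: mult_right_mono ennreal_leI)
    also have "\<dots> = ennreal (2 powr \<bar>e\<bar>) * (\<integral>\<^sup>+\<xi>\<in>cball 0 1. inv_powr \<delta> (P \<xi>) \<partial>lborel)"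
    proof (rule nn_integral_cmult)
      have [measurable]: "cball (0::real ^ 'n) 1 \<in> sets borel" by (intro borel_closed closed_cball)
      show "(\<lambda>\<xi>. inv_powr \<delta> (P \<xi>) * indicator (cball 0 1) \<xi>) \<in> borel_measurable lborel"
        by measurable
    qed
    also have "\<dots> < \<infinity>"
      using nn_integral_inv_powr_principal_symbol[OF j(2), of \<delta>] \<delta> \<delta>j by (simp add: P_def ennreal_mult_less_top)
    finally show "(\<integral>\<^sup>+\<xi>\<in>?B. G \<xi> \<partial>lborel) < \<infinity>" .
  qed simp
  define B where "B = 2 powr s + c1 powr - s * (2 * C) powr \<delta>"
  have B: "B > 0" unfolding B_def by (intro add_pos_nonneg) auto
  have le: "ennreal (cmod (symbol \<alpha> a \<xi>) powr - s) \<le> ennreal B * G \<xi>" if \<xi>: "0 < norm \<xi>" "norm \<xi> \<le> 1" for \<xi>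
  proof (cases "P \<xi> = 0")
    case True
    \<comment> \<open>At zeros of \<open>P\<close> away from the origin \<open>G\<close> is
      infinite, so the estimate is trivial there.\<close>
    show ?thesis using True \<xi> B by (simp add: G_def inv_powr_def ennreal_mult_top)
  next
    case False
    define t where "t = P \<xi> / norm \<xi> ^ j"
    have "cmod (symbol \<alpha> a \<xi>) powr - s \<le> B * (norm \<xi> powr (\<delta> - s * real \<alpha>) * t powr - \<delta>)"
      unfolding B_def
    proof (rule singular_weight_bound)
      show "0 < t" using False \<xi> by (auto simp: t_def P_def)
      show "c1 * norm \<xi> ^ \<alpha> \<le> cmod (symbol \<alpha> a \<xi>)" using c by blast
      have "P \<xi> \<le> cmod (symbol \<alpha> a \<xi>) + cmod (symbol \<alpha> a \<xi> - principal_symbol j a \<xi>)"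
        unfolding P_def by (metis norm_minus_commute norm_triangle_sub add.commute)
      then show "norm \<xi> ^ j * t - C * norm \<xi> ^ (j + 1) \<le> cmod (symbol \<alpha> a \<xi>)"
        using C(2)[OF \<xi>(2)] \<xi>(1) by (simp add: t_def)
    qed (use \<xi> \<delta> C c j in auto)
    also have "norm \<xi> powr (\<delta> - s * real \<alpha>) * t powr - \<delta> = norm \<xi> powr (\<delta> + \<delta> * real j - n) * P \<xi> powr - \<delta>"
    proof -
      have "P \<xi> > 0" using False by (simp add: P_def)
      then show ?thesis
        using \<xi> unfolding s t_def by (simp add: powr_def ln_div ln_realpow mult_exp_exp algebra_simps)
    qed
    finally have "ennreal (cmod (symbol \<alpha> a \<xi>) powr - s)
        \<le> ennreal (B * (norm \<xi> powr (\<delta> + \<delta> * real j - n) * P \<xi> powr - \<delta>))"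
      by (rule ennreal_leI)
    also have "\<dots> = ennreal B * G \<xi>"
      using False B by (simp add: G_def inv_powr_def ennreal_mult')
    finally show ?thesis .
  qed
  have "(\<integral>\<^sup>+\<xi>\<in>{\<xi>. norm \<xi> \<le> 1}. ennreal (cmod (symbol \<alpha> a \<xi>) powr - s) \<partial>lborel)
    \<le> (\<integral>\<^sup>+\<xi>. ennreal B * (G \<xi> * indicator ?A \<xi>) + \<infinity> * indicator {0} \<xi> \<partial>lborel)"
  proof (intro nn_integral_mono)
    fix \<xi> :: "real ^ 'n"
    show "ennreal (cmod (symbol \<alpha> a \<xi>) powr - s) * indicator {\<xi>. norm \<xi> \<le> 1} \<xi>
      \<le> ennreal B * (G \<xi> * indicator ?A \<xi>) + \<infinity> * indicator {0} \<xi>"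
    proof (cases "\<xi> \<noteq> 0 \<and> norm \<xi> \<le> 1")
      case True
      then show ?thesis using le[of \<xi>] by simp
    next
      case False
      then show ?thesis by (cases "\<xi> = 0") (simp_all add: indicator_def)
    qed
  qed
  also have "\<dots> = ennreal B * (\<integral>\<^sup>+\<xi>\<in>?A. G \<xi> \<partial>lborel) + 0"
    by (simp add: nn_integral_add nn_integral_cmult)
  also have "\<dots> < \<infinity>" using G by (simp add: ennreal_mult_less_top)
  finally show ?thesis by (simp add: s_def n_def)
qed

subsection \<open>The inverse Fourier transform of integrable functions\<close>

abbreviation two_pi_i :: complex where
  "two_pi_i \<equiv> 2 * of_real pi * \<i>"

notation inverse_fourier ("\<F>")

definition wave :: "real ^ 'n::finite \<Rightarrow> real ^ 'n \<Rightarrow> complex" where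
  "wave x \<xi> = exp (two_pi_i * of_real (x \<bullet> \<xi>))"

lemma norm_wave [simp]: "cmod (wave x \<xi>) = 1"
  by (simp add: wave_def norm_exp_eq_Re)

lemma wave_commute: "wave x \<xi> = wave \<xi> x"
  by (simp add: wave_def inner_commute)

lemma wave_add: "wave x (\<xi> + \<eta>) = wave x \<xi> * wave x \<eta>"
  by (simp add: wave_def inner_add_right distrib_left exp_add)

lemma wave_minus: "wave x (- \<xi>) = cnj (wave x \<xi>)"
  by (simp add: wave_def exp_cnj)

lemma wave_scaleR: "wave (r *\<^sub>R x) \<xi> = wave x (r *\<^sub>R \<xi>)"
  by (simp add: wave_def)

lemma continuous_on_wave [continuous_intros]:
  "continuous_on S f \<Longrightarrow> continuous_on S g \<Longrightarrow> continuous_on S (\<lambda>z. wave (f z) (g z))"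
  unfolding wave_def by (intro continuous_intros)

lemma measurable_wave [measurable]:
  assumes [measurable]: "f \<in> borel_measurable M" "g \<in> borel_measurable M"
  shows "(\<lambda>z. wave (f z) (g z)) \<in> borel_measurable M"
proof -
  have "(\<lambda>p. wave (fst p) (snd p)) \<in> borel_measurable borel"
    by (intro borel_measurable_continuous_onI continuous_intros)
  from measurable_compose[OF _ this, of "\<lambda>z. (f z, g z)"] show ?thesis by simp
qed

text \<open>For Borel functions the completed measure can be replaced by \<open>lborel\<close>, to
  which the product measure and Fubini arguments apply.\<close>

lemma inverse_fourier_lborel:
  assumes [measurable]: "f \<in> borel_measurable borel"
  shows "\<F> f x = (LINT \<xi>|lborel. f \<xi> * wave x \<xi>)"
  unfolding inverse_fourier_def wave_def[symmetric] by (rule integral_completion) simp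

lemma borel_of_integrable: "integrable lborel f \<Longrightarrow> f \<in> borel_measurable borel"
  by (simp add: borel_measurable_integrable)

lemma integrable_mult_bounded:
  fixes f :: "'a::euclidean_space \<Rightarrow> complex"
  assumes "integrable lborel f" and [measurable]: "g \<in> borel_measurable borel" and "\<And>x. cmod (g x) \<le> B"
  shows "integrable lborel (\<lambda>x. f x * g x)"
proof (rule Bochner_Integration.integrable_bound)
  show "integrable lborel (\<lambda>x. B * norm (f x))" using assms(1) by auto
  have [measurable]: "f \<in> borel_measurable borel" using assms(1) by (simp add: borel_measurable_integrable)
  show "(\<lambda>x. f x * g x) \<in> borel_measurable lborel" by simp
  have "B \<ge> 0" using assms(3) norm_ge_zero order_trans by blast
  then show "AE x in lborel. norm (f x * g x) \<le> norm (B * norm (f x))"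
    using assms(3) by (simp add: norm_mult mult.commute[of "norm (f _)"] mult_right_mono)
qed

lemma integrable_wave:
  assumes "integrable lborel f"
  shows "integrable lborel (\<lambda>\<xi>. f \<xi> * wave x \<xi>)"
  by (rule integrable_mult_bounded[OF assms, of _ 1]) auto

lemma inverse_fourier_norm_le:
  assumes "integrable lborel f"
  shows "cmod (\<F> f x) \<le> (LINT \<xi>|lborel. cmod (f \<xi>))"
proof -
  note [measurable] = borel_of_integrable[OF assms]
  have "cmod (LINT \<xi>|lborel. f \<xi> * wave x \<xi>) \<le> (LINT \<xi>|lborel. cmod (f \<xi> * wave x \<xi>))"
    by (rule integral_norm_bound)
  then show ?thesis by (simp add: inverse_fourier_lborel norm_mult)
qed

lemma measurable_inverse_fourier [measurable]:
  assumes [measurable]: "f \<in> borel_measurable borel"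
  shows "\<F> f \<in> borel_measurable borel"
proof -
  have "(\<lambda>x. LINT \<xi>|lborel. f \<xi> * wave x \<xi>) \<in> borel_measurable borel"
    by (rule lborel.borel_measurable_lebesgue_integral) measurable
  moreover have "\<F> f = (\<lambda>x. LINT \<xi>|lborel. f \<xi> * wave x \<xi>)"
    by (intro ext inverse_fourier_lborel) simp
  ultimately show ?thesis by simp
qed

lemma integrable_lborel_pairI:
  fixes f :: "'a::euclidean_space \<times> 'b::euclidean_space \<Rightarrow> complex"
  assumes [measurable]: "f \<in> borel_measurable (lborel \<Otimes>\<^sub>M lborel)"
    and "(\<integral>\<^sup>+x. \<integral>\<^sup>+y. ennreal (norm (f (x, y))) \<partial>lborel \<partial>lborel) < \<infinity>"
  shows "integrable (lborel \<Otimes>\<^sub>M lborel) f"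
proof -
  have "(\<integral>\<^sup>+z. ennreal (norm (f z)) \<partial>(lborel \<Otimes>\<^sub>M lborel)) = (\<integral>\<^sup>+x. \<integral>\<^sup>+y. ennreal (norm (f (x, y))) \<partial>lborel \<partial>lborel)"
    by (rule lborel.nn_integral_fst[symmetric]) measurable
  with assms(2) show ?thesis by (simp add: integrable_iff_bounded)
qed

text \<open>Fubini applied to \<open>F \<xi> * wave x \<xi> * H x\<close>, whose modulus is a
  product because \<open>wave\<close> is unimodular. Moving the transform from one factor to the
  other serves both the distributional identity for \<open>K\<close> and the Plancherel
  inequality.\<close>

lemma inverse_fourier_multiplication:
  assumes F: "integrable lborel F" and H: "integrable lborel H"
  shows "(LINT x|lborel. \<F> F x * H x) = (LINT \<xi>|lborel. F \<xi> * \<F> H \<xi>)"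
proof -
  note [measurable] = borel_of_integrable[OF F] borel_of_integrable[OF H]
  have "(\<integral>\<^sup>+x. \<integral>\<^sup>+\<xi>. ennreal (norm (F \<xi> * wave x \<xi> * H x)) \<partial>lborel \<partial>lborel)
      = (\<integral>\<^sup>+x. (\<integral>\<^sup>+\<xi>. ennreal (norm (F \<xi>)) \<partial>lborel) * ennreal (norm (H x)) \<partial>lborel)"
    by (simp add: norm_mult ennreal_mult nn_integral_multc)
  also have "\<dots> = (\<integral>\<^sup>+\<xi>. ennreal (norm (F \<xi>)) \<partial>lborel) * (\<integral>\<^sup>+x. ennreal (norm (H x)) \<partial>lborel)"
    by (rule nn_integral_cmult) simp
  also have "\<dots> < \<infinity>" using F H by (simp add: integrable_iff_bounded ennreal_mult_less_top)
  finally have int: "integrable (lborel \<Otimes>\<^sub>M lborel) (\<lambda>(x, \<xi>). F \<xi> * wave x \<xi> * H x)"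
    by (intro integrable_lborel_pairI) auto
  have "(LINT x|lborel. \<F> F x * H x) = (LINT x|lborel. LINT \<xi>|lborel. F \<xi> * wave x \<xi> * H x)"
    by (simp add: inverse_fourier_lborel)
  also have "\<dots> = (LINT \<xi>|lborel. LINT x|lborel. F \<xi> * wave x \<xi> * H x)"
    using lborel_pair.Fubini_integral[OF int] by simp
  also have "\<dots> = (LINT \<xi>|lborel. F \<xi> * \<F> H \<xi>)"
    by (simp add: inverse_fourier_lborel mult.assoc wave_commute mult.commute[of "wave _ _"])
  finally show ?thesis .
qed

text \<open>Only the restrictions of \<open>f\<close> to lines in direction \<open>v\<close> are
  differentiated. This is what the fundamental theorem of calculus on segments consumes and what the
  Leibniz rule for one real parameter supplies.\<close>

definition dir_deriv :: "'a::real_normed_vector \<Rightarrow> ('a \<Rightarrow> complex) \<Rightarrow> ('a \<Rightarrow> complex) \<Rightarrow> bool" where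
  "dir_deriv v f f' \<longleftrightarrow> (\<forall>x t. ((\<lambda>s. f (x + s *\<^sub>R v)) has_vector_derivative f' (x + t *\<^sub>R v)) (at t))"

lemma dir_derivI:
  assumes "\<And>x. (f has_derivative D x) (at x)"
  shows "dir_deriv v f (\<lambda>x. D x v)"
  unfolding dir_deriv_def has_vector_derivative_def
proof (intro allI)
  fix x :: 'a and t :: real
  have "((\<lambda>s. x + s *\<^sub>R v) has_derivative (\<lambda>s. s *\<^sub>R v)) (at t)"
    by (auto intro!: derivative_eq_intros)
  from has_derivative_compose[OF this assms[of "x + t *\<^sub>R v"]]
  have "((\<lambda>s. f (x + s *\<^sub>R v)) has_derivative (\<lambda>s. D (x + t *\<^sub>R v) (s *\<^sub>R v))) (at t)" .
  moreover have "linear (D (x + t *\<^sub>R v))" using assms has_derivative_linear by blast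
  ultimately show "((\<lambda>s. f (x + s *\<^sub>R v)) has_derivative (\<lambda>s. s *\<^sub>R D (x + t *\<^sub>R v) v)) (at t)"
    by (simp add: linear_cmul)
qed

lemma dir_deriv_mult:
  assumes "dir_deriv v f f'" "dir_deriv v g g'"
  shows "dir_deriv v (\<lambda>x. f x * g x) (\<lambda>x. f x * g' x + f' x * g x)"
  using assms unfolding dir_deriv_def by (auto intro: has_vector_derivative_mult)

lemma dir_deriv_wave:
  fixes \<xi> :: "real ^ 'n::finite"
  shows "dir_deriv v (\<lambda>x. wave x \<xi>) (\<lambda>x. two_pi_i * of_real (v \<bullet> \<xi>) * wave x \<xi>)"
proof (rule dir_derivI)
  fix x :: "real ^ 'n"
  let ?c = "two_pi_i"
  have "((\<lambda>x. exp (?c * of_real (x \<bullet> \<xi>))) has_derivative (\<lambda>v. exp (?c * of_real (x \<bullet> \<xi>)) * (?c * of_real (v \<bullet> \<xi>)))) (at x)"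
    by (rule has_derivative_compose[where g = exp and g' = "\<lambda>z. exp (?c * of_real (x \<bullet> \<xi>)) * z"])
       (auto intro!: derivative_eq_intros DERIV_exp[unfolded has_field_derivative_def])
  then show "((\<lambda>x. wave x \<xi>) has_derivative (\<lambda>v. two_pi_i * of_real (v \<bullet> \<xi>) * wave x \<xi>)) (at x)"
    by (simp add: wave_def mult_ac)
qed

lemma integrable_translate:
  fixes f :: "'a::euclidean_space \<Rightarrow> complex"
  assumes "integrable lborel f"
  shows "integrable lborel (\<lambda>x. f (x + t))" "(LINT x|lborel. f (x + t)) = (LINT x|lborel. f x)"
proof -
  note [measurable] = borel_of_integrable[OF assms]
  have "integrable (distr lborel borel ((+) t)) f" using assms by (simp add: lborel_distr_plus)
  then show "integrable lborel (\<lambda>x. f (x + t))"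
    by (subst (asm) integrable_distr_eq) (auto simp: add.commute)
  have "(LINT x|lborel. f x) = (LINT x|distr lborel borel ((+) t). f x)" by (simp add: lborel_distr_plus)
  also have "\<dots> = (LINT x|lborel. f (x + t))" by (subst integral_distr) (auto simp: add.commute)
  finally show "(LINT x|lborel. f (x + t)) = (LINT x|lborel. f x)" by simp
qed

text \<open>Integrate \<open>G' (x + t *\<^sub>R v)\<close> over all \<open>x\<close> and over
  \<open>t\<close> in \<open>[0,1]\<close>. For fixed \<open>x\<close> the fundamental theorem gives
  \<open>G (x + v) - G x\<close>, with integral 0 by translation invariance; for fixed
  \<open>t\<close> the integral over \<open>x\<close> is the one in question. Integrability thus
  replaces the discussion of boundary terms at infinity.\<close>

lemma integral_dir_deriv_eq_0:
  fixes G G' :: "'a::euclidean_space \<Rightarrow> complex"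
  assumes G: "integrable lborel G" and G': "integrable lborel G'" and d: "dir_deriv v G G'"
  shows "(LINT x|lborel. G' x) = 0"
proof -
  have [measurable]: "G \<in> borel_measurable borel" "G' \<in> borel_measurable borel"
    using G G' by (simp_all add: borel_measurable_integrable)
  let ?f = "\<lambda>x t. indicator {0..1::real} t *\<^sub>R G' (x + t *\<^sub>R v)"
  have trans: "(\<integral>\<^sup>+x. ennreal (norm (G' (x + t *\<^sub>R v))) \<partial>lborel) = (\<integral>\<^sup>+x. ennreal (norm (G' x)) \<partial>lborel)" for t
    using nn_integral_lborel_affine[of "\<lambda>x. ennreal (norm (G' x))" 1 "t *\<^sub>R v"] by (simp add: add.commute)
  have "(\<integral>\<^sup>+x. \<integral>\<^sup>+t. ennreal (norm (?f x t)) \<partial>lborel \<partial>lborel) = (\<integral>\<^sup>+t. \<integral>\<^sup>+x. ennreal (norm (?f x t)) \<partial>lborel \<partial>lborel)"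
    by (rule lborel_pair.Fubini') measurable
  also have "\<dots> = (\<integral>\<^sup>+t. (\<integral>\<^sup>+x. ennreal (norm (G' x)) \<partial>lborel) * indicator {0..1::real} t \<partial>lborel)"
    by (intro nn_integral_cong) (simp add: trans indicator_def)
  also have "\<dots> = (\<integral>\<^sup>+x. ennreal (norm (G' x)) \<partial>lborel)"
    by (simp add: nn_integral_cmult)
  also have "\<dots> < \<infinity>" using G' by (simp add: integrable_iff_bounded)
  finally have int: "integrable (lborel \<Otimes>\<^sub>M lborel) (\<lambda>(x, t). ?f x t)"
    by (intro integrable_lborel_pairI) auto
  have "AE x in lborel. integrable lborel (?f x)"
    using lborel_pair.AE_integrable_fst'[OF int] by simp
  then have "AE x in lborel. (LINT t|lborel. ?f x t) = G (x + v) - G x"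
  proof eventually_elim
    case (elim x)
    have "((\<lambda>t. G' (x + t *\<^sub>R v)) has_integral (G (x + 1 *\<^sub>R v) - G (x + 0 *\<^sub>R v))) {0..1}"
      using d by (intro fundamental_theorem_of_calculus) (auto simp: dir_deriv_def intro: has_vector_derivative_at_within)
    moreover have "(LINT t|lborel. ?f x t) = integral {0..1} (\<lambda>t. G' (x + t *\<^sub>R v))"
      using set_borel_integral_eq_integral(2)[of "{0..1}" "\<lambda>t. G' (x + t *\<^sub>R v)"] elim
      by (simp add: set_integrable_def set_lebesgue_integral_def)
    ultimately show ?case by (simp add: integral_unique)
  qed
  then have "(LINT x|lborel. LINT t|lborel. ?f x t) = (LINT x|lborel. G (x + v) - G x)"
    by (intro integral_cong_AE) (auto intro!: lborel.borel_measurable_lebesgue_integral)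
  also have "\<dots> = 0"
    using integrable_translate[OF G, of v] G by simp
  finally have "0 = (LINT t|lborel. LINT x|lborel. ?f x t)"
    using lborel_pair.Fubini_integral[OF int] by simp
  also have "\<dots> = (LINT t|lborel. indicator {0..1::real} t *\<^sub>R (LINT x|lborel. G' x))"
    using integrable_translate(2)[OF G'] by simp
  also have "\<dots> = (LINT x|lborel. G' x)"
    by simp
  finally show ?thesis by simp
qed

lemma integrable_of_decay:
  fixes f :: "'a::euclidean_space \<Rightarrow> complex"
  assumes [measurable]: "f \<in> borel_measurable borel" and s: "s > real DIM('a)"
    and "\<And>x. norm x \<le> 1 \<Longrightarrow> cmod (f x) \<le> C" "\<And>x. norm x \<ge> 1 \<Longrightarrow> cmod (f x) \<le> C * norm x powr - s"
  shows "integrable lborel f"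
proof -
  have C: "C \<ge> 0" using assms(3)[of 0] norm_ge_zero[of "f 0"] by (simp del: norm_ge_zero)
  have "(\<integral>\<^sup>+x. ennreal (norm (f x)) \<partial>lborel)
    \<le> (\<integral>\<^sup>+x. ennreal C * indicator (cball (0::'a) 1) x + ennreal C * (ennreal (norm x powr - s) * indicator {x. norm x \<ge> 1} x) \<partial>lborel)"
  proof (intro nn_integral_mono)
    fix x :: 'a
    show "ennreal (norm (f x)) \<le> ennreal C * indicator (cball 0 1) x + ennreal C * (ennreal (norm x powr - s) * indicator {x. norm x \<ge> 1} x)"
    proof (cases "norm x \<le> 1")
      case True
      then have "ennreal (norm (f x)) \<le> ennreal C" using assms(3) by (intro ennreal_leI) auto
      then show ?thesis using True by (simp add: add_increasing2)
    next
      case False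
      then have "ennreal (norm (f x)) \<le> ennreal (C * norm x powr - s)" using assms(4) by (intro ennreal_leI) auto
      then show ?thesis using False C by (simp add: ennreal_mult)
    qed
  qed
  also have "\<dots> = ennreal C * emeasure lborel (cball (0::'a) 1) + ennreal C * (\<integral>\<^sup>+x\<in>{x::'a. norm x \<ge> 1}. ennreal (norm x powr - s) \<partial>lborel)"
  proof -
    have [measurable]: "cball (0::'a) 1 \<in> sets borel" by (intro borel_closed closed_cball)
    show ?thesis by (subst nn_integral_add) (auto simp: nn_integral_cmult)
  qed
  also have "\<dots> < \<infinity>"
    using nn_integral_norm_powr_infinity[OF s] emeasure_bounded_finite[OF bounded_cball, of "0::'a" 1]
    by (simp add: ennreal_mult_less_top)
  finally show ?thesis by (simp add: integrable_iff_bounded)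
qed

subsection \<open>Explicit bump functions\<close>

text \<open>A polynomial, positive on the open box and zero on its boundary, so that
  \<open>exp\<close> of a negative multiple of its reciprocal is flat there.\<close>

definition bump_weight :: "real ^ 'n::finite \<Rightarrow> real ^ 'n \<Rightarrow> real ^ 'n \<Rightarrow> real" where
  "bump_weight a b x = (\<Prod>i\<in>UNIV. (x $ i - a $ i) * (b $ i - x $ i))"

abbreviation bump_factor :: "real ^ 'n::finite \<Rightarrow> real ^ 'n \<Rightarrow> real \<Rightarrow> nat \<Rightarrow> real ^ 'n \<Rightarrow> complex" where
  "bump_factor a b c m x \<equiv> inverse (of_real (bump_weight a b x)) ^ m * exp (- of_real c * inverse (of_real (bump_weight a b x)))"

text \<open>Admitting all polynomials \<open>p\<close> and all pole orders \<open>m\<close>, with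
  the box and \<open>c\<close> fixed, makes the class closed under partial derivatives and
  multiplication by coordinates. Smoothness then follows by iteration, and letting \<open>c\<close>
  tend to 0 recovers indicators of boxes.\<close>

definition bump :: "real ^ 'n::finite \<Rightarrow> real ^ 'n \<Rightarrow> real \<Rightarrow> (real ^ 'n \<Rightarrow> complex) \<Rightarrow> bool" where
  "bump a b c \<phi> \<longleftrightarrow> (\<exists>d p m. polyf d p \<and>
     \<phi> = (\<lambda>x. if x \<in> box a b
       then p x * bump_factor a b c m x else 0))"

lemma polyf_bump_weight: "polyf (int CARD('n) * 2) (\<lambda>x. complex_of_real (bump_weight a b (x :: real ^ 'n::finite)))"
proof -
  have "polyf (\<Sum>i\<in>(UNIV::'n set). 1 + 1) (\<lambda>x. \<Prod>i\<in>UNIV. (of_real (x $ i) - of_real (a $ i)) * (of_real (b $ i) - of_real (x $ i)))"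
    by (intro polyf_prod polyf_mult polyf_diff polyf_coord polyf_const) auto
  then show ?thesis by (simp add: bump_weight_def)
qed

lemma bump_weight_pos: "x \<in> box a b \<Longrightarrow> bump_weight a b x > 0"
  unfolding bump_weight_def by (intro prod_pos) (auto simp: mem_box_cart)

text \<open>If \<open>y\<close> violates the box condition in coordinate \<open>i\<close>, one of
  the two factors of coordinate \<open>i\<close> is at most \<open>norm (x - y)\<close>; all others
  are at most \<open>1 + norm (b - a)\<close>. The exponent \<open>2 * CARD('n)\<close> is rounded
  up by one.\<close>

lemma bump_weight_le_dist:
  assumes x: "x \<in> box a b" and y: "y \<notin> box a b"
  shows "bump_weight a b x \<le> (1 + norm (b - a)) ^ (2 * CARD('n)) * norm (x - y :: real ^ 'n::finite)"
proof -
  define N where "N = 1 + norm (b - a)"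
  have N: "N \<ge> 1" by (simp add: N_def)
  have ab: "0 < x $ i - a $ i" "0 < b $ i - x $ i" "x $ i - a $ i \<le> N" "b $ i - x $ i \<le> N" for i
    using x component_le_norm_cart[of "b - a" i] by (auto simp: mem_box_cart N_def add_nonneg_nonneg intro: less_imp_le)
       (smt (verit))+
  obtain i where i: "y $ i \<le> a $ i \<or> b $ i \<le> y $ i" using y by (auto simp: mem_box_cart not_less)
  have xy: "\<bar>x $ i - y $ i\<bar> \<le> norm (x - y)" using component_le_norm_cart[of "x - y" i] by simp
  have "(x $ i - a $ i) * (b $ i - x $ i) \<le> N * norm (x - y)"
  proof (cases "y $ i \<le> a $ i")
    case True
    then have "x $ i - a $ i \<le> norm (x - y)" using xy by linarith
    then have "(x $ i - a $ i) * (b $ i - x $ i) \<le> norm (x - y) * N" using ab by (intro mult_mono) (auto intro: less_imp_le)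
    then show ?thesis by (simp add: mult.commute)
  next
    case False
    then have "b $ i - x $ i \<le> norm (x - y)" using xy i by linarith
    then show ?thesis using ab N by (intro mult_mono) (auto intro: less_imp_le)
  qed
  moreover have "(\<Prod>j\<in>UNIV - {i}. (x $ j - a $ j) * (b $ j - x $ j)) \<le> (\<Prod>j\<in>UNIV - {i}. N * N)"
    using ab N by (intro prod_mono conjI mult_mono mult_nonneg_nonneg) (auto intro: less_imp_le)
  moreover have "0 \<le> N * norm (x - y)" using N by simp
  moreover have "0 \<le> (\<Prod>j\<in>UNIV - {i}. (x $ j - a $ j) * (b $ j - x $ j))"
    using ab by (intro prod_nonneg mult_nonneg_nonneg) (auto intro: less_imp_le)
  ultimately have "(x $ i - a $ i) * (b $ i - x $ i) * (\<Prod>j\<in>UNIV - {i}. (x $ j - a $ j) * (b $ j - x $ j))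
      \<le> N * norm (x - y) * (\<Prod>j\<in>UNIV - {i}. N * N)"
    by (rule mult_mono)
  then have "bump_weight a b x \<le> N * norm (x - y) * (\<Prod>j\<in>UNIV - {i}. N * N)"
    unfolding bump_weight_def by (subst prod.remove[of UNIV i]) auto
  also have "(\<Prod>j\<in>UNIV - {i}. N * N) = N ^ (2 * (CARD('n) - 1))"
    by (simp add: power_mult power2_eq_square)
  also have "N * norm (x - y) * N ^ (2 * (CARD('n) - 1)) = N ^ (2 * (CARD('n) - 1) + 1) * norm (x - y)"
    by simp
  also have "\<dots> \<le> N ^ (2 * CARD('n)) * norm (x - y)"
  proof (intro mult_right_mono power_increasing)
    show "2 * (CARD('n) - 1) + 1 \<le> 2 * CARD('n)" by (cases "CARD('n)") auto
  qed (use N in auto)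
  finally show ?thesis by (simp add: N_def)
qed

text \<open>From \<open>u \<le> exp u\<close> with \<open>u = c / (m w)\<close>, raised to the power
  \<open>m\<close>. In this way the exponential outweighs any power of the reciprocal
  weight.\<close>

lemma exp_neg_inverse_le:
  fixes c w :: real
  assumes "c > 0" "w > 0"
  shows "exp (- c * inverse w) \<le> (real m / c) ^ m * w ^ m"
proof (cases "m = 0")
  case False
  define u where "u = c * inverse w / real m"
  have u: "u > 0" using assms False by (simp add: u_def)
  have "u \<le> exp u" using exp_ge_add_one_self[of u] by linarith
  then have "u ^ m \<le> exp u ^ m" using u by (intro power_mono) auto
  also have "exp u ^ m = exp (c * inverse w)" using False by (simp add: u_def exp_of_nat_mult[symmetric])
  finally have "inverse (exp (c * inverse w)) \<le> inverse (u ^ m)" using u by (intro le_imp_inverse_le) auto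
  also have "inverse (u ^ m) = (real m / c) ^ m * w ^ m"
    using assms False by (simp add: u_def power_mult_distrib power_divide field_simps)
  finally show ?thesis by (simp add: exp_minus)
qed (use assms in simp)

text \<open>Two powers of the weight more than the pole order are extracted from the exponential,
  leaving a multiple of the squared weight and hence of the squared distance. The square forces
  derivative 0 at every point outside the open box, boundary included.\<close>

lemma bump_le_dist_squared:
  assumes c: "c > 0" and \<phi>: "bump a b c \<phi>"
  shows "\<exists>K. \<forall>x y. y \<notin> box a b \<longrightarrow> cmod (\<phi> x) \<le> K * (norm (x - y :: real ^ 'n::finite))\<^sup>2"
proof -
  obtain d p m where p: "polyf d p" and \<phi>_eq: "\<phi> = (\<lambda>x. if x \<in> box a b
       then p x * bump_factor a b c m x else 0)"
    using \<phi> by (auto simp: bump_def)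
  have "bounded (p ` cbox a b)"
    by (intro compact_imp_bounded compact_continuous_image polyf_continuous[OF p]) auto
  then obtain B where B: "\<And>x. x \<in> cbox a b \<Longrightarrow> cmod (p x) \<le> B" unfolding bounded_iff by blast
  define R where "R = (real (m + 2) / c) ^ (m + 2)"
  define L where "L = (1 + norm (b - a)) ^ (2 * CARD('n))"
  have "cmod (\<phi> x) \<le> (\<bar>B\<bar> * R * L\<^sup>2) * (norm (x - y))\<^sup>2" if y: "y \<notin> box a b" for x y
  proof (cases "x \<in> box a b")
    case True
    define w where "w = bump_weight a b x"
    have w: "w > 0" "w \<le> L * norm (x - y)"
      using bump_weight_pos[OF True] bump_weight_le_dist[OF True y] by (auto simp: w_def L_def)
    have "cmod (\<phi> x) = cmod (p x) * (inverse w ^ m * exp (- c * inverse w))"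
    proof -
      have "exp (- of_real c * inverse (of_real w)) = complex_of_real (exp (- c * inverse w))"
        by (subst exp_of_real[symmetric]) simp
      then show ?thesis
        using True w by (simp add: \<phi>_eq w_def[symmetric] norm_mult norm_power norm_inverse del: of_real_exp)
    qed
    also have "\<dots> \<le> \<bar>B\<bar> * (inverse w ^ m * (R * w ^ (m + 2)))"
    proof (intro mult_mono)
      show "cmod (p x) \<le> \<bar>B\<bar>" using B[of x] box_subset_cbox[of a b] True by fastforce
      show "exp (- c * inverse w) \<le> R * w ^ (m + 2)"
        unfolding R_def by (intro exp_neg_inverse_le c w)
    qed (use w in auto)
    also have "inverse w ^ m * (R * w ^ (m + 2)) = R * w\<^sup>2"
      using w by (simp add: power_add field_simps power2_eq_square)
    also have "\<bar>B\<bar> * (R * w\<^sup>2) \<le> \<bar>B\<bar> * (R * (L * norm (x - y))\<^sup>2)"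
      using w c by (intro mult_left_mono power_mono) (auto simp: R_def)
    finally show ?thesis by (simp add: power_mult_distrib mult_ac)
  next
    case False
    then show ?thesis using c by (simp add: \<phi>_eq R_def L_def)
  qed
  then show ?thesis by blast
qed

lemma bump_derivative:
  assumes c: "c > 0" and \<phi>: "bump a b c \<phi>"
  obtains D where "\<And>x. (\<phi> has_derivative D x) (at x)" "\<And>v. bump a b c (\<lambda>x. D x v)"
proof -
  obtain d p m where p: "polyf d p" and \<phi>_eq: "\<phi> = (\<lambda>x. if x \<in> box a b
       then p x * bump_factor a b c m x else 0)"
    using \<phi> by (auto simp: bump_def)
  define W where "W x = complex_of_real (bump_weight a b x)" for x
  obtain P' where P': "\<And>x. (p has_derivative P' x) (at x)" "\<And>v. polyf (d - 1) (\<lambda>x. P' x v)"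
    using polyf_derivative[OF p] by blast
  obtain W' e where W': "\<And>x. (W has_derivative W' x) (at x)" "\<And>v. polyf e (\<lambda>x. W' x v)" and We: "polyf (e + 1) W"
    using polyf_derivative[OF polyf_bump_weight[of a b]] polyf_bump_weight[of a b] unfolding W_def by (metis diff_add_cancel)
  define h where "h z = inverse z ^ m * exp (- of_real c * inverse z)" for z :: complex
  have h: "(h has_field_derivative (of_real c - of_nat m * z) * (inverse z ^ (m + 2) * exp (- of_real c * inverse z))) (at z)" if "z \<noteq> 0" for z
  proof -
    have 1: "((\<lambda>z. inverse z ^ m) has_field_derivative of_nat m * (- (inverse z ^ 2) * inverse z ^ (m - Suc 0))) (at z)"
      using DERIV_power[OF DERIV_inverse[OF that], of m] by (simp add: numeral_2_eq_2)
    have 2: "((\<lambda>z. exp (- of_real c * inverse z)) has_field_derivative exp (- of_real c * inverse z) * (of_real c * inverse z ^ 2)) (at z)"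
      using that by (auto intro!: derivative_eq_intros simp: power2_eq_square)
    show ?thesis
      unfolding h_def
      by (rule DERIV_cong[OF DERIV_mult[OF 1 2]])
         (use that in \<open>cases m; simp add: power2_eq_square field_simps\<close>)
  qed
  \<comment> \<open>Differentiating \<open>h\<close> raises the pole order from \<open>m\<close> to
    \<open>m + 2\<close> and brings the factor \<open>c - m z\<close>; the term with the derivative
    of \<open>p\<close> is brought to the same order by \<open>W x ^ 2\<close>.\<close>
  define q where "q v x = p x * W' x v * (of_real c - of_nat m * W x) + P' x v * W x ^ 2" for v x
  define D where "D x v = (if x \<in> box a b then q v x * (inverse (W x) ^ (m + 2) * exp (- of_real c * inverse (W x))) else 0)" for x v
  have "(\<phi> has_derivative D x) (at x)" for x
  proof (cases "x \<in> box a b")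
    case True
    then have W0: "W x \<noteq> 0" using bump_weight_pos[OF True] by (simp add: W_def)
    have "((\<lambda>x. h (W x)) has_derivative (\<lambda>v. (of_real c - of_nat m * W x) * (inverse (W x) ^ (m + 2) * exp (- of_real c * inverse (W x))) * W' x v)) (at x)"
      using has_derivative_compose[OF W'(1) h[OF W0, unfolded has_field_derivative_def]] by simp
    from has_derivative_mult[OF P'(1) this]
    have "((\<lambda>x. p x * h (W x)) has_derivative D x) (at x)"
      by (rule has_derivative_eq_rhs) (use True W0 in \<open>auto simp: D_def q_def h_def fun_eq_iff power_add power2_eq_square field_simps\<close>)
    then show ?thesis
      by (rule has_derivative_transform_within_open[OF _ open_box True]) (auto simp: \<phi>_eq h_def W_def)
  next
    case False
    \<comment> \<open>Since \<open>\<phi>\<close> vanishes at \<open>x\<close>, a quadratic bound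
      around \<open>x\<close> makes the difference quotients tend to 0.\<close>
    obtain K where K: "\<And>x y. y \<notin> box a b \<Longrightarrow> cmod (\<phi> x) \<le> K * (norm (x - y))\<^sup>2"
      using bump_le_dist_squared[OF c \<phi>] by blast
    have "(\<phi> has_derivative (\<lambda>v. 0)) (at x)"
    proof (rule has_derivativeI_sandwich[of 1 _ _ _ _ "\<lambda>y. K * norm (y - x)"])
      show "norm (\<phi> y - \<phi> x - 0) / norm (y - x) \<le> K * norm (y - x)" if "y \<noteq> x" for y
      proof -
        have "\<phi> x = 0" using False by (simp add: \<phi>_eq)
        then show ?thesis using K[OF False, of y] that by (simp add: divide_le_eq power2_eq_square mult_ac)
      qed
      have "((\<lambda>y. K * norm (y - x)) \<longlongrightarrow> K * norm (x - x)) (at x)" by (intro tendsto_intros)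
      then show "((\<lambda>y. K * norm (y - x)) \<longlongrightarrow> 0) (at x)" by simp
    qed auto
    moreover have "D x = (\<lambda>v. 0)" using False by (simp add: D_def fun_eq_iff)
    ultimately show ?thesis by simp
  qed
  moreover have "bump a b c (\<lambda>x. D x v)" for v
  proof -
    \<comment> \<open>Crude bounds are enough, since \<open>bump\<close> asks only for some
      degree.\<close>
    let ?d = "max d 0 + max e 0 + max (e + 1) 0" and ?e = "max (d - 1) 0 + int 2 * (max (e + 1) 0)"
    have "polyf (max ?d ?e) (q v)"
      unfolding q_def[abs_def]
    proof (intro polyf_add)
      have "polyf ?d (\<lambda>x. p x * W' x v * (of_real c - of_nat m * W x))"
        by (intro polyf_mult polyf_diff polyf_cmult polyf_const polyf_mono[OF p] polyf_mono[OF W'(2)] polyf_mono[OF We]) auto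
      then show "polyf (max ?d ?e) (\<lambda>x. p x * W' x v * (of_real c - of_nat m * W x))"
        by (rule polyf_mono) simp
      have "polyf ?e (\<lambda>x. P' x v * W x ^ 2)"
        by (intro polyf_mult polyf_power polyf_mono[OF P'(2)] polyf_mono[OF We]) auto
      then show "polyf (max ?d ?e) (\<lambda>x. P' x v * W x ^ 2)"
        by (rule polyf_mono) simp
    qed
    then show ?thesis unfolding bump_def D_def W_def by blast
  qed
  ultimately show thesis using that by blast
qed

lemma bump_cmult_coord:
  assumes "bump a b c \<phi>"
  shows "bump a b c (\<lambda>x. k * of_real (x $ i) * \<phi> x)"
proof -
  obtain d p m where p: "polyf d p" and \<phi>_eq: "\<phi> = (\<lambda>x. if x \<in> box a b
       then p x * bump_factor a b c m x else 0)"
    using assms by (auto simp: bump_def)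
  have "polyf (1 + d) (\<lambda>x. k * of_real (x $ i) * p x)"
    by (intro polyf_mult polyf_cmult polyf_coord p) auto
  then show ?thesis
    unfolding bump_def by (intro exI conjI, assumption) (auto simp: \<phi>_eq fun_eq_iff mult.assoc)
qed

lemma bump_continuous: "c > 0 \<Longrightarrow> bump a b c \<phi> \<Longrightarrow> continuous_on S \<phi>"
  by (meson bump_derivative continuous_at_imp_continuous_on has_derivative_continuous)

lemma bump_outside: "bump a b c \<phi> \<Longrightarrow> x \<notin> box a b \<Longrightarrow> \<phi> x = 0"
  by (auto simp: bump_def)

lemma bump_measurable: "c > 0 \<Longrightarrow> bump a b c \<phi> \<Longrightarrow> \<phi> \<in> borel_measurable borel"
  by (intro borel_measurable_continuous_onI bump_continuous)

lemma integrable_compact_support: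
  fixes f :: "'a::euclidean_space \<Rightarrow> complex"
  assumes "continuous_on (cbox a b) f" "\<And>x. x \<notin> cbox a b \<Longrightarrow> f x = 0"
  shows "integrable lborel f" "(LINT x|lborel. f x) = integral (cbox a b) f"
proof -
  have "integrable lborel (\<lambda>x. indicator (cbox a b) x *\<^sub>R f x)"
    using assms(1) by (intro borel_integrable_compact) auto
  also have "(\<lambda>x. indicator (cbox a b) x *\<^sub>R f x) = f"
    using assms(2) by (auto simp: indicator_def)
  finally show 1: "integrable lborel f" .
  have "(LINT x|lborel. f x) = integral UNIV f" using integral_lborel[OF 1] by simp
  also have "\<dots> = integral (cbox a b) f"
  proof -
    have "(\<lambda>x. if x \<in> cbox a b then f x else 0) = f" using assms(2) by auto
    then show ?thesis using integral_restrict_UNIV[of "cbox a b" f] by simp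
  qed
  finally show "(LINT x|lborel. f x) = integral (cbox a b) f" .
qed

lemma bump_integrable:
  assumes "c > 0" "bump a b c \<phi>"
  shows "integrable lborel \<phi>"
proof (rule integrable_compact_support(1))
  show "continuous_on (cbox a b) \<phi>" using bump_continuous[OF assms] .
  show "\<phi> x = 0" if "x \<notin> cbox a b" for x
    using bump_outside[OF assms(2)] box_subset_cbox[of a b] that by blast
qed

section \<open>Fourier transforms of bump functions: differentiation, decay and
  integrability\<close>

lemma bump_partial_deriv:
  assumes "c > 0" "bump a b c \<phi>"
  shows "bump a b c (partial_deriv i \<phi>)" "dir_deriv (axis i 1) \<phi> (partial_deriv i \<phi>)"
proof -
  obtain D where D: "\<And>x. (\<phi> has_derivative D x) (at x)" "\<And>v. bump a b c (\<lambda>x. D x v)"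
    using bump_derivative[OF assms] by blast
  have "partial_deriv i \<phi> = (\<lambda>x. D x (axis i 1))"
    unfolding partial_deriv_def using frechet_derivative_at[OF D(1)] by metis
  then show "bump a b c (partial_deriv i \<phi>)" "dir_deriv (axis i 1) \<phi> (partial_deriv i \<phi>)"
    using D(2) dir_derivI[OF D(1)] by auto
qed

lemma bump_test_function:
  assumes "c > 0" "bump a b c \<phi>"
  shows "test_function \<phi>"
  unfolding test_function_def
proof (intro conjI allI)
  fix js x
  have "bump a b c (foldr partial_deriv js \<phi>)"
    by (induction js) (auto intro: bump_partial_deriv assms)
  then show "foldr partial_deriv js \<phi> differentiable (at x)"
    using bump_derivative[OF assms(1)] unfolding differentiable_def by blast
next
  have "{x. \<phi> x \<noteq> 0} \<subseteq> box a b" using bump_outside[OF assms(2)] by blast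
  then have "bounded {x. \<phi> x \<noteq> 0}" using bounded_box bounded_subset by blast
  then show "compact (closure {x. \<phi> x \<noteq> 0})" by simp
qed

text \<open>Differentiation under the integral. Vanishing outside the box turns the transform into
  an integral over \<open>cbox a b\<close> of a continuous integrand, the setting of the Leibniz
  rule.\<close>

lemma dir_deriv_inverse_fourier_bump:
  assumes c: "c > 0" and \<phi>: "bump a b c \<phi>"
  shows "dir_deriv (axis i 1) (\<F> \<phi>) (\<F> (\<lambda>x. two_pi_i * of_real (x $ i) * \<phi> x))"
  unfolding dir_deriv_def
proof (intro allI)
  fix \<xi> :: "real ^ 'a" and t :: real
  let ?e = "axis i 1 :: real ^ 'a"
  let ?\<psi> = "\<lambda>x. two_pi_i * of_real (x $ i) * \<phi> x"
  have \<psi>: "bump a b c ?\<psi>" by (rule bump_cmult_coord[OF \<phi>])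
  have cont: "continuous_on S \<phi>" "continuous_on S ?\<psi>" for S
    using bump_continuous[OF c \<phi>] bump_continuous[OF c \<psi>] by blast+
  have out: "\<phi> x = 0" if "x \<notin> cbox a b" for x
    using bump_outside[OF \<phi>] box_subset_cbox[of a b] that by blast
  have eq: "\<F> f \<zeta> = integral (cbox a b) (\<lambda>x. f x * wave x \<zeta>)"
    if "continuous_on UNIV f" "\<And>x. x \<notin> cbox a b \<Longrightarrow> f x = 0" for f :: "real ^ 'a \<Rightarrow> complex" and \<zeta>
  proof -
    have "f \<in> borel_measurable borel" using that(1) by (rule borel_measurable_continuous_onI)
    then have "\<F> f \<zeta> = (LINT x|lborel. f x * wave x \<zeta>)"
      by (simp add: inverse_fourier_lborel wave_commute)
    also have "\<dots> = integral (cbox a b) (\<lambda>x. f x * wave x \<zeta>)"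
      using that continuous_on_subset[OF that(1)] by (intro integrable_compact_support(2) continuous_intros) auto
    finally show ?thesis .
  qed
  have "((\<lambda>s. integral (cbox a b) (\<lambda>x. \<phi> x * wave x (\<xi> + s *\<^sub>R ?e))) has_vector_derivative
      integral (cbox a b) (\<lambda>x. ?\<psi> x * wave x (\<xi> + t *\<^sub>R ?e))) (at t within UNIV)"
  proof (rule leibniz_rule_vector_derivative)
    fix s x
    have "((\<lambda>s. wave (\<xi> + s *\<^sub>R ?e) x) has_vector_derivative
        two_pi_i * of_real (?e \<bullet> x) * wave (\<xi> + s *\<^sub>R ?e) x) (at s)"
      using dir_deriv_wave[of ?e x] unfolding dir_deriv_def by blast
    then have "((\<lambda>s. \<phi> x * wave (\<xi> + s *\<^sub>R ?e) x) has_vector_derivative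
        \<phi> x * (two_pi_i * of_real (?e \<bullet> x) * wave (\<xi> + s *\<^sub>R ?e) x)) (at s)"
      by (rule has_vector_derivative_mult_right)
    then show "((\<lambda>s. \<phi> x * wave x (\<xi> + s *\<^sub>R ?e)) has_vector_derivative ?\<psi> x * wave x (\<xi> + s *\<^sub>R ?e)) (at s within UNIV)"
      by (simp add: wave_commute[of x] inner_axis' mult_ac)
  next
    show "(\<lambda>x. \<phi> x * wave x (\<xi> + s *\<^sub>R ?e)) integrable_on cbox a b" for s
      by (intro integrable_continuous continuous_intros cont)
    show "continuous_on (UNIV \<times> cbox a b) (\<lambda>(s, x). ?\<psi> x * wave x (\<xi> + s *\<^sub>R ?e))"
      unfolding case_prod_unfold
      by (intro continuous_intros continuous_on_compose2[OF cont(1)[of UNIV]]) auto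
  qed auto
  then show "((\<lambda>s. \<F> \<phi> (\<xi> + s *\<^sub>R ?e)) has_vector_derivative
      \<F> ?\<psi> (\<xi> + t *\<^sub>R ?e)) (at t)"
    using eq[OF cont(1)] eq[OF cont(2)] out by simp
qed

text \<open>Integration by parts: the derivative of \<open>\<phi> x * wave x \<xi>\<close> along the
  \<open>i\<close>-th axis has integral 0.\<close>

lemma inverse_fourier_partial_deriv:
  assumes c: "c > 0" and \<phi>: "bump a b c \<phi>"
  shows "\<F> (partial_deriv i \<phi>) \<xi> = - 2 * of_real pi * \<i> * of_real (\<xi> $ i) * \<F> \<phi> \<xi>"
proof -
  note d = bump_partial_deriv[OF c \<phi>, of i]
  let ?k = "two_pi_i * of_real (axis i 1 \<bullet> \<xi>)"
  have "(LINT x|lborel. \<phi> x * (?k * wave x \<xi>) + partial_deriv i \<phi> x * wave x \<xi>) = 0"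
  proof (rule integral_dir_deriv_eq_0)
    show "integrable lborel (\<lambda>x. \<phi> x * wave x \<xi>)"
      using integrable_wave[OF bump_integrable[OF c \<phi>], of \<xi>] by (simp add: wave_commute)
    show "dir_deriv (axis i 1) (\<lambda>x. \<phi> x * wave x \<xi>) (\<lambda>x. \<phi> x * (?k * wave x \<xi>) + partial_deriv i \<phi> x * wave x \<xi>)"
      by (intro dir_deriv_mult d dir_deriv_wave)
    show "integrable lborel (\<lambda>x. \<phi> x * (?k * wave x \<xi>) + partial_deriv i \<phi> x * wave x \<xi>)"
      using integrable_wave[OF bump_integrable[OF c \<phi>], of \<xi>] integrable_wave[OF bump_integrable[OF c d(1)], of \<xi>]
      by (auto simp: wave_commute mult.left_commute[of "\<phi> _"])
  qed
  moreover have "(LINT x|lborel. \<phi> x * (?k * wave x \<xi>) + partial_deriv i \<phi> x * wave x \<xi>)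
      = ?k * \<F> \<phi> \<xi> + \<F> (partial_deriv i \<phi>) \<xi>"
    using integrable_wave[OF bump_integrable[OF c \<phi>], of \<xi>] integrable_wave[OF bump_integrable[OF c d(1)], of \<xi>]
    by (simp add: inverse_fourier_lborel[OF bump_measurable[OF c \<phi>]] inverse_fourier_lborel[OF bump_measurable[OF c d(1)]]
        wave_commute[of \<xi>] mult.left_commute[of "\<phi> _"])
  ultimately have "\<F> (partial_deriv i \<phi>) \<xi> = - (?k * \<F> \<phi> \<xi>)"
    by (simp add: eq_neg_iff_add_eq_0 add.commute)
  then show ?thesis by (simp add: inner_axis')
qed

text \<open>Each partial derivative produces one factor
  \<open>2 * pi * \<bar>\<xi> $ i\<bar>\<close> in the transform, and derivatives stay in the bump
  class, so the induction runs over all bumps at once.\<close>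

lemma bump_fourier_decay:
  assumes c: "c > 0" and "bump a b c \<phi>"
  shows "\<exists>C. \<forall>\<xi>. \<bar>\<xi> $ i\<bar> ^ M * cmod (\<F> \<phi> \<xi>) \<le> C"
  using assms(2)
proof (induction M arbitrary: \<phi>)
  case 0
  then show ?case using inverse_fourier_norm_le[OF bump_integrable[OF c 0]] by auto
next
  case (Suc M)
  then obtain C where C: "\<And>\<xi>. \<bar>\<xi> $ i\<bar> ^ M * cmod (\<F> (partial_deriv i \<phi>) \<xi>) \<le> C"
    using bump_partial_deriv(1)[OF c Suc.prems] by blast
  have "\<bar>\<xi> $ i\<bar> ^ Suc M * cmod (\<F> \<phi> \<xi>) \<le> C / (2 * pi)" for \<xi>
    using C[of \<xi>] unfolding inverse_fourier_partial_deriv[OF c Suc.prems]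
    by (simp add: norm_mult pos_le_divide_eq mult_ac)
  then show ?case by blast
qed

text \<open>The norm is at most \<open>CARD('n)\<close> times the largest coordinate in modulus.
  This turns decay in each coordinate separately into decay in the norm.\<close>

lemma norm_power_le_coords:
  fixes \<xi> :: "real ^ 'n::finite"
  shows "norm \<xi> ^ M \<le> real CARD('n) ^ M * (\<Sum>i\<in>UNIV. \<bar>\<xi> $ i\<bar> ^ M)"
proof -
  have "Max (range (\<lambda>i. \<bar>\<xi> $ i\<bar>)) \<in> range (\<lambda>i. \<bar>\<xi> $ i\<bar>)" by (intro Max_in) auto
  from this obtain j where j: "Max (range (\<lambda>i. \<bar>\<xi> $ i\<bar>)) = \<bar>\<xi> $ j\<bar>" by (rule imageE)
  have "\<bar>\<xi> $ i\<bar> \<le> \<bar>\<xi> $ j\<bar>" for i unfolding j[symmetric] by (intro Max_ge) auto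
  then have "norm \<xi> \<le> (\<Sum>i\<in>(UNIV::'n set). \<bar>\<xi> $ j\<bar>)"
    by (intro order_trans[OF norm_le_l1_cart] sum_mono)
  then have "norm \<xi> ^ M \<le> (real CARD('n) * \<bar>\<xi> $ j\<bar>) ^ M" by (intro power_mono) auto
  also have "\<dots> = real CARD('n) ^ M * \<bar>\<xi> $ j\<bar> ^ M" by (simp add: power_mult_distrib)
  also have "\<dots> \<le> real CARD('n) ^ M * (\<Sum>i\<in>UNIV. \<bar>\<xi> $ i\<bar> ^ M)"
    by (intro mult_left_mono member_le_sum[of j UNIV "\<lambda>i. \<bar>\<xi> $ i\<bar> ^ M"]) auto
  finally show ?thesis .
qed

lemma bump_fourier_integrable:
  fixes \<phi> :: "real ^ 'n::finite \<Rightarrow> complex"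
  assumes c: "c > 0" and \<phi>: "bump a b c \<phi>"
  shows "integrable lborel (\<F> \<phi>)"
proof -
  \<comment> \<open>One power more than the dimension makes the tail integrable.\<close>
  define M where "M = CARD('n) + 1"
  obtain C where C: "\<And>i \<xi>. \<bar>\<xi> $ i\<bar> ^ M * cmod (\<F> \<phi> \<xi>) \<le> C i"
    using bump_fourier_decay[OF c \<phi>, of _ M] by metis
  define C1 where "C1 = real CARD('n) ^ M * (\<Sum>i\<in>UNIV. C i)"
  define C0 where "C0 = (LINT x|lborel. cmod (\<phi> x))"
  have 1: "norm \<xi> ^ M * cmod (\<F> \<phi> \<xi>) \<le> C1" for \<xi>
  proof -
    have "norm \<xi> ^ M * cmod (\<F> \<phi> \<xi>) \<le> real CARD('n) ^ M * (\<Sum>i\<in>UNIV. \<bar>\<xi> $ i\<bar> ^ M) * cmod (\<F> \<phi> \<xi>)"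
      by (intro mult_right_mono norm_power_le_coords) auto
    also have "\<dots> = real CARD('n) ^ M * (\<Sum>i\<in>UNIV. \<bar>\<xi> $ i\<bar> ^ M * cmod (\<F> \<phi> \<xi>))"
      by (simp add: sum_distrib_right mult.assoc)
    also have "\<dots> \<le> C1" unfolding C1_def by (intro mult_left_mono sum_mono C) auto
    finally show ?thesis .
  qed
  show ?thesis
  proof (rule integrable_of_decay[where s = "real M" and C = "max C0 C1"])
    show "\<F> \<phi> \<in> borel_measurable borel" by (intro measurable_inverse_fourier bump_measurable[OF c \<phi>])
    show "cmod (\<F> \<phi> \<xi>) \<le> max C0 C1" for \<xi>
      using inverse_fourier_norm_le[OF bump_integrable[OF c \<phi>], of \<xi>] by (simp add: C0_def)
    show "cmod (\<F> \<phi> \<xi>) \<le> max C0 C1 * norm \<xi> powr - real M" if "norm \<xi> \<ge> 1" for \<xi>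
    proof -
      have "norm \<xi> > 0" using that by linarith
      then show ?thesis
        using 1[of \<xi>] by (simp add: powr_minus powr_realpow field_simps max_def)
    qed
  qed (simp add: M_def)
qed

subsection \<open>Plancherel inequality\<close>

abbreviation power_integral :: "real \<Rightarrow> ('a::euclidean_space \<Rightarrow> complex) \<Rightarrow> ennreal" where
  "power_integral q F \<equiv> \<integral>\<^sup>+x. ennreal (cmod (F x) powr q) \<partial>lborel"

abbreviation square_integral :: "('a::euclidean_space \<Rightarrow> complex) \<Rightarrow> ennreal" where
  "square_integral F \<equiv> \<integral>\<^sup>+x. ennreal ((cmod (F x))\<^sup>2) \<partial>lborel"

text \<open>A bump on the cube from \<open>-1\<close> to \<open>1\<close> serves as a nonnegative
  weight that is bounded below near the origin and has an integrable transform.\<close>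

lemma exists_positive_kernel:
  obtains \<theta> :: "real ^ 'n::finite \<Rightarrow> real" and \<kappa> :: real
  where "\<kappa> > 0" "\<And>x. \<theta> x \<ge> 0" "\<And>x. norm x \<le> 1 / 2 \<Longrightarrow> \<theta> x \<ge> \<kappa>" "\<theta> \<in> borel_measurable borel"
    "integrable lborel (\<lambda>x. complex_of_real (\<theta> x))" "integrable lborel (\<F> (\<lambda>x. complex_of_real (\<theta> x)))"
proof -
  define W :: "real ^ 'n \<Rightarrow> real" where "W = bump_weight (- 1) 1"
  define \<theta> where "\<theta> x = (if x \<in> box (- 1) 1 then exp (- inverse (W x)) else 0)" for x
  have bump: "bump (- 1) 1 1 (\<lambda>x. complex_of_real (\<theta> x))"
    unfolding bump_def
  proof (intro exI conjI)
    show "polyf 0 (\<lambda>_. 1)" by (intro polyf_const) auto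
    show "(\<lambda>x. complex_of_real (\<theta> x)) = (\<lambda>x. if x \<in> box (- 1) 1
       then 1 * (inverse (of_real (bump_weight (- 1) 1 x)) ^ 0 * exp (- of_real 1 * inverse (of_real (bump_weight (- 1) 1 x)))) else 0)"
      by (auto simp: \<theta>_def W_def fun_eq_iff exp_of_real[symmetric])
  qed
  \<comment> \<open>On the ball of radius \<open>1/2\<close> each of the two factors per coordinate
    is at least \<open>1/2\<close>, so the weight is at least
    \<open>(1/4) ^ CARD('n)\<close>.\<close>
  have "\<theta> x \<ge> exp (- (4 ^ CARD('n)))" if "norm x \<le> 1 / 2" for x
  proof -
    have x: "\<bar>x $ i\<bar> \<le> 1 / 2" for i using component_le_norm_cart[of x i] that by linarith
    have "- 1 < x $ i \<and> x $ i < 1" for i using x[of i] by linarith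
    then have box: "x \<in> box (- 1) 1" by (simp add: mem_box_cart)
    have "(\<Prod>i\<in>(UNIV :: 'n set). (1 / 2) * (1 / 2)) \<le> W x"
      unfolding W_def bump_weight_def
    proof (intro prod_mono conjI mult_mono)
      fix i show "1 / 2 \<le> x $ i - (- 1) $ i" "1 / 2 \<le> 1 $ i - x $ i" "0 \<le> x $ i - (- 1) $ i"
        using x[of i] by (auto simp: abs_le_iff)
    qed auto
    then have "(1 / 4) ^ CARD('n) \<le> W x" by simp
    then have "inverse (W x) \<le> inverse ((1 / 4) ^ CARD('n))"
      by (intro le_imp_inverse_le) auto
    then show ?thesis using box by (simp add: \<theta>_def power_one_over)
  qed
  moreover have "\<theta> \<in> borel_measurable borel"
  proof -
    have "(\<lambda>x. Re (complex_of_real (\<theta> x))) \<in> borel_measurable borel"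
      using bump_measurable[OF _ bump] by (intro measurable_compose[OF _ borel_measurable_Re]) auto
    then show ?thesis by simp
  qed
  ultimately show thesis
    using bump_integrable[OF _ bump] bump_fourier_integrable[OF _ bump]
    by (intro that[of "exp (- (4 ^ CARD('n)))" \<theta>]) (auto simp: \<theta>_def)
qed

lemma inverse_fourier_scale:
  fixes f :: "real ^ 'n::finite \<Rightarrow> complex"
  assumes [measurable]: "f \<in> borel_measurable borel" and r: "r > 0"
  shows "\<F> (\<lambda>x. f (r *\<^sub>R x)) \<zeta> = of_real (1 / r ^ CARD('n)) * \<F> f ((1 / r) *\<^sub>R \<zeta>)"
proof -
  have "\<F> f ((1 / r) *\<^sub>R \<zeta>) = (LINT x|density (distr lborel borel (\<lambda>x. 0 + r *\<^sub>R x)) (\<lambda>_. ennreal (\<bar>r\<bar> ^ DIM(real ^ 'n))). f x * wave ((1 / r) *\<^sub>R \<zeta>) x)"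
    using r by (subst lborel_affine[symmetric]) (auto simp: inverse_fourier_lborel)
  also have "\<dots> = r ^ CARD('n) *\<^sub>R (LINT x|lborel. f (r *\<^sub>R x) * wave ((1 / r) *\<^sub>R \<zeta>) (r *\<^sub>R x))"
    using r by (simp add: integral_density integral_distr)
  also have "\<dots> = of_real (r ^ CARD('n)) * \<F> (\<lambda>x. f (r *\<^sub>R x)) \<zeta>"
  proof -
    have "wave ((1 / r) *\<^sub>R \<zeta>) (r *\<^sub>R x) = wave \<zeta> x" for x
      using r by (simp add: wave_scaleR)
    then show ?thesis by (simp add: inverse_fourier_lborel scaleR_conv_of_real[where 'a = complex])
  qed
  finally show ?thesis using r by (simp add: field_simps)
qed

text \<open>Dilating a function rescales its transform in argument and height so that the
  \<open>L^1\<close> norm is preserved. Thus the constant of the weighted estimate is the same for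
  all dilates of the kernel.\<close>

lemma nn_integral_inverse_fourier_scale:
  fixes f :: "real ^ 'n::finite \<Rightarrow> complex"
  assumes [measurable]: "f \<in> borel_measurable borel" and r: "r > 0"
  shows "(\<integral>\<^sup>+\<zeta>. ennreal (cmod (\<F> (\<lambda>x. f (r *\<^sub>R x)) \<zeta>)) \<partial>lborel) = (\<integral>\<^sup>+\<zeta>. ennreal (cmod (\<F> f \<zeta>)) \<partial>lborel)"
proof -
  have "(\<integral>\<^sup>+\<zeta>. ennreal (cmod (\<F> f \<zeta>)) \<partial>lborel)
      = ennreal (\<bar>1 / r\<bar> ^ DIM(real ^ 'n)) * (\<integral>\<^sup>+\<zeta>. ennreal (cmod (\<F> f (0 + (1 / r) *\<^sub>R \<zeta>))) \<partial>lborel)"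
    using r by (intro nn_integral_lborel_affine) auto
  also have "\<dots> = (\<integral>\<^sup>+\<zeta>. ennreal ((1 / r) ^ CARD('n)) * ennreal (cmod (\<F> f ((1 / r) *\<^sub>R \<zeta>))) \<partial>lborel)"
    using r by (subst nn_integral_cmult) auto
  also have "\<dots> = (\<integral>\<^sup>+\<zeta>. ennreal (cmod (\<F> (\<lambda>x. f (r *\<^sub>R x)) \<zeta>)) \<partial>lborel)"
    using r by (intro nn_integral_cong) (simp add: inverse_fourier_scale norm_mult norm_divide norm_power ennreal_mult'[symmetric] power_one_over)
  finally show ?thesis by simp
qed

lemma ennreal_norm_integral_le:
  fixes f :: "'a \<Rightarrow> complex"
  shows "ennreal (cmod (LINT x|M. f x)) \<le> (\<integral>\<^sup>+x. ennreal (cmod (f x)) \<partial>M)"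
proof (cases "integrable M f")
  case True
  then show ?thesis by (rule integral_norm_bound_ennreal)
next
  case False
  then show ?thesis by (simp add: not_integrable_integral_eq)
qed

text \<open>The left side is the integral of \<open>h * H\<close>. Two uses of the multiplication
  formula turn it, up to conjugation, into a double integral of \<open>F \<xi>\<close>,
  \<open>F \<eta>\<close> and \<open>\<Theta> (\<eta> - \<xi>)\<close>, which the Schur test bounds
  by the \<open>L^1\<close> norm of \<open>\<Theta>\<close> times the square integral of
  \<open>F\<close>.\<close>

lemma weighted_plancherel:
  fixes F :: "real ^ 'n::finite \<Rightarrow> complex" and \<theta> :: "real ^ 'n \<Rightarrow> real"
  assumes F: "integrable lborel F" and \<theta>0: "\<And>x. \<theta> x \<ge> 0" and \<theta>: "integrable lborel (\<lambda>x. complex_of_real (\<theta> x))"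
  shows "(\<integral>\<^sup>+x. ennreal (\<theta> x * (cmod (\<F> F x))\<^sup>2) \<partial>lborel)
    \<le> (\<integral>\<^sup>+\<zeta>. ennreal (cmod (\<F> (\<lambda>x. complex_of_real (\<theta> x)) \<zeta>)) \<partial>lborel) * square_integral F"
proof -
  let ?\<theta> = "\<lambda>x. complex_of_real (\<theta> x)"
  have [measurable]: "F \<in> borel_measurable borel" "?\<theta> \<in> borel_measurable borel"
    using F \<theta> by (simp_all add: borel_measurable_integrable)
  define \<Theta> where "\<Theta> = \<F> ?\<theta>"
  define h where "h = \<F> F"
  have [measurable]: "\<Theta> \<in> borel_measurable borel" "h \<in> borel_measurable borel"
    unfolding \<Theta>_def h_def by (intro measurable_inverse_fourier; simp)+
  have "(\<lambda>x. Re (complex_of_real (\<theta> x))) \<in> borel_measurable borel" by measurable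
  then have [measurable]: "\<theta> \<in> borel_measurable borel" by simp
  define H where "H x = complex_of_real (\<theta> x) * cnj (h x)" for x
  have h_bound: "cmod (h x) \<le> (LINT \<xi>|lborel. cmod (F \<xi>))" for x
    unfolding h_def by (rule inverse_fourier_norm_le[OF F])
  have [measurable]: "(\<lambda>x. cnj (h x)) \<in> borel_measurable borel"
    by (intro measurable_compose[OF _ borel_measurable_continuous_onI[OF continuous_on_cnj[OF continuous_on_id]]]) measurable
  have H: "integrable lborel H"
    unfolding H_def by (rule integrable_mult_bounded[OF \<theta>]) (use h_bound in auto)
  then have [measurable]: "H \<in> borel_measurable borel" by (simp add: borel_measurable_integrable)
  let ?I = "\<lambda>\<xi>. \<integral>\<^sup>+\<eta>. ennreal (cmod (F \<eta>) * cmod (\<Theta> (\<eta> - \<xi>))) \<partial>lborel"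
  \<comment> \<open>Multiplying \<open>\<theta>\<close> by a wave translates its transform, so up to
    conjugation the transform of \<open>H\<close> is a correlation of \<open>F\<close> with
    \<open>\<Theta>\<close>.\<close>
  have fourier_H: "ennreal (cmod (\<F> H \<xi>)) \<le> ?I \<xi>" for \<xi>
  proof -
    have B: "integrable lborel (\<lambda>x. complex_of_real (\<theta> x) * wave x (- \<xi>))"
      using integrable_wave[OF \<theta>, of "- \<xi>"] by (simp add: wave_commute)
    have "cnj (\<F> H \<xi>) = (LINT x|lborel. cnj (H x * wave \<xi> x))"
      by (simp add: inverse_fourier_lborel integral_cnj del: complex_cnj_mult)
    also have "\<dots> = (LINT x|lborel. \<F> F x * (complex_of_real (\<theta> x) * wave x (- \<xi>)))"
      by (simp add: H_def h_def wave_minus wave_commute[of \<xi>] mult_ac)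
    also have "\<dots> = (LINT \<eta>|lborel. F \<eta> * \<F> (\<lambda>x. complex_of_real (\<theta> x) * wave x (- \<xi>)) \<eta>)"
      by (rule inverse_fourier_multiplication[OF F B])
    also have "\<F> (\<lambda>x. complex_of_real (\<theta> x) * wave x (- \<xi>)) = (\<lambda>\<eta>. \<Theta> (\<eta> - \<xi>))"
    proof (rule ext)
      fix \<eta>
      have "wave x (- \<xi>) * wave \<eta> x = wave (\<eta> - \<xi>) x" for x
        using wave_add[of x "- \<xi>" \<eta>] by (simp add: wave_commute[of _ x] add.commute)
      then show "\<F> (\<lambda>x. complex_of_real (\<theta> x) * wave x (- \<xi>)) \<eta> = \<Theta> (\<eta> - \<xi>)"
        by (simp add: \<Theta>_def inverse_fourier_lborel mult.assoc)
    qed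
    finally have "ennreal (cmod (cnj (\<F> H \<xi>))) \<le> (\<integral>\<^sup>+\<eta>. ennreal (cmod (F \<eta> * \<Theta> (\<eta> - \<xi>))) \<partial>lborel)"
      using ennreal_norm_integral_le by metis
    then show ?thesis by (simp add: norm_mult)
  qed
  have Hh: "h x * H x = of_real (\<theta> x * (cmod (h x))\<^sup>2)" for x
  proof -
    have "h x * H x = of_real (\<theta> x) * (h x * cnj (h x))" by (simp add: H_def mult_ac)
    then show ?thesis by (simp only: complex_norm_square[symmetric] of_real_mult)
  qed
  define N where "N = (\<integral>\<^sup>+\<zeta>. ennreal (cmod (\<Theta> \<zeta>)) \<partial>lborel)"
  have N1: "(\<integral>\<^sup>+\<eta>. ennreal (cmod (\<Theta> (\<eta> - \<xi>))) \<partial>lborel) = N" for \<xi>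
    using nn_integral_lborel_affine[of "\<lambda>\<zeta>. ennreal (cmod (\<Theta> \<zeta>))" 1 "- \<xi>"] by (simp add: N_def)
  have N2: "(\<integral>\<^sup>+\<xi>. ennreal (cmod (\<Theta> (\<eta> - \<xi>))) \<partial>lborel) = N" for \<eta>
    using nn_integral_lborel_affine[of "\<lambda>\<zeta>. ennreal (cmod (\<Theta> \<zeta>))" "-1" \<eta>] by (simp add: N_def)
  let ?S = "\<lambda>\<xi>. ennreal ((cmod (F \<xi>))\<^sup>2 / 2)"
  let ?T = "\<lambda>\<xi> \<eta>. ennreal (cmod (\<Theta> (\<eta> - \<xi>)))"
  have "(\<integral>\<^sup>+x. ennreal (\<theta> x * (cmod (h x))\<^sup>2) \<partial>lborel) = ennreal (LINT x|lborel. \<theta> x * (cmod (h x))\<^sup>2)"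
  proof (rule nn_integral_eq_integral)
    have "integrable lborel (\<lambda>x. Re (H x * h x))"
      by (intro integrable_Re integrable_mult_bounded[OF H _ h_bound]) auto
    moreover have "H x * h x = of_real (\<theta> x * (cmod (h x))\<^sup>2)" for x
      using Hh[of x] by (simp add: mult.commute)
    ultimately show "integrable lborel (\<lambda>x. \<theta> x * (cmod (h x))\<^sup>2)" by simp
  qed (use \<theta>0 in auto)
  also have "ennreal (LINT x|lborel. \<theta> x * (cmod (h x))\<^sup>2) \<le> ennreal (cmod (LINT x|lborel. h x * H x))"
  proof (rule ennreal_leI)
    have "(LINT x|lborel. h x * H x) = of_real (LINT x|lborel. \<theta> x * (cmod (h x))\<^sup>2)"
      by (simp only: Hh integral_complex_of_real)
    then show "(LINT x|lborel. \<theta> x * (cmod (h x))\<^sup>2) \<le> cmod (LINT x|lborel. h x * H x)" by simp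
  qed
  also have "(LINT x|lborel. h x * H x) = (LINT \<xi>|lborel. F \<xi> * \<F> H \<xi>)"
    unfolding h_def by (rule inverse_fourier_multiplication[OF F H])
  also have "ennreal (cmod \<dots>) \<le> (\<integral>\<^sup>+\<xi>. ennreal (cmod (F \<xi> * \<F> H \<xi>)) \<partial>lborel)"
    by (rule ennreal_norm_integral_le)
  also have "\<dots> \<le> (\<integral>\<^sup>+\<xi>. ennreal (cmod (F \<xi>)) * ?I \<xi> \<partial>lborel)"
  proof (intro nn_integral_mono)
    fix \<xi>
    have "ennreal (cmod (F \<xi> * \<F> H \<xi>)) = ennreal (cmod (F \<xi>)) * ennreal (cmod (\<F> H \<xi>))"
      by (simp add: norm_mult ennreal_mult)
    also have "\<dots> \<le> ennreal (cmod (F \<xi>)) * ?I \<xi>"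
      by (intro mult_left_mono fourier_H) simp
    finally show "ennreal (cmod (F \<xi> * \<F> H \<xi>))
      \<le> ennreal (cmod (F \<xi>)) * ?I \<xi>" .
  qed
  also have "\<dots> = (\<integral>\<^sup>+\<xi>. \<integral>\<^sup>+\<eta>. ennreal (cmod (F \<xi>) * cmod (F \<eta>) * cmod (\<Theta> (\<eta> - \<xi>))) \<partial>lborel \<partial>lborel)"
    by (simp add: nn_integral_cmult[symmetric] ennreal_mult mult.assoc)
  \<comment> \<open>The arithmetic-geometric mean inequality separates the two values of
    \<open>F\<close>; integrating out the other variable leaves \<open>N\<close> in both terms, by
    translation and reflection invariance.\<close>
  also have "\<dots> \<le> (\<integral>\<^sup>+\<xi>. \<integral>\<^sup>+\<eta>. ?S \<xi> * ?T \<xi> \<eta> + ?S \<eta> * ?T \<xi> \<eta> \<partial>lborel \<partial>lborel)"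
  proof (intro nn_integral_mono)
    fix \<xi> \<eta>
    have "cmod (F \<xi>) * cmod (F \<eta>) \<le> (cmod (F \<xi>))\<^sup>2 / 2 + (cmod (F \<eta>))\<^sup>2 / 2"
      using sum_squares_bound[of "cmod (F \<xi>)" "cmod (F \<eta>)"] by simp
    then have "cmod (F \<xi>) * cmod (F \<eta>) * cmod (\<Theta> (\<eta> - \<xi>)) \<le> ((cmod (F \<xi>))\<^sup>2 / 2 + (cmod (F \<eta>))\<^sup>2 / 2) * cmod (\<Theta> (\<eta> - \<xi>))"
      by (intro mult_right_mono) auto
    then have "ennreal (cmod (F \<xi>) * cmod (F \<eta>) * cmod (\<Theta> (\<eta> - \<xi>))) \<le> ennreal (((cmod (F \<xi>))\<^sup>2 / 2 + (cmod (F \<eta>))\<^sup>2 / 2) * cmod (\<Theta> (\<eta> - \<xi>)))"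
      by (rule ennreal_leI)
    also have "\<dots> = ?S \<xi> * ?T \<xi> \<eta> + ?S \<eta> * ?T \<xi> \<eta>"
      by (subst ennreal_mult'', simp, subst ennreal_plus) (simp_all add: distrib_right)
    finally show "ennreal (cmod (F \<xi>) * cmod (F \<eta>) * cmod (\<Theta> (\<eta> - \<xi>))) \<le> ?S \<xi> * ?T \<xi> \<eta> + ?S \<eta> * ?T \<xi> \<eta>" .
  qed
  also have "\<dots> = (\<integral>\<^sup>+\<xi>. \<integral>\<^sup>+\<eta>. ?S \<xi> * ?T \<xi> \<eta> \<partial>lborel \<partial>lborel)
      + (\<integral>\<^sup>+\<xi>. \<integral>\<^sup>+\<eta>. ?S \<eta> * ?T \<xi> \<eta> \<partial>lborel \<partial>lborel)"
    by (simp add: nn_integral_add)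
  also have "(\<integral>\<^sup>+\<xi>. \<integral>\<^sup>+\<eta>. ?S \<xi> * ?T \<xi> \<eta> \<partial>lborel \<partial>lborel) = (\<integral>\<^sup>+\<xi>. ?S \<xi> \<partial>lborel) * N"
    by (simp add: nn_integral_cmult nn_integral_multc N1)
  also have "(\<integral>\<^sup>+\<xi>. \<integral>\<^sup>+\<eta>. ?S \<eta> * ?T \<xi> \<eta> \<partial>lborel \<partial>lborel)
      = (\<integral>\<^sup>+\<eta>. \<integral>\<^sup>+\<xi>. ?S \<eta> * ?T \<xi> \<eta> \<partial>lborel \<partial>lborel)"
    by (rule lborel_pair.Fubini') measurable
  also have "\<dots> = (\<integral>\<^sup>+\<xi>. ?S \<xi> \<partial>lborel) * N"
    by (simp add: nn_integral_cmult nn_integral_multc N2)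
  also have "(\<integral>\<^sup>+\<xi>. ?S \<xi> \<partial>lborel) * N + (\<integral>\<^sup>+\<xi>. ?S \<xi> \<partial>lborel) * N = N * (\<integral>\<^sup>+\<xi>. ?S \<xi> + ?S \<xi> \<partial>lborel)"
    by (simp add: nn_integral_add distrib_left mult.commute)
  also have "(\<integral>\<^sup>+\<xi>. ?S \<xi> + ?S \<xi> \<partial>lborel) = square_integral F"
    by (intro nn_integral_cong) (simp flip: ennreal_plus)
  finally show ?thesis by (simp add: N_def \<Theta>_def h_def)
qed

text \<open>The kernel \<open>\<theta>\<close> dilated by \<open>k + 1\<close> is at least
  \<open>\<kappa>\<close> on the ball of radius \<open>(k + 1) / 2\<close>, while the
  \<open>L^1\<close> norm \<open>N\<close> of its transform does not change. The estimate with
  constant \<open>N / \<kappa>\<close> therefore holds on every such ball, and monotone convergence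
  extends it to the whole space.\<close>

lemma plancherel_inequality:
  obtains K :: real where "K \<ge> 0"
    "\<And>F :: real ^ 'n::finite \<Rightarrow> complex. integrable lborel F \<Longrightarrow>
      square_integral (\<F> F) \<le> ennreal K * square_integral F"
proof -
  obtain \<theta> :: "real ^ 'n \<Rightarrow> real" and \<kappa> :: real
    where \<theta>: "\<kappa> > 0" "\<And>x. \<theta> x \<ge> 0" "\<And>x. norm x \<le> 1 / 2 \<Longrightarrow> \<theta> x \<ge> \<kappa>" "\<theta> \<in> borel_measurable borel"
    "integrable lborel (\<lambda>x. complex_of_real (\<theta> x))" "integrable lborel (\<F> (\<lambda>x. complex_of_real (\<theta> x)))"
    by (rule exists_positive_kernel, rule that)
  note [measurable] = \<theta>(4)
  define N where "N = (\<integral>\<^sup>+\<zeta>. ennreal (cmod (\<F> (\<lambda>x. complex_of_real (\<theta> x)) \<zeta>)) \<partial>lborel)"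
  have N: "N < \<infinity>" using \<theta>(6) by (simp add: N_def integrable_iff_bounded)
  have "square_integral (\<F> F) \<le> ennreal (enn2real N / \<kappa>) * square_integral F"
    if F: "integrable lborel F" for F :: "real ^ 'n \<Rightarrow> complex"
  proof -
    note [measurable] = borel_of_integrable[OF F]
    define u where "u x = ennreal ((cmod (\<F> F x))\<^sup>2)" for x
    have [measurable]: "u \<in> borel_measurable borel"
      unfolding u_def[abs_def] by measurable
    define A where "A k = {x :: real ^ 'n. norm x \<le> real (Suc k) / 2}" for k
    have [measurable]: "A k \<in> sets borel" for k unfolding A_def by measurable
    have le: "(\<integral>\<^sup>+x\<in>A k. u x \<partial>lborel) \<le> ennreal (1 / \<kappa>) * (N * square_integral F)" for k
    proof -
      define r where "r = 1 / real (Suc k)"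
      have r: "r > 0" by (simp add: r_def)
      have \<theta>r: "integrable lborel (\<lambda>x. complex_of_real (\<theta> (r *\<^sub>R x)))"
      proof -
        have "(\<integral>\<^sup>+x. ennreal (\<theta> x) \<partial>lborel) = ennreal (\<bar>r\<bar> ^ DIM(real ^ 'n)) * (\<integral>\<^sup>+x. ennreal (\<theta> (0 + r *\<^sub>R x)) \<partial>lborel)"
          using r by (intro nn_integral_lborel_affine) auto
        moreover have "(\<integral>\<^sup>+x. ennreal (\<theta> x) \<partial>lborel) < \<infinity>"
          using \<theta>(2,5) by (simp add: integrable_iff_bounded)
        ultimately show ?thesis using r \<theta>(2) by (auto simp: integrable_iff_bounded ennreal_mult_less_top)
      qed
      let ?g = "\<lambda>x. ennreal (\<theta> (r *\<^sub>R x) * (cmod (\<F> F x))\<^sup>2)"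
      have "(\<integral>\<^sup>+x\<in>A k. u x \<partial>lborel) \<le> (\<integral>\<^sup>+x. ennreal (1 / \<kappa>) * ?g x \<partial>lborel)"
      proof (intro nn_integral_mono)
        fix x
        show "u x * indicator (A k) x \<le> ennreal (1 / \<kappa>) * ?g x"
        proof (cases "x \<in> A k")
          case True
          then have "\<theta> (r *\<^sub>R x) \<ge> \<kappa>" by (intro \<theta>(3)) (simp add: r_def A_def field_simps)
          then have "1 * (cmod (\<F> F x))\<^sup>2 \<le> (1 / \<kappa> * \<theta> (r *\<^sub>R x)) * (cmod (\<F> F x))\<^sup>2"
            using \<theta>(1) by (intro mult_right_mono) (auto simp: field_simps)
          then show ?thesis using True \<theta>(1) by (simp add: u_def ennreal_mult'[symmetric] ennreal_leI mult.assoc)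
        qed simp
      qed
      also have "\<dots> = ennreal (1 / \<kappa>) * (\<integral>\<^sup>+x. ?g x \<partial>lborel)"
        by (intro nn_integral_cmult) measurable
      also have "\<dots> \<le> ennreal (1 / \<kappa>) * (N * square_integral F)"
        using weighted_plancherel[OF F, of "\<lambda>x. \<theta> (r *\<^sub>R x)", OF \<theta>(2) \<theta>r]
          nn_integral_inverse_fourier_scale[of "\<lambda>x. complex_of_real (\<theta> x)" r] r
        by (intro mult_left_mono) (auto simp: N_def)
      finally show ?thesis .
    qed
    have "u x = (SUP k. u x * indicator (A k) x)" for x
    proof (rule antisym)
      obtain k :: nat where "2 * norm x \<le> real k" using real_arch_simple by blast
      then have "x \<in> A k" by (simp add: A_def)
      then show "u x \<le> (SUP k. u x * indicator (A k) x)" by (intro SUP_upper2[of k]) auto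
      show "(SUP k. u x * indicator (A k) x) \<le> u x" by (intro SUP_least) (auto simp: indicator_def)
    qed
    then have "(\<integral>\<^sup>+x. u x \<partial>lborel) = (\<integral>\<^sup>+x. (SUP k. u x * indicator (A k) x) \<partial>lborel)" by simp
    also have "\<dots> = (SUP k. (\<integral>\<^sup>+x\<in>A k. u x \<partial>lborel))"
    proof (rule nn_integral_monotone_convergence_SUP)
      show "incseq (\<lambda>k x. u x * indicator (A k) x)"
        by (auto simp: incseq_def le_fun_def A_def indicator_def field_simps)
    qed measurable
    also have "\<dots> \<le> ennreal (1 / \<kappa>) * (N * square_integral F)"
      by (intro SUP_least le)
    also have "ennreal (1 / \<kappa>) * (N * square_integral F) = ennreal (enn2real N / \<kappa>) * square_integral F"
    proof -
      have "ennreal (enn2real N / \<kappa>) = ennreal (1 / \<kappa>) * ennreal (enn2real N)"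
        using \<theta>(1) by (simp add: ennreal_mult'[symmetric])
      then show ?thesis using N by (simp add: mult.assoc)
    qed
    finally show ?thesis by (simp add: u_def)
  qed
  moreover have "enn2real N / \<kappa> \<ge> 0" using \<theta>(1) by simp
  ultimately show thesis by (rule that[rotated])
qed

subsection \<open>Hausdorff-Young inequality\<close>

lemma nn_integral_powr_interval:
  fixes e b :: real
  assumes "e > -1" "b \<ge> 0"
  shows "(\<integral>\<^sup>+s\<in>{0..b}. ennreal (s powr e) \<partial>lborel) = ennreal (b powr (e + 1) / (e + 1))"
proof -
  have "(\<integral>\<^sup>+s. ennreal (indicator {0..b} s * s powr e) \<partial>lborel) = ennreal (b powr (e + 1) / (e + 1))"
  proof (rule nn_integral_has_integral_lborel)
    have "((\<lambda>s. s powr e) has_integral (b powr (e + 1) / (e + 1))) {0..b}"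
      using assms by (intro has_integral_powr_from_0) auto
    moreover have "(\<lambda>s. indicator {0..b} s * s powr e) = (\<lambda>s. if s \<in> {0..b} then s powr e else 0)"
      by (auto simp: indicator_def)
    ultimately show "((\<lambda>s. indicator {0..b} s * s powr e) has_integral (b powr (e + 1) / (e + 1))) UNIV"
      by (simp only: has_integral_restrict_UNIV)
  qed auto
  moreover have "ennreal (indicator {0..b} s * s powr e) = ennreal (s powr e) * indicator {0..b} s" for s
    by (simp add: indicator_def)
  ultimately show ?thesis by simp
qed

lemma inverse_fourier_add:
  assumes "integrable lborel f" "integrable lborel g"
  shows "\<F> (\<lambda>x. f x + g x) \<xi> = \<F> f \<xi> + \<F> g \<xi>"
proof -
  have [measurable]: "f \<in> borel_measurable borel" "g \<in> borel_measurable borel"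
    using assms by (simp_all add: borel_measurable_integrable)
  show ?thesis
    using integrable_wave[OF assms(1), of \<xi>] integrable_wave[OF assms(2), of \<xi>]
    by (simp add: inverse_fourier_lborel distrib_right)
qed

text \<open>Marcinkiewicz interpolation between \<open>L\<^sup>1 \<rightarrow> L\<^sup>\<infinity>\<close> and \<open>L\<^sup>2 \<rightarrow> L\<^sup>2\<close>: the cut-off height \<open>(A/s)\<^sup>q\<^sup>-\<^sup>1\<close> makes the
  \<open>L\<^sup>1\<close> norm of the large part of \<open>F\<close> at most \<open>s/2\<close>.\<close>

lemma hausdorff_young_split:
  fixes F :: "real ^ 'n::finite \<Rightarrow> complex" and q A K s :: real
  assumes F: "integrable lborel F" and q: "q > 2" and A: "A > 0" and s: "s > 0"
    and norm: "power_integral (q / (q - 1)) F \<le> ennreal (A / 2)"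
    and K: "K \<ge> 0" "\<And>F :: real ^ 'n \<Rightarrow> complex. integrable lborel F \<Longrightarrow>
      square_integral (\<F> F) \<le> ennreal K * square_integral F"
  shows "emeasure lborel {x. cmod (\<F> F x) > s}
    \<le> ennreal (4 * K / s\<^sup>2) * (\<integral>\<^sup>+\<xi>\<in>{\<xi>. cmod (F \<xi>) \<le> (A / s) powr (q - 1)}. ennreal ((cmod (F \<xi>))\<^sup>2) \<partial>lborel)"
proof -
  note [measurable] = borel_of_integrable[OF F]
  define l where "l = (A / s) powr (q - 1)"
  have l: "l > 0" using A s by (simp add: l_def)
  define low where "low \<xi> = F \<xi> * of_real (indicator {\<xi>. cmod (F \<xi>) \<le> l} \<xi>)" for \<xi>
  define high where "high \<xi> = F \<xi> * of_real (indicator {\<xi>. cmod (F \<xi>) > l} \<xi>)" for \<xi>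
  have int: "integrable lborel low" "integrable lborel high"
    unfolding low_def high_def by (rule integrable_mult_bounded[OF F, of _ 1]; (measurable | simp add: indicator_def))+
  then have [measurable]: "low \<in> borel_measurable borel" "high \<in> borel_measurable borel"
    by (simp_all add: borel_measurable_integrable)
  have split: "F = (\<lambda>\<xi>. low \<xi> + high \<xi>)" by (auto simp: low_def high_def indicator_def fun_eq_iff)
  have high_le: "cmod (high \<xi>) \<le> s / A * cmod (F \<xi>) powr (q / (q - 1))" for \<xi>
  proof (cases "cmod (F \<xi>) > l")
    case True
    define y where "y = cmod (F \<xi>)"
    have y: "y > l" "y > 0" using True l by (auto simp: y_def)
    \<comment> \<open>The height \<open>l\<close> is chosen so that
      \<open>y powr (1 / (q - 1)) \<ge> A / s\<close> for \<open>y > l\<close>; multiplying by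
      \<open>y\<close> raises the exponent to \<open>q / (q - 1)\<close>.\<close>
    have "A / s = l powr (1 / (q - 1))" using A s q by (simp add: l_def powr_powr)
    also have "\<dots> \<le> y powr (1 / (q - 1))" using l y q by (intro powr_mono2) auto
    finally have "1 \<le> s / A * y powr (1 / (q - 1))" using A s by (simp add: field_simps)
    then have "y * 1 \<le> y * (s / A * y powr (1 / (q - 1)))" using y by (intro mult_left_mono) auto
    also have "\<dots> = s / A * (y powr 1 * y powr (1 / (q - 1)))" using y by simp
    also have "y powr 1 * y powr (1 / (q - 1)) = y powr (q / (q - 1))"
      using q by (subst powr_add[symmetric]) (simp add: field_simps)
    finally show ?thesis using True by (simp add: high_def y_def)
  next
    case False
    then show ?thesis using A s by (simp add: high_def)
  qed
  have "cmod (\<F> high x) \<le> s / 2" for x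
  proof -
    have "ennreal (LINT \<xi>|lborel. cmod (high \<xi>)) = (\<integral>\<^sup>+\<xi>. ennreal (cmod (high \<xi>)) \<partial>lborel)"
      using int by (intro nn_integral_eq_integral[symmetric]) auto
    also have "\<dots> \<le> (\<integral>\<^sup>+\<xi>. ennreal (s / A) * ennreal (cmod (F \<xi>) powr (q / (q - 1))) \<partial>lborel)"
      using high_le A s by (intro nn_integral_mono) (simp add: ennreal_mult'[symmetric] ennreal_leI)
    also have "\<dots> = ennreal (s / A) * power_integral (q / (q - 1)) F"
      by (intro nn_integral_cmult) measurable
    also have "\<dots> \<le> ennreal (s / A) * ennreal (A / 2)" by (intro mult_left_mono norm) auto
    also have "\<dots> = ennreal (s / 2)" using A s by (simp add: ennreal_mult'[symmetric])
    finally have "(LINT \<xi>|lborel. cmod (high \<xi>)) \<le> s / 2" using s by simp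
    then show ?thesis using inverse_fourier_norm_le[OF int(2), of x] by simp
  qed
  \<comment> \<open>The large part accounts for at most half of the level \<open>s\<close>, so the
    small part must supply the rest.\<close>
  then have low_ge: "cmod (\<F> low x) \<ge> s / 2" if "cmod (\<F> F x) > s" for x
  proof -
    have "cmod (\<F> F x) \<le> cmod (\<F> low x) + cmod (\<F> high x)"
      by (subst split, subst inverse_fourier_add[OF int]) (rule norm_triangle_ineq)
    moreover have "cmod (\<F> high x) \<le> s / 2" by fact
    ultimately show ?thesis using that by linarith
  qed
  have "emeasure lborel {x. cmod (\<F> F x) > s} = (\<integral>\<^sup>+x. indicator {x. cmod (\<F> F x) > s} x \<partial>lborel)"
    by simp
  \<comment> \<open>Chebyshev at level \<open>s / 2\<close>, which is where the 4 comes
    from.\<close>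
  also have "\<dots> \<le> (\<integral>\<^sup>+x. ennreal (4 / s\<^sup>2) * ennreal ((cmod (\<F> low x))\<^sup>2) \<partial>lborel)"
  proof (intro nn_integral_mono)
    fix x
    show "indicator {x. cmod (\<F> F x) > s} x \<le> ennreal (4 / s\<^sup>2) * ennreal ((cmod (\<F> low x))\<^sup>2)"
    proof (cases "cmod (\<F> F x) > s")
      case True
      have "(s / 2)\<^sup>2 \<le> (cmod (\<F> low x))\<^sup>2" using low_ge[OF True] s by (intro power_mono) auto
      then have "1 \<le> 4 / s\<^sup>2 * (cmod (\<F> low x))\<^sup>2" using s by (simp add: field_simps power_divide)
      then show ?thesis using True by (simp add: ennreal_mult'[symmetric] flip: ennreal_1 del: ennreal_eq_1 ennreal_1)
    qed simp
  qed
  also have "\<dots> = ennreal (4 / s\<^sup>2) * square_integral (\<F> low)"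
    by (intro nn_integral_cmult) measurable
  also have "\<dots> \<le> ennreal (4 / s\<^sup>2) * (ennreal K * square_integral low)"
    by (intro mult_left_mono K int) auto
  also have "\<dots> = ennreal (4 * K / s\<^sup>2) * square_integral low"
    using K(1) by (simp add: mult.assoc[symmetric] ennreal_mult'[symmetric])
  also have "square_integral low = (\<integral>\<^sup>+\<xi>\<in>{\<xi>. cmod (F \<xi>) \<le> l}. ennreal ((cmod (F \<xi>))\<^sup>2) \<partial>lborel)"
    by (intro nn_integral_cong) (simp add: low_def indicator_def)
  finally show ?thesis by (simp add: l_def)
qed

text \<open>The layer-cake formula and the bound on level sets give a double integral in
  \<open>s\<close> and \<open>\<xi>\<close>. For fixed \<open>y = cmod (F \<xi>) > 0\<close> the
  cut-off condition says \<open>s \<le> A * y powr (- 1 / (q - 1))\<close>. Integrating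
  \<open>s powr (q - 3)\<close> up to there, which converges as \<open>q > 2\<close>, and
  multiplying by \<open>y^2\<close> yields a multiple of
  \<open>y powr (q / (q - 1))\<close>.\<close>

lemma hausdorff_young_aux:
  fixes F :: "real ^ 'n::finite \<Rightarrow> complex" and q :: real
  assumes F: "integrable lborel F" and q: "q > 2"
    and fin: "power_integral (q / (q - 1)) F < \<infinity>"
  shows "power_integral q (\<F> F) < \<infinity>"
proof -
  obtain K :: real where K: "K \<ge> 0" "\<And>F :: real ^ 'n \<Rightarrow> complex. integrable lborel F \<Longrightarrow>
      square_integral (\<F> F) \<le> ennreal K * square_integral F"
    by (rule plancherel_inequality, rule that)
  note [measurable] = borel_of_integrable[OF F]
  define M where "M = power_integral (q / (q - 1)) F"
  \<comment> \<open>The added 1 keeps \<open>A\<close> positive when \<open>F\<close> vanishes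
    almost everywhere.\<close>
  define A where "A = 2 * (enn2real M + 1)"
  have A: "A > 0" by (simp add: A_def add_nonneg_pos)
  have MA: "M \<le> ennreal (A / 2)"
    using fin unfolding M_def[symmetric] A_def by (cases M) (auto intro: ennreal_leI)
  let ?h = "\<lambda>x. cmod (\<F> F x)"
  let ?l = "\<lambda>s. (A / s) powr (q - 1)"
  \<comment> \<open>The conditions are written as indicators of sets of pairs, so that joint
    measurability is visible for the exchange of integrals.\<close>
  let ?U = "\<lambda>s y. ennreal (q * s powr (q - 1)) * indicator {p. 0 < fst p \<and> fst p < snd p} (s, y)"
  let ?V = "\<lambda>s y. ennreal (s powr (q - 3)) * indicator {p. 0 < fst p \<and> snd p \<le> ?l (fst p)} (s, y)"
  let ?W = "\<lambda>s y. ennreal (4 * K * q) * (ennreal (y\<^sup>2) * ?V s y)"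
  have "(\<integral>\<^sup>+x. ennreal (?h x powr q) \<partial>lborel)
    \<le> (\<integral>\<^sup>+x. \<integral>\<^sup>+s. ?U s (?h x) \<partial>lborel \<partial>lborel)"
  proof (intro nn_integral_mono)
    fix x
    have "ennreal (?h x powr q) = ennreal q * (\<integral>\<^sup>+s\<in>{0..?h x}. ennreal (s powr (q - 1)) \<partial>lborel)"
      using q by (subst nn_integral_powr_interval) (auto simp: ennreal_mult'[symmetric])
    also have "\<dots> = (\<integral>\<^sup>+s. ennreal q * (ennreal (s powr (q - 1)) * indicator {0..?h x} s) \<partial>lborel)"
      by (intro nn_integral_cmult[symmetric]) measurable
    also have "\<dots> = (\<integral>\<^sup>+s. ?U s (?h x) \<partial>lborel)"
    proof (intro nn_integral_cong_AE)
      have "AE s in lborel. s \<noteq> 0 \<and> s \<noteq> ?h x" by (intro AE_conjI AE_lborel_singleton)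
      then show "AE s in lborel. ennreal q * (ennreal (s powr (q - 1)) * indicator {0..?h x} s)
          = ?U s (?h x)"
        by eventually_elim (use q in \<open>auto simp: indicator_def ennreal_mult'\<close>)
    qed
    finally show "ennreal (?h x powr q) \<le> (\<integral>\<^sup>+s. ?U s (?h x) \<partial>lborel)"
      by simp
  qed
  also have "\<dots> = (\<integral>\<^sup>+s. \<integral>\<^sup>+x. ?U s (?h x) \<partial>lborel \<partial>lborel)"
    by (rule lborel_pair.Fubini') measurable
  also have "\<dots> \<le> (\<integral>\<^sup>+s. \<integral>\<^sup>+\<xi>. ?W s (cmod (F \<xi>)) \<partial>lborel \<partial>lborel)"
  proof (rule nn_integral_mono)
    fix s :: real
    show "(\<integral>\<^sup>+x. ?U s (?h x) \<partial>lborel)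
      \<le> (\<integral>\<^sup>+\<xi>. ?W s (cmod (F \<xi>)) \<partial>lborel)"
    proof (cases "s > 0")
      case True
      have "(\<integral>\<^sup>+x. ?U s (?h x) \<partial>lborel)
        = (\<integral>\<^sup>+x\<in>{x. s < ?h x}. ennreal (q * s powr (q - 1)) \<partial>lborel)"
        using True by (intro nn_integral_cong) (simp add: indicator_def)
      also have "\<dots> = ennreal (q * s powr (q - 1)) * emeasure lborel {x. s < ?h x}"
        by (intro nn_integral_cmult_indicator) measurable
      also have "\<dots> \<le> ennreal (q * s powr (q - 1)) * (ennreal (4 * K / s\<^sup>2) * (\<integral>\<^sup>+\<xi>\<in>{\<xi>. cmod (F \<xi>) \<le> ?l s}. ennreal ((cmod (F \<xi>))\<^sup>2) \<partial>lborel))"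
        by (intro mult_left_mono hausdorff_young_split[OF F q A True _ K]) (use MA in \<open>auto simp: M_def\<close>)
      also have "\<dots> = ennreal (4 * K * q * s powr (q - 3)) * (\<integral>\<^sup>+\<xi>\<in>{\<xi>. cmod (F \<xi>) \<le> ?l s}. ennreal ((cmod (F \<xi>))\<^sup>2) \<partial>lborel)"
      proof -
        have "s powr (q - 1) = s powr ((q - 3) + 2)" by simp
        also have "\<dots> = s powr (q - 3) * s\<^sup>2"
          using True by (simp only: powr_add powr_numeral)
        finally have "q * s powr (q - 1) * (4 * K / s\<^sup>2) = q * (s powr (q - 3) * s\<^sup>2) * (4 * K / s\<^sup>2)"
          by (simp only:)
        also have "\<dots> = 4 * K * q * s powr (q - 3)" using True by simp
        finally have "q * s powr (q - 1) * (4 * K / s\<^sup>2) = 4 * K * q * s powr (q - 3)" .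
        then show ?thesis using q by (simp add: mult.assoc[symmetric] ennreal_mult'[symmetric])
      qed
      also have "\<dots> = (\<integral>\<^sup>+\<xi>. ennreal (4 * K * q * s powr (q - 3)) * (ennreal ((cmod (F \<xi>))\<^sup>2) * indicator {\<xi>. cmod (F \<xi>) \<le> ?l s} \<xi>) \<partial>lborel)"
        by (intro nn_integral_cmult[symmetric]) measurable
      also have "\<dots> = (\<integral>\<^sup>+\<xi>. ?W s (cmod (F \<xi>)) \<partial>lborel)"
        using True K q by (intro nn_integral_cong) (simp add: ennreal_mult indicator_def mult_ac)
      finally show ?thesis .
    qed simp
  qed
  also have "\<dots> = (\<integral>\<^sup>+\<xi>. \<integral>\<^sup>+s. ?W s (cmod (F \<xi>)) \<partial>lborel \<partial>lborel)"
    by (rule lborel_pair.Fubini') measurable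
  also have "\<dots> \<le> (\<integral>\<^sup>+\<xi>. ennreal (4 * K * q) * (ennreal (A powr (q - 2) / (q - 2)) * ennreal (cmod (F \<xi>) powr (q / (q - 1)))) \<partial>lborel)"
  proof (intro nn_integral_mono)
    fix \<xi>
    define y where "y = cmod (F \<xi>)"
    have "(\<lambda>s. ennreal (s powr (q - 3)) * indicator {s. 0 < s \<and> y \<le> ?l s} s) \<in> borel_measurable borel"
      by measurable
    then have "(\<lambda>s. ?V s y) \<in> borel_measurable borel"
      by (simp add: indicator_def)
    then have "(\<integral>\<^sup>+s. ?W s y \<partial>lborel)
        = ennreal (4 * K * q) * (ennreal (y\<^sup>2) * (\<integral>\<^sup>+s. ?V s y \<partial>lborel))"
      by (simp add: nn_integral_cmult)
    also have "ennreal (y\<^sup>2) * (\<integral>\<^sup>+s. ?V s y \<partial>lborel)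
       \<le> ennreal (A powr (q - 2) / (q - 2)) * ennreal (y powr (q / (q - 1)))"
    proof (cases "y = 0")
      case False
      then have y: "y > 0" by (simp add: y_def)
      \<comment> \<open>\<open>b\<close> inverts the cut-off height: it is the value of
        \<open>s\<close> at which \<open>?l s\<close> equals \<open>y\<close>.\<close>
      define b where "b = A * y powr (- 1 / (q - 1))"
      have b: "b > 0" using A y by (simp add: b_def)
      have sb: "s \<le> b" if "s > 0" "y \<le> ?l s" for s
      proof -
        have "y powr (1 / (q - 1)) \<le> ?l s powr (1 / (q - 1))" using that y q by (intro powr_mono2) auto
        also have "\<dots> = A / s" using A that q by (simp add: powr_powr)
        finally show ?thesis using that y by (simp add: b_def powr_minus field_simps)
      qed
      have "(\<integral>\<^sup>+s. ?V s y \<partial>lborel)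
          \<le> (\<integral>\<^sup>+s\<in>{0..b}. ennreal (s powr (q - 3)) \<partial>lborel)"
        using sb by (intro nn_integral_mono mult_left_mono) (auto simp: indicator_def)
      also have "\<dots> = ennreal (b powr (q - 2) / (q - 2))"
        using q b by (subst nn_integral_powr_interval) auto
      finally have "ennreal (y\<^sup>2) * (\<integral>\<^sup>+s. ?V s y \<partial>lborel)
          \<le> ennreal (y\<^sup>2) * ennreal (b powr (q - 2) / (q - 2))" by (intro mult_left_mono) auto
      also have "\<dots> = ennreal (y\<^sup>2 * (b powr (q - 2) / (q - 2)))" by (rule ennreal_mult'[symmetric]) simp
      also have "y\<^sup>2 * (b powr (q - 2) / (q - 2)) = A powr (q - 2) / (q - 2) * (y\<^sup>2 * (y powr (- 1 / (q - 1))) powr (q - 2))"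
        using A y by (simp add: b_def powr_mult)
      also have "y\<^sup>2 * (y powr (- 1 / (q - 1))) powr (q - 2) = y powr (2 + (- 1 / (q - 1)) * (q - 2))"
        using y by (simp only: powr_powr powr_add powr_numeral)
      also have "2 + (- 1 / (q - 1)) * (q - 2) = q / (q - 1)" using q by (simp add: field_simps)
      also have "ennreal (A powr (q - 2) / (q - 2) * y powr (q / (q - 1))) = ennreal (A powr (q - 2) / (q - 2)) * ennreal (y powr (q / (q - 1)))"
        using q by (intro ennreal_mult') simp
      finally show ?thesis .
    qed simp
    finally show "(\<integral>\<^sup>+s. ?W s (cmod (F \<xi>)) \<partial>lborel)
       \<le> ennreal (4 * K * q) * (ennreal (A powr (q - 2) / (q - 2)) * ennreal (cmod (F \<xi>) powr (q / (q - 1))))"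
      by (simp add: y_def mult_left_mono)
  qed
  also have "\<dots> = ennreal (4 * K * q) * (ennreal (A powr (q - 2) / (q - 2)) * M)"
    by (simp add: nn_integral_cmult M_def)
  also have "\<dots> < \<infinity>" using fin by (simp add: M_def ennreal_mult_less_top)
  finally show ?thesis .
qed

text \<open>At \<open>q = 2\<close> the integral of \<open>s powr (q - 3)\<close> diverges at 0, so
  interpolation fails and the Plancherel inequality itself is used.\<close>

lemma hausdorff_young:
  fixes F :: "real ^ 'n::finite \<Rightarrow> complex" and q :: real
  assumes F: "integrable lborel F" and q: "q \<ge> 2"
    and fin: "power_integral (q / (q - 1)) F < \<infinity>"
  shows "power_integral q (\<F> F) < \<infinity>"
proof (cases "q = 2")
  case True
  obtain K :: real where K: "K \<ge> 0" "\<And>F :: real ^ 'n \<Rightarrow> complex. integrable lborel F \<Longrightarrow>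
      square_integral (\<F> F) \<le> ennreal K * square_integral F"
    by (rule plancherel_inequality, rule that)
  have "square_integral (\<F> F) \<le> ennreal K * square_integral F"
    by (rule K(2)[OF F])
  also have "\<dots> < \<infinity>" using fin True by (simp add: ennreal_mult_less_top)
  finally show ?thesis using True by simp
next
  case False
  then show ?thesis using q by (intro hausdorff_young_aux[OF F _ fin]) auto
qed

subsection \<open>Uniqueness of functions given by distributions\<close>

lemma locally_integrable_mult_continuous:
  assumes f: "locally_integrable f" and h: "continuous_on UNIV h"
  shows "locally_integrable (\<lambda>x. h x * f x)"
  unfolding locally_integrable_def
proof (intro allI impI)
  fix C :: "(real ^ 'a) set" assume C: "compact C"
  then have f: "integrable lebesgue (\<lambda>x. indicator C x *\<^sub>R f x)"
    using f by (simp add: locally_integrable_def set_integrable_def)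
  have "bounded (h ` C)" using C h by (intro compact_imp_bounded compact_continuous_image) (auto intro: continuous_on_subset)
  then obtain B where B: "\<And>x. x \<in> C \<Longrightarrow> cmod (h x) \<le> B" unfolding bounded_iff by blast
  have [measurable]: "h \<in> borel_measurable lebesgue"
    using borel_measurable_continuous_onI[OF h] by (intro measurable_completion) simp
  have "integrable lebesgue (\<lambda>x. h x * (indicator C x *\<^sub>R f x))"
  proof (rule Bochner_Integration.integrable_bound)
    show "integrable lebesgue (\<lambda>x. \<bar>B\<bar> *\<^sub>R norm (indicator C x *\<^sub>R f x))"
      using f by (intro integrable_scaleR_right integrable_norm)
    show "(\<lambda>x. h x * (indicator C x *\<^sub>R f x)) \<in> borel_measurable lebesgue"
      using f by (intro borel_measurable_times) (auto simp: borel_measurable_integrable)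
    show "AE x in lebesgue. norm (h x * (indicator C x *\<^sub>R f x)) \<le> norm (\<bar>B\<bar> *\<^sub>R norm (indicator C x *\<^sub>R f x))"
      using B by (intro AE_I2) (auto simp: norm_mult indicator_def intro!: mult_right_mono order_trans[OF _ abs_ge_self])
  qed
  then show "(\<lambda>x. h x * f x) absolutely_integrable_on C"
    by (simp add: set_integrable_def mult_ac)
qed

lemma locally_integrable_diff:
  "locally_integrable f \<Longrightarrow> locally_integrable g \<Longrightarrow> locally_integrable (\<lambda>x. f x - g x)"
  unfolding locally_integrable_def by (auto intro: set_integral_diff(1))

lemma locally_integrable_bounded:
  assumes [measurable]: "w \<in> borel_measurable borel" and B: "\<And>x. cmod (w x) \<le> B"
  shows "locally_integrable w"
  unfolding locally_integrable_def
proof (intro allI impI)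
  fix C :: "(real ^ 'a) set" assume C: "compact C"
  have [measurable]: "C \<in> sets borel" using C by (simp add: borel_compact)
  have "integrable lborel (\<lambda>x. complex_of_real (indicator C x) * w x)"
  proof (rule integrable_mult_bounded[OF _ _ B])
    have "integrable lborel (indicator C :: _ \<Rightarrow> real)"
      using emeasure_compact_finite[OF C] by (intro integrable_real_indicator) auto
    then show "integrable lborel (\<lambda>x. complex_of_real (indicator C x))" by simp
  qed simp
  then have "integrable lebesgue (\<lambda>x. complex_of_real (indicator C x) * w x)"
    by (subst integrable_completion) auto
  then show "w absolutely_integrable_on C" by (simp add: set_integrable_def scaleR_conv_of_real)
qed

lemma locally_integrable_mult_bump:
  assumes f: "locally_integrable f" and c: "c > 0" and \<phi>: "bump a b c \<phi>"
  shows "integrable lebesgue (\<lambda>x. f x * \<phi> x)"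
proof -
  have "integrable lebesgue (\<lambda>x. indicator (cbox a b) x *\<^sub>R (\<phi> x * f x))"
    using locally_integrable_mult_continuous[OF f bump_continuous[OF c \<phi>]]
    by (simp add: locally_integrable_def set_integrable_def)
  moreover have "indicator (cbox a b) x *\<^sub>R (\<phi> x * f x) = f x * \<phi> x" for x
    using bump_outside[OF \<phi>, of x] box_subset_cbox[of a b] by (auto simp: indicator_def)
  ultimately show ?thesis by simp
qed

lemma locally_integrable_measurable:
  fixes f :: "real ^ 'n::finite \<Rightarrow> complex"
  assumes "locally_integrable f"
  shows "f \<in> borel_measurable lebesgue"
proof (rule borel_measurable_LIMSEQ_metric)
  show "(\<lambda>x. indicator (cball 0 (real k)) x *\<^sub>R f x) \<in> borel_measurable lebesgue" for k
  proof -
    have "integrable lebesgue (\<lambda>x. indicator (cball 0 (real k)) x *\<^sub>R f x)"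
      using assms by (simp add: locally_integrable_def set_integrable_def)
    then show ?thesis by (simp add: borel_measurable_integrable)
  qed
  show "(\<lambda>k. indicator (cball 0 (real k)) x *\<^sub>R f x) \<longlonglongrightarrow> f x" for x
  proof (rule tendsto_eventually)
    obtain k0 :: nat where "norm x \<le> real k0" using real_arch_simple by blast
    then show "eventually (\<lambda>k. indicator (cball 0 (real k)) x *\<^sub>R f x = f x) sequentially"
      unfolding eventually_sequentially by (intro exI[of _ k0]) auto
  qed
qed

text \<open>Open boxes are closed under intersection and generate the Borel sets, so vanishing box
  integrals extend to Borel sets by Dynkin's argument, then to Lebesgue sets, which differ from
  Borel sets by null sets. Localising to a cube \<open>B\<close> supplies the integrability for
  complements and the finite measure for \<open>density_zero\<close>.\<close>

lemma AE_eq_0_of_box_integrals: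
  fixes v :: "real ^ 'n::finite \<Rightarrow> complex"
  assumes v: "locally_integrable v" and box0: "\<And>a b. (LINT x:box a b|lebesgue. v x) = 0"
  shows "AE x in lebesgue. v x = 0"
proof -
  have "AE x in lebesgue. x \<in> box (\<chi> i. - real k) (\<chi> i. real k) \<longrightarrow> v x = 0" for k
  proof -
    define B where "B = box (\<chi> i. - real k :: real ^ 'n) (\<chi> i. real k)"
    have B: "B \<in> sets lebesgue" "B \<in> lmeasurable" by (auto simp: B_def)
    define u where "u x = indicator B x *\<^sub>R v x" for x
    have "set_integrable lebesgue B v"
      using v unfolding locally_integrable_def B_def
      by (intro set_integrable_subset[OF _ _ box_subset_cbox]) auto
    then have u: "integrable lebesgue u" by (simp add: u_def[abs_def] set_integrable_def)
    have uS: "set_integrable lebesgue A u" if "A \<in> sets lebesgue" for A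
      unfolding set_integrable_def using that u by (rule integrable_mult_indicator)
    \<comment> \<open>Intersections of boxes are boxes, so cutting off at \<open>B\<close> keeps all
      box integrals zero; the box \<open>B\<close> itself then yields \<open>total\<close>, which
      handles complements.\<close>
    have box_u: "(LINT x:box a b|lebesgue. u x) = 0" for a b
    proof -
      obtain c d where "box a b \<inter> B = box c d" unfolding B_def box_Int_box by blast
      then have "indicator (box a b) x *\<^sub>R u x = indicator (box c d) x *\<^sub>R v x" for x
        by (auto simp: u_def indicator_def)
      then show ?thesis using box0[of c d] by (simp add: set_lebesgue_integral_def)
    qed
    have "indicator B x *\<^sub>R u x = u x" for x by (simp add: u_def indicator_def)
    then have "(LINT x|lebesgue. u x) = (LINT x:B|lebesgue. u x)"
      by (simp add: set_lebesgue_integral_def)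
    then have total: "(LINT x|lebesgue. u x) = 0" using box_u unfolding B_def by simp
    have borel_u: "(LINT x:A|lebesgue. u x) = 0" if "A \<in> sets borel" for A
    proof -
      let ?G = "range (\<lambda>(a, b). box a b :: (real ^ 'n) set)"
      have *: "A \<in> sigma_sets UNIV ?G"
        using that unfolding borel_eq_box by (simp add: sets_measure_of)
      have sub: "sigma_sets UNIV ?G \<subseteq> sets lebesgue"
      proof -
        have "sigma_sets UNIV ?G = sets (borel :: (real ^ 'n) measure)"
          unfolding borel_eq_box by (simp add: sets_measure_of)
        then show ?thesis by auto
      qed
      have "Int_stable ?G" by (auto simp: Int_stable_def box_Int_box)
      moreover have "?G \<subseteq> Pow UNIV" by auto
      ultimately show ?thesis using *
      proof (induction rule: sigma_sets_induct_disjoint)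
        case (basic A) then show ?case using box_u by auto
      next
        case empty show ?case by (simp add: set_lebesgue_integral_def)
      next
        case (compl A)
        have "A \<in> sets lebesgue" using compl sub by blast
        then have "(LINT x|lebesgue. u x - indicator A x *\<^sub>R u x) = 0"
          using u uS[of A] total compl by (subst Bochner_Integration.integral_diff) (auto simp: set_integrable_def set_lebesgue_integral_def)
        moreover have "u x - indicator A x *\<^sub>R u x = indicator (UNIV - A) x *\<^sub>R u x" for x by (simp add: indicator_def)
        ultimately show ?case by (simp add: set_lebesgue_integral_def)
      next
        case (union A)
        have "\<And>i. A i \<in> sets lebesgue" using union sub by blast
        then have "(LINT x:(\<Union>i. A i)|lebesgue. u x) = (\<Sum>i. (LINT x:(A i)|lebesgue. u x))"
          using union(1) by (intro lebesgue_integral_countable_add uS) (auto simp: disjoint_family_on_def)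
        then show ?case using union by simp
      qed
    qed
    have leb_u: "(LINT x:A|lebesgue. u x) = 0" if A: "A \<in> sets lebesgue" for A
    proof -
      obtain S N N' where *: "A = S \<union> N" "N \<subseteq> N'" "N' \<in> null_sets lborel" "S \<in> sets lborel"
        using A by (rule sets_completionE)
      have "N' \<in> null_sets lebesgue" using *(3) by (intro null_sets_completionI)
      then have "AE x in lebesgue. x \<notin> N'" by (rule AE_not_in)
      then have "AE x in lebesgue. indicator A x *\<^sub>R u x = indicator S x *\<^sub>R u x"
        by eventually_elim (use * in \<open>auto simp: indicator_def\<close>)
      moreover have "S \<in> sets lebesgue" using *(4) by auto
      ultimately have "(LINT x:A|lebesgue. u x) = (LINT x:S|lebesgue. u x)"
        using uS[OF A] uS[of S] unfolding set_lebesgue_integral_def set_integrable_def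
        by (intro integral_cong_AE) (auto simp: borel_measurable_integrable)
      then show ?thesis using borel_u[of S] *(4) by simp
    qed
    interpret finite_measure "lebesgue_on B" using B(2) by (rule finite_measure_lebesgue_on)
    have "AE x in lebesgue_on B. v x = 0"
    proof (rule density_zero)
      show "integrable (lebesgue_on B) v"
        using \<open>set_integrable lebesgue B v\<close> B(1) by (simp add: set_integrable_def integrable_restrict_space)
      fix A assume "A \<in> sets (lebesgue_on B)"
      then have A: "A \<in> sets lebesgue" "A \<subseteq> B" using B(1) by (auto simp: sets_restrict_space_iff)
      have "set_lebesgue_integral (lebesgue_on B) A v = (LINT x|lebesgue. indicator B x *\<^sub>R (indicator A x *\<^sub>R v x))"
        unfolding set_lebesgue_integral_def using B(1) by (subst integral_restrict_space) auto
      also have "\<dots> = (LINT x:A|lebesgue. u x)"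
        by (simp add: set_lebesgue_integral_def u_def mult.commute)
      finally show "set_lebesgue_integral (lebesgue_on B) A v = 0" using leb_u[OF A(1)] by simp
    qed
    then show ?thesis using B(1) by (simp add: AE_restrict_space_iff B_def)
  qed
  then have "AE x in lebesgue. \<forall>k. x \<in> box (\<chi> i. - real k) (\<chi> i. real k) \<longrightarrow> v x = 0"
    by (subst AE_all_countable) blast
  then show ?thesis
  proof eventually_elim
    case (elim x)
    obtain k :: nat where k: "norm x < real k" using reals_Archimedean2 by blast
    have "- real k < x $ i \<and> x $ i < real k" for i
      using component_le_norm_cart[of x i] k by (auto simp: abs_le_iff)
    then show ?case using elim by (auto simp: mem_box_cart)
  qed
qed

text \<open>With \<open>w\<close> the weight of the box, the bumps
  \<open>exp (- 1 / ((k + 1) w))\<close> increase to the indicator of the open box. Dominated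
  convergence passes from bump integrals to box integrals.\<close>

lemma AE_eq_0_of_bump_integrals:
  fixes v :: "real ^ 'n::finite \<Rightarrow> complex"
  assumes v: "locally_integrable v"
    and bump0: "\<And>a b c \<phi>. c > 0 \<Longrightarrow> bump a b c \<phi> \<Longrightarrow> (LINT x|lebesgue. v x * \<phi> x) = 0"
  shows "AE x in lebesgue. v x = 0"
proof (rule AE_eq_0_of_box_integrals[OF v])
  fix a b :: "real ^ 'n"
  define \<phi> where "\<phi> k x = (if x \<in> box a b then exp (- of_real (1 / real (Suc k)) * inverse (complex_of_real (bump_weight a b x))) else 0)" for k x
  have bump: "bump a b (1 / real (Suc k)) (\<phi> k)" for k
    unfolding bump_def \<phi>_def
    by (intro exI[of _ 0] exI[of _ "\<lambda>_. 1"] conjI polyf_const) auto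
  have int: "integrable lebesgue (\<lambda>x. v x * \<phi> k x)" for k
    by (rule locally_integrable_mult_bump[OF v _ bump]) simp
  have "(\<lambda>k. LINT x|lebesgue. v x * \<phi> k x) \<longlonglongrightarrow> (LINT x|lebesgue. indicator (box a b) x *\<^sub>R v x)"
  proof (rule integral_dominated_convergence)
    have v_int: "integrable lebesgue (\<lambda>x. indicator (cbox a b) x *\<^sub>R v x)"
      using v by (simp add: locally_integrable_def set_integrable_def)
    then show "integrable lebesgue (\<lambda>x. norm (indicator (cbox a b) x *\<^sub>R v x))" by (rule integrable_norm)
    show "(\<lambda>x. indicator (box a b) x *\<^sub>R v x) \<in> borel_measurable lebesgue"
      using locally_integrable_measurable[OF v] by (intro borel_measurable_scaleR borel_measurable_indicator) auto
    show "(\<lambda>x. v x * \<phi> k x) \<in> borel_measurable lebesgue" for k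
      using int[of k] by (simp add: borel_measurable_integrable)
    show "AE x in lebesgue. (\<lambda>k. v x * \<phi> k x) \<longlonglongrightarrow> indicator (box a b) x *\<^sub>R v x"
    proof (intro AE_I2)
      fix x
      show "(\<lambda>k. v x * \<phi> k x) \<longlonglongrightarrow> indicator (box a b) x *\<^sub>R v x"
      proof (cases "x \<in> box a b")
        case True
        have "(\<lambda>k. v x * exp (- of_real (1 / real (Suc k)) * inverse (complex_of_real (bump_weight a b x))))
            \<longlonglongrightarrow> v x * exp (- of_real 0 * inverse (complex_of_real (bump_weight a b x)))"
          by (intro tendsto_intros lim_1_over_n[THEN LIMSEQ_Suc])
        then show ?thesis using True by (simp add: \<phi>_def)
      qed (simp add: \<phi>_def)
    qed
    show "AE x in lebesgue. norm (v x * \<phi> k x) \<le> norm (indicator (cbox a b) x *\<^sub>R v x)" for k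
    proof (intro AE_I2)
      fix x
      show "norm (v x * \<phi> k x) \<le> norm (indicator (cbox a b) x *\<^sub>R v x)"
      proof (cases "x \<in> box a b")
        case True
        define w where "w = bump_weight a b x"
        have w: "w > 0" using bump_weight_pos[OF True] by (simp add: w_def)
        have "exp (- of_real (1 / real (Suc k)) * inverse (complex_of_real w)) = complex_of_real (exp (- (1 / real (Suc k)) * inverse w))"
          by (subst exp_of_real[symmetric]) simp
        then have "\<phi> k x = complex_of_real (exp (- (1 / real (Suc k)) * inverse w))"
          using True by (simp add: \<phi>_def w_def)
        then have "cmod (\<phi> k x) = exp (- (1 / real (Suc k)) * inverse w)"
          by (simp del: of_real_exp)
        also have "\<dots> \<le> 1" using w by simp
        finally have "cmod (v x) * cmod (\<phi> k x) \<le> cmod (v x) * 1" by (intro mult_left_mono) auto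
        then show ?thesis using True box_subset_cbox[of a b] by (auto simp: norm_mult)
      qed (simp add: \<phi>_def)
    qed
  qed
  moreover have "(LINT x|lebesgue. v x * \<phi> k x) = 0" for k
    by (rule bump0[OF _ bump]) simp
  ultimately have "(\<lambda>k. 0) \<longlonglongrightarrow> (LINT x:box a b|lebesgue. v x)" by (simp add: set_lebesgue_integral_def)
  then show "(LINT x:box a b|lebesgue. v x) = 0" using LIMSEQ_unique tendsto_const by blast
qed

subsection \<open>Splitting the reciprocal symbol\<close>

lemma polyf_quotient_derivative:
  assumes q: "polyf d q" and S: "polyf e S" and nz: "\<And>x. S x \<noteq> 0"
  shows "\<exists>q'. polyf (d + e - 1) q' \<and> dir_deriv v (\<lambda>x. q x * inverse (S x) ^ (k + 1)) (\<lambda>x. q' x * inverse (S x) ^ (k + 2))"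
proof -
  obtain Q where Q: "\<And>x. (q has_derivative Q x) (at x)" "polyf (d - 1) (\<lambda>x. Q x v)"
    using polyf_derivative[OF q] by blast
  obtain T where T: "\<And>x. (S has_derivative T x) (at x)" "polyf (e - 1) (\<lambda>x. T x v)"
    using polyf_derivative[OF S] by blast
  define D where "D x w = q x * (of_nat (k + 1) * (- (inverse (S x) ^ 2) * inverse (S x) ^ k) * T x w) + Q x w * inverse (S x) ^ (k + 1)" for x w
  have "((\<lambda>x. q x * inverse (S x) ^ (k + 1)) has_derivative D x) (at x)" for x
  proof -
    have "((\<lambda>z. inverse z ^ (k + 1)) has_field_derivative of_nat (k + 1) * (- (inverse (S x) ^ 2) * inverse (S x) ^ k)) (at (S x))"
      using DERIV_power[OF DERIV_inverse[OF nz[of x]], of "k + 1"] by (simp add: numeral_2_eq_2)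
    from has_derivative_compose[OF T(1) this[unfolded has_field_derivative_def]]
    have "((\<lambda>x. inverse (S x) ^ (k + 1)) has_derivative (\<lambda>w. of_nat (k + 1) * (- (inverse (S x) ^ 2) * inverse (S x) ^ k) * T x w)) (at x)" .
    from has_derivative_mult[OF Q(1) this] show ?thesis by (simp add: D_def[abs_def])
  qed
  from dir_derivI[OF this, of v]
  have "dir_deriv v (\<lambda>x. q x * inverse (S x) ^ (k + 1)) (\<lambda>x. D x v)" .
  moreover have "(\<lambda>x. D x v) = (\<lambda>x. (Q x v * S x - of_nat (k + 1) * (q x * T x v)) * inverse (S x) ^ (k + 2))"
    using nz by (simp add: D_def fun_eq_iff field_simps power2_eq_square)
  moreover have "polyf (d + e - 1) (\<lambda>x. Q x v * S x - of_nat (k + 1) * (q x * T x v))"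
    using polyf_mult[OF Q(2) S] polyf_mult[OF q T(2)] by (intro polyf_diff polyf_cmult) (simp_all add: algebra_simps)
  ultimately show ?thesis by (intro exI[of _ "\<lambda>x. Q x v * S x - of_nat (k + 1) * (q x * T x v)"]) simp
qed

text \<open>By the quotient rule each derivative adds one power of \<open>S\<close> to the
  denominator and \<open>e - 1\<close> to the degree of the numerator, so the total order drops by
  exactly 1. Dependent choice strings the numerators together, as each step only asserts that a next
  one exists.\<close>

lemma polyf_quotient_derivatives:
  assumes q: "polyf d q" and S: "polyf e S" and nz: "\<And>x. S x \<noteq> 0"
  obtains q' where "q' 0 = q" "\<And>k. polyf (d + int k * (e - 1)) (q' k)"
    "\<And>k. dir_deriv v (\<lambda>x. q' k x * inverse (S x) ^ (k + 1)) (\<lambda>x. q' (Suc k) x * inverse (S x) ^ (Suc k + 1))"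
proof -
  have "\<exists>f. f 0 = q \<and> (\<forall>k. polyf (d + int k * (e - 1)) (f k) \<and>
    dir_deriv v (\<lambda>x. f k x * inverse (S x) ^ (k + 1)) (\<lambda>x. f (Suc k) x * inverse (S x) ^ (Suc k + 1)))"
  proof -
    let ?P = "\<lambda>k f. polyf (d + int k * (e - 1)) f \<and> (k = 0 \<longrightarrow> f = q)"
    let ?Q = "\<lambda>k f g. dir_deriv v (\<lambda>x. f x * inverse (S x) ^ (k + 1)) (\<lambda>x. g x * inverse (S x) ^ (Suc k + 1))"
    have "\<exists>f. \<forall>k. ?P k (f k) \<and> ?Q k (f k) (f (Suc k))"
    proof (rule dependent_nat_choice)
      show "\<exists>f. ?P 0 f" using q by auto
      fix f k assume "?P k f"
      then show "\<exists>g. ?P (Suc k) g \<and> ?Q k f g"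
        using polyf_quotient_derivative[OF _ S nz, of "d + int k * (e - 1)" f v k] by (auto simp: algebra_simps)
    qed
    then show ?thesis by blast
  qed
  then show thesis using that by blast
qed

text \<open>This is \<open>1 + |p|^2\<close>, written with the conjugate so that it is a polynomial
  function; it never vanishes, even if \<open>p\<close> has a zero at the origin.\<close>

definition denom :: "nat \<Rightarrow> ('n::finite multiindex \<Rightarrow> real) \<Rightarrow> real ^ 'n \<Rightarrow> complex" where
  "denom \<alpha> a \<xi> = 1 + symbol \<alpha> a \<xi> * cnj (symbol \<alpha> a \<xi>)"

lemma denom_eq: "denom \<alpha> a \<xi> = of_real (1 + (cmod (symbol \<alpha> a \<xi>))\<^sup>2)"
  using complex_norm_square[of "symbol \<alpha> a \<xi>"] by (simp add: denom_def)

lemma norm_denom: "cmod (denom \<alpha> a \<xi>) = 1 + (cmod (symbol \<alpha> a \<xi>))\<^sup>2"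
  unfolding denom_eq norm_of_real by (simp add: add_nonneg_nonneg)

lemma denom_nonzero: "denom \<alpha> a \<xi> \<noteq> 0"
proof -
  have "1 + (cmod (symbol \<alpha> a \<xi>))\<^sup>2 > 0" by (simp add: add_pos_nonneg)
  then show ?thesis using norm_denom[of \<alpha> a \<xi>] by (metis norm_zero less_irrefl)
qed

lemma polyf_denom: "polyf (int \<alpha> + int \<alpha>) (denom \<alpha> a)"
  unfolding denom_def[abs_def]
  by (intro polyf_add polyf_mult polyf_cnj polyf_symbol polyf_const) auto

text \<open>The 1 suffices on the unit ball and the lower bound on the symbol outside it;
  \<open>4 ^ \<alpha>\<close> absorbs
  \<open>1 + norm \<xi> \<le> 2 * max 1 (norm \<xi>)\<close>.\<close>

lemma denom_lower:
  assumes "c1 > 0" "symbol_bound c1 \<alpha> a"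
  obtains \<kappa> where "\<kappa> > 0" "\<And>\<xi>. cmod (denom \<alpha> a \<xi>) \<ge> \<kappa> * (1 + norm \<xi>) ^ (2 * \<alpha>)"
proof -
  define \<kappa> where "\<kappa> = min 1 (c1\<^sup>2) / 4 ^ \<alpha>"
  have \<kappa>: "\<kappa> > 0" "\<kappa> * 4 ^ \<alpha> = min 1 (c1\<^sup>2)" using assms(1) by (auto simp: \<kappa>_def)
  have "\<kappa> * (1 + norm \<xi>) ^ (2 * \<alpha>) \<le> cmod (denom \<alpha> a \<xi>)" for \<xi>
  proof (cases "norm \<xi> \<le> 1")
    case True
    then have "(1 + norm \<xi>) ^ (2 * \<alpha>) \<le> 2 ^ (2 * \<alpha>)" by (intro power_mono) auto
    then have "\<kappa> * (1 + norm \<xi>) ^ (2 * \<alpha>) \<le> \<kappa> * 4 ^ \<alpha>" using \<kappa> by (intro mult_left_mono) (auto simp: power_mult)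
    also have "\<dots> \<le> 1" using \<kappa>(2) by simp
    finally show ?thesis unfolding norm_denom by (simp add: add_increasing2)
  next
    case False
    then have "(1 + norm \<xi>) ^ (2 * \<alpha>) \<le> (2 * norm \<xi>) ^ (2 * \<alpha>)" by (intro power_mono) auto
    also have "\<dots> = 4 ^ \<alpha> * (norm \<xi> ^ \<alpha>)\<^sup>2"
      using power_mult[of "2 :: real" 2 \<alpha>] by (simp only: power_mult_distrib power_even_eq[of "norm \<xi>"]) simp
    finally have "\<kappa> * (1 + norm \<xi>) ^ (2 * \<alpha>) \<le> \<kappa> * (4 ^ \<alpha> * (norm \<xi> ^ \<alpha>)\<^sup>2)" using \<kappa> by (intro mult_left_mono) auto
    also have "\<dots> = min 1 (c1\<^sup>2) * (norm \<xi> ^ \<alpha>)\<^sup>2" using \<kappa>(2) by (simp add: mult.assoc[symmetric])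
    also have "\<dots> \<le> (c1 * norm \<xi> ^ \<alpha>)\<^sup>2" unfolding power_mult_distrib by (intro mult_right_mono) auto
    also have "\<dots> \<le> (cmod (symbol \<alpha> a \<xi>))\<^sup>2" using assms by (intro power_mono) auto
    finally show ?thesis unfolding norm_denom by simp
  qed
  then show thesis using \<kappa>(1) that by blast
qed

text \<open>Degree counting: the \<open>k\<close>-th numerator has degree at most
  \<open>\<alpha> + k (2 \<alpha> - 1)\<close> and stands over the power \<open>k + 1\<close> of a
  denominator growing with order \<open>2 \<alpha>\<close>, which leaves
  \<open>- \<alpha> - k\<close>.\<close>

lemma smooth_part_derivatives:
  fixes a :: "'n::finite multiindex \<Rightarrow> real"
  assumes c: "c1 > 0" "symbol_bound c1 \<alpha> a"
  obtains g where "g 0 = (\<lambda>\<xi>. cnj (symbol \<alpha> a \<xi>) / denom \<alpha> a \<xi>)"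
    "\<And>k. continuous_on UNIV (g k)" "\<And>k. dir_deriv v (g k) (g (Suc k))"
    "\<And>k. \<exists>C. \<forall>\<xi>. cmod (g k \<xi>) \<le> C * (1 + norm \<xi>) powr - (real \<alpha> + real k)"
proof -
  define S where "S = denom \<alpha> a"
  have S: "polyf (int \<alpha> + int \<alpha>) S" "\<And>x. S x \<noteq> 0"
    unfolding S_def by (rule polyf_denom, rule denom_nonzero)
  obtain q where q: "q 0 = (\<lambda>\<xi>. cnj (symbol \<alpha> a \<xi>))" "\<And>k. polyf (int \<alpha> + int k * (int \<alpha> + int \<alpha> - 1)) (q k)"
    "\<And>k. dir_deriv v (\<lambda>x. q k x * inverse (S x) ^ (k + 1)) (\<lambda>x. q (Suc k) x * inverse (S x) ^ (Suc k + 1))"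
    by (rule polyf_quotient_derivatives[OF polyf_cnj[OF polyf_symbol] S], rule that)
  obtain \<kappa> where \<kappa>: "\<kappa> > 0" "\<And>\<xi>. cmod (S \<xi>) \<ge> \<kappa> * (1 + norm \<xi>) ^ (2 * \<alpha>)"
    unfolding S_def using denom_lower[OF c] by metis
  define g where "g k x = q k x * inverse (S x) ^ (k + 1)" for k x
  show thesis
  proof (rule that[of g])
    show "g 0 = (\<lambda>\<xi>. cnj (symbol \<alpha> a \<xi>) / denom \<alpha> a \<xi>)"
      by (simp add: g_def[abs_def] q(1) S_def divide_inverse)
    show "continuous_on UNIV (g k)" for k
      unfolding g_def by (intro continuous_intros polyf_continuous[OF q(2)] polyf_continuous[OF S(1)]) (use S in auto)
    show "dir_deriv v (g k) (g (Suc k))" for k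
      using q(3)[of k] unfolding g_def[abs_def] .
    show "\<exists>C. \<forall>\<xi>. cmod (g k \<xi>) \<le> C * (1 + norm \<xi>) powr - (real \<alpha> + real k)" for k
    proof -
      obtain C where C: "\<And>x. cmod (q k x) \<le> C * (1 + norm x) powr of_int (int \<alpha> + int k * (int \<alpha> + int \<alpha> - 1))"
        using polyf_bound[OF q(2)] by blast
      have "cmod (g k \<xi>) \<le> (C * inverse \<kappa> ^ (k + 1)) * (1 + norm \<xi>) powr - (real \<alpha> + real k)" for \<xi>
      proof -
        let ?u = "real \<alpha> + real k * (2 * real \<alpha> - 1)" and ?w = "2 * real \<alpha> * (real k + 1)"
        define r where "r = 1 + norm \<xi>"
        have r: "r > 0" by (simp add: r_def add_pos_nonneg)
        have "inverse (cmod (S \<xi>)) \<le> inverse (\<kappa> * r ^ (2 * \<alpha>))"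
          using \<kappa> r by (intro le_imp_inverse_le) (auto simp: r_def)
        then have "inverse (cmod (S \<xi>)) ^ (k + 1) \<le> inverse (\<kappa> * r ^ (2 * \<alpha>)) ^ (k + 1)"
          by (intro power_mono) auto
        also have "\<dots> = inverse \<kappa> ^ (k + 1) * r powr - ?w"
        proof -
          have "- ?w = - real (2 * \<alpha> * (k + 1))" by (simp add: algebra_simps)
          then have "r powr - ?w = inverse (r powr real (2 * \<alpha> * (k + 1)))"
            by (simp only: powr_minus)
          also have "\<dots> = inverse ((r ^ (2 * \<alpha>)) ^ (k + 1))"
            using r by (simp only: powr_realpow power_mult)
          finally show ?thesis by (simp only: power_inverse power_mult_distrib inverse_mult_distrib)
        qed
        finally have 1: "inverse (cmod (S \<xi>)) ^ (k + 1) \<le> inverse \<kappa> ^ (k + 1) * r powr - ?w" .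
        have "cmod (g k \<xi>) = cmod (q k \<xi>) * inverse (cmod (S \<xi>)) ^ (k + 1)"
          by (simp add: g_def norm_mult norm_power norm_inverse)
        also have "\<dots> \<le> (C * r powr ?u) * (inverse \<kappa> ^ (k + 1) * r powr - ?w)"
        proof (intro mult_mono 1)
          show "cmod (q k \<xi>) \<le> C * r powr ?u"
            using C[of \<xi>] by (simp add: r_def)
          then show "0 \<le> C * r powr ?u" by (rule order_trans[OF norm_ge_zero])
        qed auto
        also have "\<dots> = C * inverse \<kappa> ^ (k + 1) * (r powr ?u * r powr - ?w)"
          by (simp only: mult_ac)
        also have "r powr ?u * r powr - ?w = r powr - (real \<alpha> + real k)"
          by (subst powr_add[symmetric]) (simp add: algebra_simps)
        finally show ?thesis by (simp add: r_def)
      qed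
      then show ?thesis by blast
    qed
  qed
qed

text \<open>Near the origin \<open>|f0| \<le> 1 / |p|\<close> is used; far away \<open>|f0|\<close>
  is at most a multiple of the power \<open>-3 \<alpha>\<close> of the norm, where
  \<open>3 \<alpha> > n\<close> follows from \<open>\<alpha> \<ge> n / 2\<close>. Integrability of
  \<open>f0\<close> is wanted as well, since its transform is defined by an integral.\<close>

lemma singular_part_integrable:
  fixes a :: "'n::finite multiindex \<Rightarrow> real"
  assumes c: "c1 > 0" "symbol_bound c1 \<alpha> a"
    and nonhom: "\<not> homogeneous \<alpha> a" and \<alpha>: "real CARD('n) / 2 \<le> real \<alpha>" "\<alpha> < CARD('n)"
  defines "f0 \<equiv> \<lambda>\<xi>. 1 / (symbol \<alpha> a \<xi> * denom \<alpha> a \<xi>)"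
  shows "integrable lborel f0"
    and "power_integral (real CARD('n) / real \<alpha>) f0 < \<infinity>"
proof -
  define s where "s = real CARD('n) / real \<alpha>"
  have \<alpha>0: "\<alpha> > 0" using \<alpha> by (cases \<alpha>) auto
  have s: "s \<ge> 1" "s * real \<alpha> = real CARD('n)" using \<alpha> \<alpha>0 by (auto simp: s_def)
  have [measurable]: "f0 \<in> borel_measurable borel"
  proof -
    have [measurable]: "denom \<alpha> a \<in> borel_measurable borel"
      by (intro borel_measurable_continuous_onI polyf_continuous[OF polyf_denom])
    show ?thesis unfolding f0_def by measurable
  qed
  have f0_norm: "cmod (f0 \<xi>) = 1 / (cmod (symbol \<alpha> a \<xi>) * (1 + (cmod (symbol \<alpha> a \<xi>))\<^sup>2))" for \<xi>
    by (simp add: f0_def norm_divide norm_mult norm_denom)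
  define C where "C = 1 / c1 ^ 3"
  have C: "C > 0" using c by (simp add: C_def)
  have far: "cmod (f0 \<xi>) \<le> C * norm \<xi> powr - (3 * real \<alpha>)" if "norm \<xi> \<ge> 1" for \<xi>
  proof -
    define y where "y = cmod (symbol \<alpha> a \<xi>)"
    define r where "r = c1 * norm \<xi> ^ \<alpha>"
    have r: "0 < r" "r \<le> y" using c that by (auto simp: r_def y_def intro!: mult_pos_pos zero_less_power)
    have "r ^ 3 \<le> y ^ 3" using r by (intro power_mono) auto
    also have "\<dots> \<le> y * (1 + y\<^sup>2)" using r by (simp add: power3_eq_cube power2_eq_square distrib_left)
    finally have "1 / (y * (1 + y\<^sup>2)) \<le> 1 / r ^ 3" using r by (intro divide_left_mono) (auto intro!: mult_pos_pos add_pos_nonneg)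
    also have "1 / r ^ 3 = C * norm \<xi> powr - (3 * real \<alpha>)"
    proof -
      have "norm \<xi> > 0" using that by linarith
      then have "norm \<xi> powr - (3 * real \<alpha>) = inverse ((norm \<xi> ^ \<alpha>) ^ 3)"
        by (simp add: powr_minus powr_realpow[symmetric] powr_powr mult.commute)
      then show ?thesis by (simp add: r_def C_def power_mult_distrib divide_inverse)
    qed
    finally show ?thesis by (simp add: f0_norm y_def)
  qed
  have near: "cmod (f0 \<xi>) powr s \<le> cmod (symbol \<alpha> a \<xi>) powr - s" for \<xi>
  proof (cases "symbol \<alpha> a \<xi> = 0")
    case True
    then show ?thesis by (simp add: f0_def)
  next
    case False
    define y where "y = cmod (symbol \<alpha> a \<xi>)"
    have y: "y > 0" using False by (simp add: y_def)
    have "1 / (y * (1 + y\<^sup>2)) \<le> 1 / y"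
      using y by (intro divide_left_mono) (auto intro!: mult_pos_pos add_pos_nonneg)
    then have "(1 / (y * (1 + y\<^sup>2))) powr s \<le> (1 / y) powr s" using y s by (intro powr_mono2) auto
    also have "(1 / y) powr s = y powr - s" using y by (simp add: powr_divide powr_minus_divide)
    finally show ?thesis by (simp add: f0_norm y_def[symmetric])
  qed
  let ?p = "\<lambda>\<xi>. ennreal (cmod (symbol \<alpha> a \<xi>) powr - s)"
  have origin: "(\<integral>\<^sup>+\<xi>\<in>{\<xi>. norm \<xi> \<le> 1}. ?p \<xi> \<partial>lborel) < \<infinity>"
    unfolding s_def by (rule nn_integral_symbol_origin[OF nonhom c])
  \<comment> \<open>Both claims are instances of one test: \<open>|p|\<close> to the power
    \<open>- s\<close> controls the unit ball, and a decay beyond the dimension controls the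
    rest.\<close>
  have split: "(\<integral>\<^sup>+\<xi>. h \<xi> \<partial>lborel) < \<infinity>"
    if h1: "\<And>\<xi>. h \<xi> \<le> ?p \<xi> + 1"
      and h2: "\<And>\<xi>. norm \<xi> \<ge> 1 \<Longrightarrow> h \<xi> \<le> ennreal B * ennreal (norm \<xi> powr - t)" and t: "t > real CARD('n)"
    for h :: "real ^ 'n \<Rightarrow> ennreal" and B t
  proof -
    have "(\<integral>\<^sup>+\<xi>. h \<xi> \<partial>lborel) \<le> (\<integral>\<^sup>+\<xi>. (?p \<xi> * indicator {\<xi>. norm \<xi> \<le> 1} \<xi> + indicator {\<xi>. norm \<xi> \<le> 1} \<xi>)
        + ennreal B * (ennreal (norm \<xi> powr - t) * indicator {\<xi>. norm \<xi> \<ge> 1} \<xi>) \<partial>lborel)"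
    proof (intro nn_integral_mono)
      fix \<xi> :: "real ^ 'n"
      show "h \<xi> \<le> (?p \<xi> * indicator {\<xi>. norm \<xi> \<le> 1} \<xi> + indicator {\<xi>. norm \<xi> \<le> 1} \<xi>)
        + ennreal B * (ennreal (norm \<xi> powr - t) * indicator {\<xi>. norm \<xi> \<ge> 1} \<xi>)"
        using h1[of \<xi>] h2[of \<xi>] by (cases "norm \<xi> \<le> 1") (auto simp: add_increasing2)
    qed
    also have "\<dots> = (\<integral>\<^sup>+\<xi>\<in>{\<xi>. norm \<xi> \<le> 1}. ?p \<xi> \<partial>lborel)
        + emeasure lborel {\<xi> :: real ^ 'n. norm \<xi> \<le> 1} + ennreal B * (\<integral>\<^sup>+\<xi>\<in>{\<xi> :: real ^ 'n. norm \<xi> \<ge> 1}. ennreal (norm \<xi> powr - t) \<partial>lborel)"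
      by (simp add: nn_integral_add nn_integral_cmult)
    also have "\<dots> < \<infinity>"
    proof -
      have "{\<xi> :: real ^ 'n. norm \<xi> \<le> 1} = cball 0 1" by auto
      then have "emeasure lborel {\<xi> :: real ^ 'n. norm \<xi> \<le> 1} < \<infinity>"
        using emeasure_bounded_finite[OF bounded_cball] by metis
      moreover have "(\<integral>\<^sup>+\<xi>\<in>{\<xi> :: real ^ 'n. norm \<xi> \<ge> 1}. ennreal (norm \<xi> powr - t) \<partial>lborel) < \<infinity>"
        using t by (intro nn_integral_norm_powr_infinity) simp
      ultimately show ?thesis using origin by (simp add: ennreal_mult_less_top)
    qed
    finally show ?thesis .
  qed
  have "(\<integral>\<^sup>+\<xi>. ennreal (cmod (f0 \<xi>)) \<partial>lborel) < \<infinity>"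
  proof (rule split)
    fix \<xi>
    \<comment> \<open>\<open>s \<ge> 1\<close>, a consequence of \<open>\<alpha> < n\<close>, lets
      the first power be absorbed by the \<open>s\<close>-th power plus 1.\<close>
    have "cmod (f0 \<xi>) \<le> cmod (f0 \<xi>) powr s + 1"
    proof (cases "cmod (f0 \<xi>) \<le> 1")
      case True
      then show ?thesis by (simp add: add_increasing)
    next
      case False
      then have "cmod (f0 \<xi>) powr 1 \<le> cmod (f0 \<xi>) powr s" using s by (intro powr_mono) auto
      then show ?thesis using False by simp
    qed
    also have "\<dots> \<le> cmod (symbol \<alpha> a \<xi>) powr - s + 1" using near by simp
    finally have "ennreal (cmod (f0 \<xi>)) \<le> ennreal (cmod (symbol \<alpha> a \<xi>) powr - s + 1)" by (rule ennreal_leI)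
    then show "ennreal (cmod (f0 \<xi>)) \<le> ?p \<xi> + 1" by (simp add: ennreal_plus)
    show "norm \<xi> \<ge> 1 \<Longrightarrow> ennreal (cmod (f0 \<xi>)) \<le> ennreal C * ennreal (norm \<xi> powr - (3 * real \<alpha>))"
      using far[of \<xi>] C by (simp add: ennreal_mult'[symmetric] ennreal_leI)
  qed (use \<alpha> \<alpha>0 in auto)
  then show "integrable lborel f0" by (simp add: integrable_iff_bounded)
  have "power_integral s f0 < \<infinity>"
  proof (rule split)
    fix \<xi>
    show "ennreal (cmod (f0 \<xi>) powr s) \<le> ?p \<xi> + 1"
      using near[of \<xi>] by (intro order_trans[OF ennreal_leI[OF near]]) simp
    show "ennreal (cmod (f0 \<xi>) powr s) \<le> ennreal (C powr s) * ennreal (norm \<xi> powr - (3 * real CARD('n)))" if "norm \<xi> \<ge> 1"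
    proof -
      have "cmod (f0 \<xi>) powr s \<le> (C * norm \<xi> powr - (3 * real \<alpha>)) powr s"
        using far[OF that] s by (intro powr_mono2) auto
      also have "\<dots> = C powr s * norm \<xi> powr (- (3 * real \<alpha>) * s)"
        using C by (simp add: powr_mult powr_powr)
      also have "- (3 * real \<alpha>) * s = - (3 * real CARD('n))" using s(2) by (simp add: mult.commute mult.left_commute)
      finally show ?thesis by (simp add: ennreal_mult'[symmetric] ennreal_leI)
    qed
  qed auto
  then show "power_integral (real CARD('n) / real \<alpha>) f0 < \<infinity>"
    by (simp add: s_def)
qed

subsection \<open>The fundamental solution\<close>

text \<open>Multiplying the test function by \<open>- 2 pi i x_i\<close> turns its transform into
  minus its derivative, and integration by parts on the frequency side moves the derivative to
  \<open>g\<close>. Boundedness of \<open>g\<close> and \<open>g'\<close> gives integrability, as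
  the transform of a bump is integrable.\<close>

lemma integral_derivative_fourier:
  fixes g g' :: "real ^ 'n::finite \<Rightarrow> complex"
  assumes g: "continuous_on UNIV g" "continuous_on UNIV g'" "dir_deriv (axis i 1) g g'"
    and bnd: "\<And>\<xi>. cmod (g \<xi>) \<le> B" "\<And>\<xi>. cmod (g' \<xi>) \<le> B'"
    and c: "c > 0" and \<phi>: "bump a b c \<phi>"
  shows "(LINT \<xi>|lborel. g \<xi> * \<F> (\<lambda>x. - 2 * of_real pi * \<i> * of_real (x $ i) * \<phi> x) \<xi>)
    = (LINT \<xi>|lborel. g' \<xi> * \<F> \<phi> \<xi>)"
proof -
  let ?\<psi> = "\<lambda>x. two_pi_i * of_real (x $ i) * \<phi> x"
  have \<psi>: "bump a b c ?\<psi>" by (rule bump_cmult_coord[OF \<phi>])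
  have [measurable]: "g \<in> borel_measurable borel" "g' \<in> borel_measurable borel"
    using g by (auto intro: borel_measurable_continuous_onI)
  have int: "integrable lborel (\<lambda>\<xi>. h \<xi> * \<F> f \<xi>)"
    if "bump a b c f" "h \<in> borel_measurable borel" "\<And>\<xi>. cmod (h \<xi>) \<le> B" for f h B
    by (subst mult.commute, rule integrable_mult_bounded[OF bump_fourier_integrable[OF c that(1)] that(2,3)])
  have int1: "integrable lborel (\<lambda>\<xi>. g \<xi> * \<F> \<phi> \<xi>)"
    "integrable lborel (\<lambda>\<xi>. g \<xi> * \<F> ?\<psi> \<xi>)" "integrable lborel (\<lambda>\<xi>. g' \<xi> * \<F> \<phi> \<xi>)"
    by (rule int[OF \<phi> _ bnd(1)], simp, rule int[OF \<psi> _ bnd(1)], simp, rule int[OF \<phi> _ bnd(2)], simp)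
  have "(LINT \<xi>|lborel. g \<xi> * \<F> ?\<psi> \<xi> + g' \<xi> * \<F> \<phi> \<xi>) = 0"
    by (rule integral_dir_deriv_eq_0[OF int1(1) _ dir_deriv_mult[OF g(3) dir_deriv_inverse_fourier_bump[OF c \<phi>]]])
       (intro Bochner_Integration.integrable_add int1(2,3))
  then have "(LINT \<xi>|lborel. g' \<xi> * \<F> \<phi> \<xi>) = - (LINT \<xi>|lborel. g \<xi> * \<F> ?\<psi> \<xi>)"
    using int1 by (simp add: eq_neg_iff_add_eq_0 add.commute)
  also have "\<dots> = (LINT \<xi>|lborel. g \<xi> * \<F> (\<lambda>x. - 2 * of_real pi * \<i> * of_real (x $ i) * \<phi> x) \<xi>)"
  proof -
    have "\<F> (\<lambda>x. - 2 * of_real pi * \<i> * of_real (x $ i) * \<phi> x) \<xi> = - \<F> ?\<psi> \<xi>" for \<xi>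
      by (simp add: inverse_fourier_def)
    then show ?thesis by simp
  qed
  finally show ?thesis by simp
qed

lemma bump_cmult_coord_power:
  assumes "bump a b c \<phi>"
  shows "bump a b c (\<lambda>x. (k * of_real (x $ i)) ^ N * \<phi> x)"
proof (induction N)
  case (Suc N)
  from bump_cmult_coord[OF this, of k i] show ?case by (simp add: mult.assoc)
qed (use assms in simp)

lemma integral_iterated_derivative_fourier:
  fixes g :: "nat \<Rightarrow> real ^ 'n::finite \<Rightarrow> complex"
  assumes g: "\<And>k. continuous_on UNIV (g k)" "\<And>k. dir_deriv (axis i 1) (g k) (g (Suc k))"
    and bnd: "\<And>k. \<exists>B. \<forall>\<xi>. cmod (g k \<xi>) \<le> B"
    and c: "c > 0" and \<phi>: "bump a b c \<phi>"
  shows "(LINT \<xi>|lborel. g k \<xi> * \<F> (\<lambda>x. (- 2 * of_real pi * \<i> * of_real (x $ i)) ^ N * \<phi> x) \<xi>)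
    = (LINT \<xi>|lborel. g (k + N) \<xi> * \<F> \<phi> \<xi>)"
proof (induction N arbitrary: k)
  case (Suc N)
  obtain B B' where B: "\<And>\<xi>. cmod (g k \<xi>) \<le> B" "\<And>\<xi>. cmod (g (Suc k) \<xi>) \<le> B'" using bnd by metis
  have "(LINT \<xi>|lborel. g k \<xi> * \<F> (\<lambda>x. (- 2 * of_real pi * \<i> * of_real (x $ i)) ^ Suc N * \<phi> x) \<xi>)
     = (LINT \<xi>|lborel. g k \<xi> * \<F> (\<lambda>x. - 2 * of_real pi * \<i> * of_real (x $ i) * ((- 2 * of_real pi * \<i> * of_real (x $ i)) ^ N * \<phi> x)) \<xi>)"
    by (simp add: mult.assoc)
  also have "\<dots> = (LINT \<xi>|lborel. g (Suc k) \<xi> * \<F> (\<lambda>x. (- 2 * of_real pi * \<i> * of_real (x $ i)) ^ N * \<phi> x) \<xi>)"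
    by (rule integral_derivative_fourier[OF g(1) g(1) g(2) B c bump_cmult_coord_power[OF \<phi>]])
  also have "\<dots> = (LINT \<xi>|lborel. g (k + Suc N) \<xi> * \<F> \<phi> \<xi>)"
    using Suc.IH[of "Suc k"] by simp
  finally show ?case .
qed simp

text \<open>Multiplication by the \<open>n\<close>-th power of \<open>- 2 pi i x_i\<close> replaces
  \<open>g 0\<close>, which need not be integrable, by its integrable \<open>n\<close>-th
  derivative. Testing against bumps identifies that power times the difference of \<open>K\<close>
  and the transform of \<open>f0\<close> with the transform of \<open>g n\<close> almost everywhere,
  and the latter is bounded by the \<open>L^1\<close> norm of \<open>g n\<close>.\<close>

lemma fundamental_solution_remainder:
  fixes a :: "'n::finite multiindex \<Rightarrow> real"
  assumes c: "c1 > 0" "symbol_bound c1 \<alpha> a" and \<alpha>: "\<alpha> > 0"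
    and f0: "integrable lborel (\<lambda>\<xi>. 1 / (symbol \<alpha> a \<xi> * denom \<alpha> a \<xi>))" (is "integrable lborel ?f0")
    and K: "fundamental_solution \<alpha> a K"
  shows "\<exists>C. AE x in lebesgue. \<bar>x $ i\<bar> ^ CARD('n) * cmod (K x - \<F> ?f0 x) \<le> C"
proof -
  define N where "N = CARD('n)"
  let ?S = "denom \<alpha> a"
  obtain g where g0: "g 0 = (\<lambda>\<xi>. cnj (symbol \<alpha> a \<xi>) / ?S \<xi>)"
    and g: "\<And>k. continuous_on UNIV (g k)" "\<And>k. dir_deriv (axis i 1) (g k) (g (Suc k))"
    and decay: "\<And>k. \<exists>C. \<forall>\<xi>. cmod (g k \<xi>) \<le> C * (1 + norm \<xi>) powr - (real \<alpha> + real k)"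
    by (rule smooth_part_derivatives[OF c, of "axis i 1"], rule that)
  have [measurable]: "g k \<in> borel_measurable borel" for k
    using g(1) by (rule borel_measurable_continuous_onI)
  have bnd: "\<exists>B. \<forall>\<xi>. cmod (g k \<xi>) \<le> B" for k
  proof -
    obtain C where C: "\<And>\<xi>. cmod (g k \<xi>) \<le> C * (1 + norm \<xi>) powr - (real \<alpha> + real k)" using decay[of k] by blast
    have "cmod (g k \<xi>) \<le> \<bar>C\<bar> * 1" for \<xi>
    proof -
      have "(1 + norm \<xi>) powr - (real \<alpha> + real k) \<le> (1 + norm \<xi>) powr 0" by (intro powr_mono) auto
      also have "\<dots> = 1" using add_pos_nonneg[of 1 "norm \<xi>"] by simp
      finally have "(1 + norm \<xi>) powr - (real \<alpha> + real k) \<le> 1" .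
      then have "C * (1 + norm \<xi>) powr - (real \<alpha> + real k) \<le> \<bar>C\<bar> * 1" by (intro mult_mono) auto
      then show ?thesis using C[of \<xi>] by linarith
    qed
    then show ?thesis by blast
  qed
  \<comment> \<open>The decay order \<open>\<alpha> + n\<close> exceeds the dimension because
    \<open>\<alpha> > 0\<close>; this fixes the number of derivatives.\<close>
  have gN: "integrable lborel (g N)"
  proof -
    obtain C where C: "\<And>\<xi>. cmod (g N \<xi>) \<le> C * (1 + norm \<xi>) powr - (real \<alpha> + real N)" using decay[of N] by blast
    obtain B where B: "\<And>\<xi>. cmod (g N \<xi>) \<le> B" using bnd[of N] by blast
    show ?thesis
    proof (rule integrable_of_decay[where s = "real \<alpha> + real N" and C = "max B \<bar>C\<bar>"])
      show "real DIM(real ^ 'n) < real \<alpha> + real N" using \<alpha> by (simp add: N_def)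
      show "cmod (g N \<xi>) \<le> max B \<bar>C\<bar>" for \<xi> using B[of \<xi>] by simp
      show "cmod (g N \<xi>) \<le> max B \<bar>C\<bar> * norm \<xi> powr - (real \<alpha> + real N)" if "norm \<xi> \<ge> 1" for \<xi>
      proof -
        have "(1 + norm \<xi>) powr - (real \<alpha> + real N) \<le> norm \<xi> powr - (real \<alpha> + real N)"
          using that by (intro powr_mono2') auto
        then have "C * (1 + norm \<xi>) powr - (real \<alpha> + real N) \<le> max B \<bar>C\<bar> * norm \<xi> powr - (real \<alpha> + real N)"
          by (intro mult_mono) auto
        then show ?thesis using C[of \<xi>] by linarith
      qed
    qed simp
  qed
  define K1 where "K1 = \<F> ?f0"
  define G where "G = \<F> (g N)"
  have f0_meas [measurable]: "?f0 \<in> borel_measurable borel" using f0 by (simp add: borel_measurable_integrable)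
  have [measurable]: "K1 \<in> borel_measurable borel" "G \<in> borel_measurable borel"
    unfolding K1_def G_def by (intro measurable_inverse_fourier; simp)+
  have K1: "locally_integrable K1"
    by (rule locally_integrable_bounded[OF _ inverse_fourier_norm_le[OF f0, folded K1_def]]) simp
  have G: "locally_integrable G"
    by (rule locally_integrable_bounded[OF _ inverse_fourier_norm_le[OF gN, folded G_def]]) simp
  have K_loc: "locally_integrable K" and K_test: "\<And>\<phi>. test_function \<phi> \<Longrightarrow>
      inverse_fourier_distr (distr_of (\<lambda>\<xi>. 1 / symbol \<alpha> a \<xi>)) \<phi> = distr_of K \<phi>"
    using K by (auto simp: fundamental_solution_def distr_given_by_def)
  define m where "m x = (- 2 * of_real pi * \<i> * of_real (x $ i)) ^ N" for x :: "real ^ 'n"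
  have m_cont: "continuous_on UNIV m" unfolding m_def[abs_def] by (intro continuous_intros)
  \<comment> \<open>Vanishing of \<open>v\<close> is the claimed identity; \<open>v\<close> is
    locally integrable, so bumps can detect it.\<close>
  define v where "v x = m x * (K x - K1 x) - G x" for x
  have "AE x in lebesgue. v x = 0"
  proof (rule AE_eq_0_of_bump_integrals)
    show "locally_integrable v"
      unfolding v_def[abs_def]
      by (intro locally_integrable_diff locally_integrable_mult_continuous K_loc K1 G m_cont)
    fix u w :: "real ^ 'n" and e :: real and \<phi>
    assume e: "e > 0" and \<phi>: "bump u w e \<phi>"
    define \<psi> where "\<psi> x = m x * \<phi> x" for x
    have \<psi>: "bump u w e \<psi>"
      unfolding \<psi>_def[abs_def] m_def by (rule bump_cmult_coord_power[OF \<phi>])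
    have [measurable]: "\<phi> \<in> borel_measurable borel" "\<psi> \<in> borel_measurable borel"
      by (rule bump_measurable[OF e \<phi>], rule bump_measurable[OF e \<psi>])
    have int_f0: "integrable lborel (\<lambda>\<xi>. ?f0 \<xi> * \<F> \<psi> \<xi>)"
      by (rule integrable_mult_bounded[OF f0 _ inverse_fourier_norm_le[OF bump_integrable[OF e \<psi>]]]) simp
    obtain B where B: "\<And>\<xi>. cmod (g 0 \<xi>) \<le> B" using bnd[of 0] by blast
    have int_g: "integrable lborel (\<lambda>\<xi>. g 0 \<xi> * \<F> \<psi> \<xi>)"
      by (subst mult.commute, rule integrable_mult_bounded[OF bump_fourier_integrable[OF e \<psi>] _ B]) simp
    \<comment> \<open>At a zero of the symbol all three terms are 0, two of them by the convention
      \<open>1 / 0 = 0\<close>.\<close>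
    have split: "1 / symbol \<alpha> a \<xi> = ?f0 \<xi> + g 0 \<xi>" for \<xi>
    proof (cases "symbol \<alpha> a \<xi> = 0")
      case False
      have "?S \<xi> \<noteq> 0" by (rule denom_nonzero)
      moreover have "?S \<xi> = 1 + symbol \<alpha> a \<xi> * cnj (symbol \<alpha> a \<xi>)" by (simp add: denom_def)
      ultimately show ?thesis using False by (simp add: g0 divide_simps)
    qed (simp add: g0)
    have "(LINT x|lebesgue. K x * \<psi> x) = distr_of K \<psi>" by (simp add: distr_of_def)
    also have "\<dots> = inverse_fourier_distr (distr_of (\<lambda>\<xi>. 1 / symbol \<alpha> a \<xi>)) \<psi>"
      using K_test[OF bump_test_function[OF e \<psi>]] by simp
    also have "\<dots> = (LINT \<xi>|lborel. 1 / symbol \<alpha> a \<xi> * \<F> \<psi> \<xi>)"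
      unfolding inverse_fourier_distr_def distr_of_def by (rule integral_completion) measurable
    also have "\<dots> = (LINT \<xi>|lborel. ?f0 \<xi> * \<F> \<psi> \<xi> + g 0 \<xi> * \<F> \<psi> \<xi>)"
      unfolding split by (simp only: distrib_right)
    also have "\<dots> = (LINT \<xi>|lborel. ?f0 \<xi> * \<F> \<psi> \<xi>) + (LINT \<xi>|lborel. g 0 \<xi> * \<F> \<psi> \<xi>)"
      by (rule Bochner_Integration.integral_add[OF int_f0 int_g])
    also have "(LINT \<xi>|lborel. ?f0 \<xi> * \<F> \<psi> \<xi>) = (LINT x|lborel. K1 x * \<psi> x)"
      unfolding K1_def by (rule inverse_fourier_multiplication[OF f0 bump_integrable[OF e \<psi>], symmetric])
    also have "(LINT \<xi>|lborel. g 0 \<xi> * \<F> \<psi> \<xi>) = (LINT \<xi>|lborel. g (0 + N) \<xi> * \<F> \<phi> \<xi>)"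
      unfolding \<psi>_def[abs_def] m_def by (rule integral_iterated_derivative_fourier[of g, OF g bnd e \<phi>])
    also have "\<dots> = (LINT x|lborel. G x * \<phi> x)"
      unfolding G_def using inverse_fourier_multiplication[OF gN bump_integrable[OF e \<phi>]] by simp
    also have "(LINT x|lborel. K1 x * \<psi> x) = (LINT x|lebesgue. K1 x * \<psi> x)"
      by (rule integral_completion[symmetric]) measurable
    also have "(LINT x|lborel. G x * \<phi> x) = (LINT x|lebesgue. G x * \<phi> x)"
      by (rule integral_completion[symmetric]) measurable
    finally have eq: "(LINT x|lebesgue. K x * \<psi> x) = (LINT x|lebesgue. K1 x * \<psi> x) + (LINT x|lebesgue. G x * \<phi> x)" .
    have "(LINT x|lebesgue. v x * \<phi> x) = (LINT x|lebesgue. (K x * \<psi> x - K1 x * \<psi> x) - G x * \<phi> x)"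
      by (simp add: v_def \<psi>_def algebra_simps)
    also have "\<dots> = 0"
      using locally_integrable_mult_bump[OF K_loc e \<psi>] locally_integrable_mult_bump[OF K1 e \<psi>] locally_integrable_mult_bump[OF G e \<phi>] eq
      by simp
    finally show "(LINT x|lebesgue. v x * \<phi> x) = 0" .
  qed
  then have "AE x in lebesgue. \<bar>x $ i\<bar> ^ CARD('n) * cmod (K x - \<F> ?f0 x) \<le> (LINT \<xi>|lborel. cmod (g N \<xi>)) / (2 * pi) ^ N"
  proof eventually_elim
    case (elim x)
    then have "m x * (K x - K1 x) = G x" by (simp add: v_def)
    then have "cmod (m x) * cmod (K x - K1 x) = cmod (G x)" by (metis norm_mult)
    moreover have "cmod (m x) = (2 * pi) ^ N * \<bar>x $ i\<bar> ^ N"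
      by (simp add: m_def norm_power norm_mult power_mult_distrib)
    moreover have "cmod (G x) \<le> (LINT \<xi>|lborel. cmod (g N \<xi>))"
      unfolding G_def by (rule inverse_fourier_norm_le[OF gN])
    ultimately have "(2 * pi) ^ N * (\<bar>x $ i\<bar> ^ N * cmod (K x - K1 x)) \<le> (LINT \<xi>|lborel. cmod (g N \<xi>))"
      by (simp add: mult.assoc)
    then show ?case by (simp add: K1_def N_def pos_le_divide_eq mult.commute)
  qed
  then show ?thesis by blast
qed

theorem theorem11:
  fixes \<alpha> :: nat
    and a :: "'n::finite multiindex \<Rightarrow> real"
    and K :: "real ^ 'n \<Rightarrow> complex"
    and c1 :: real
  assumes "even \<alpha>"
    and "real CARD('n) / 2 \<le> real \<alpha>"
    and "\<alpha> < CARD('n)"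
    and "elliptic \<alpha> a"
    and "\<not> homogeneous \<alpha> a"
    and "c1 > 0"
    and "\<forall>\<xi>. norm (symbol \<alpha> a \<xi>) \<ge> c1 * norm \<xi> ^ \<alpha>"
    and "fundamental_solution \<alpha> a K"
  shows "in_Lp (real CARD('n) / (real CARD('n) - real \<alpha>)) {x. norm x \<ge> 1} K"
proof -
  define n where "n = CARD('n)"
  define q where "q = real n / (real n - real \<alpha>)"
  have \<alpha>: "\<alpha> > 0" using assms(2) by (cases \<alpha>) auto
  \<comment> \<open>\<open>q \<ge> 2\<close> is the hypothesis \<open>\<alpha> \<ge> n / 2\<close>
    in disguise, and the conjugate exponent is the critical \<open>n / \<alpha>\<close>.\<close>
  have q: "q \<ge> 2" "q / (q - 1) = real n / real \<alpha>"
    using assms(2,3) \<alpha> by (auto simp: q_def n_def field_simps)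
  define f0 where "f0 \<xi> = 1 / (symbol \<alpha> a \<xi> * denom \<alpha> a \<xi>)" for \<xi>
  have f0: "integrable lborel f0" "power_integral (q / (q - 1)) f0 < \<infinity>"
    using singular_part_integrable[OF assms(6,7,5,2,3)] by (simp_all add: f0_def[abs_def] q(2) n_def)
  define K1 where "K1 = \<F> f0"
  have [measurable]: "K1 \<in> borel_measurable borel"
    unfolding K1_def using f0 by (intro measurable_inverse_fourier) (simp add: borel_measurable_integrable)
  have K1: "power_integral q K1 < \<infinity>"
    unfolding K1_def by (rule hausdorff_young[OF f0(1) q(1) f0(2)])
  \<comment> \<open>One estimate per axis; a finite sum over the axes then replaces the coordinate
    by the norm.\<close>
  have "\<forall>i. \<exists>C. AE x in lebesgue. \<bar>x $ i\<bar> ^ n * cmod (K x - K1 x) \<le> C"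
    using fundamental_solution_remainder[OF assms(6,7) \<alpha> f0(1)[unfolded f0_def[abs_def]] assms(8)]
    by (simp add: K1_def f0_def[abs_def] n_def)
  then obtain C where "\<And>i. AE x in lebesgue. \<bar>x $ i\<bar> ^ n * cmod (K x - K1 x) \<le> C i" by metis
  then have coords: "AE x in lebesgue. \<forall>i. \<bar>x $ i\<bar> ^ n * cmod (K x - K1 x) \<le> C i"
    by (subst AE_all_countable) blast
  define D where "D = \<bar>real n ^ n * (\<Sum>i\<in>UNIV. C i)\<bar>"
  \<comment> \<open>The remainder is of order \<open>-n\<close> in the norm, so its
    \<open>q\<close>-th power is integrable outside the unit ball, as \<open>q > 1\<close>.\<close>
  have rest: "AE x in lebesgue. norm x \<ge> 1 \<longrightarrow> cmod (K x - K1 x) powr q \<le> D powr q * norm x powr - (real n * q)"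
    using coords
  proof eventually_elim
    case (elim x)
    show ?case
    proof
      assume x: "norm x \<ge> 1"
      have "norm x ^ n * cmod (K x - K1 x) \<le> real n ^ n * (\<Sum>i\<in>UNIV. \<bar>x $ i\<bar> ^ n) * cmod (K x - K1 x)"
        unfolding n_def by (intro mult_right_mono norm_power_le_coords) auto
      also have "\<dots> = real n ^ n * (\<Sum>i\<in>UNIV. \<bar>x $ i\<bar> ^ n * cmod (K x - K1 x))"
        by (simp add: sum_distrib_right mult.assoc)
      also have "\<dots> \<le> real n ^ n * (\<Sum>i\<in>UNIV. C i)" using elim by (intro mult_left_mono sum_mono) auto
      also have "\<dots> \<le> D" by (simp add: D_def)
      finally have "norm x ^ n * cmod (K x - K1 x) \<le> D" .
      moreover have "norm x > 0" using x by linarith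
      ultimately have "cmod (K x - K1 x) \<le> D * norm x powr - real n"
        by (simp add: powr_minus powr_realpow field_simps)
      then have "cmod (K x - K1 x) powr q \<le> (D * norm x powr - real n) powr q" using q by (intro powr_mono2) auto
      also have "\<dots> = D powr q * norm x powr - (real n * q)" by (simp add: powr_mult powr_powr D_def)
      finally show "cmod (K x - K1 x) powr q \<le> D powr q * norm x powr - (real n * q)" .
    qed
  qed
  let ?S = "{x :: real ^ 'n. norm x \<ge> 1}"
  have S [measurable]: "?S \<in> sets borel" by measurable
  then have S': "?S \<in> sets lebesgue" by simp
  have [measurable]: "K \<in> borel_measurable lebesgue"
    using assms(8) by (intro locally_integrable_measurable) (simp add: fundamental_solution_def distr_given_by_def)
  \<comment> \<open>The factor \<open>2 powr q\<close> comes from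
    \<open>s + t \<le> 2 * max s t\<close>, applied to the moduli of the two parts of
    \<open>K\<close>.\<close>
  let ?M = "\<lambda>x. ennreal (2 powr q) * (ennreal (cmod (K1 x) powr q) + ennreal (D powr q) * (ennreal (norm x powr - (real n * q)) * indicator ?S x))"
  have dom: "(\<integral>\<^sup>+x. ennreal (norm (indicator ?S x *\<^sub>R (cmod (K x) powr q))) \<partial>lebesgue)
    \<le> (\<integral>\<^sup>+x. ?M x \<partial>lebesgue)"
  proof (rule nn_integral_mono_AE)
    show "AE x in lebesgue. ennreal (norm (indicator ?S x *\<^sub>R (cmod (K x) powr q)))
      \<le> ?M x"
      using rest
    proof eventually_elim
      case (elim x)
      show ?case
      proof (cases "x \<in> ?S")
        case True
        define s where "s = cmod (K1 x)"
        define t where "t = cmod (K x - K1 x)"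
        have "cmod (K x) \<le> s + t" unfolding s_def t_def by (metis norm_triangle_sub)
        also have "\<dots> \<le> 2 * max s t" by simp
        finally have "cmod (K x) powr q \<le> (2 * max s t) powr q" using q by (intro powr_mono2) auto
        also have "\<dots> = 2 powr q * max s t powr q" by (simp add: powr_mult s_def t_def)
        also have "\<dots> \<le> 2 powr q * (s powr q + t powr q)"
          by (intro mult_left_mono) (auto simp: max_def)
        also have "\<dots> \<le> 2 powr q * (s powr q + D powr q * norm x powr - (real n * q))"
          using elim True by (intro mult_left_mono) (auto simp: t_def)
        finally have "ennreal (cmod (K x) powr q) \<le> ennreal (2 powr q * (s powr q + D powr q * norm x powr - (real n * q)))"
          by (rule ennreal_leI)
        then show ?thesis using True by (simp add: ennreal_mult ennreal_plus s_def)
      qed simp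
    qed
  qed
  also have "\<dots> = (\<integral>\<^sup>+x. ?M x \<partial>lborel)"
    by (rule nn_integral_completion)
  also have "\<dots> = ennreal (2 powr q) * (power_integral q K1 + ennreal (D powr q) * (\<integral>\<^sup>+x\<in>?S. ennreal (norm x powr - (real n * q)) \<partial>lborel))"
    by (simp add: nn_integral_cmult nn_integral_add)
  also have "\<dots> < \<infinity>"
  proof -
    have "n > 0" by (simp add: n_def)
    then have "real n * 1 < real n * q" using q by (intro mult_strict_left_mono) auto
    then have "(\<integral>\<^sup>+x\<in>?S. ennreal (norm x powr - (real n * q)) \<partial>lborel) < \<infinity>"
      by (intro nn_integral_norm_powr_infinity) (simp add: n_def)
    then show ?thesis using K1 by (simp add: ennreal_mult_less_top)
  qed
  finally have fin: "(\<integral>\<^sup>+x. ennreal (norm (indicator ?S x *\<^sub>R (cmod (K x) powr q))) \<partial>lebesgue) < \<infinity>" .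
  have "set_borel_measurable lebesgue ?S K"
    unfolding set_borel_measurable_def using S' by (intro borel_measurable_scaleR borel_measurable_indicator) auto
  moreover have "set_integrable lebesgue ?S (\<lambda>x. norm (K x) powr q)"
    unfolding set_integrable_def integrable_iff_bounded
  proof
    show "(\<lambda>x. indicator ?S x *\<^sub>R norm (K x) powr q) \<in> borel_measurable lebesgue"
      using S' by (intro borel_measurable_scaleR borel_measurable_indicator) auto
  qed (rule fin)
  ultimately show ?thesis by (simp add: in_Lp_def q_def n_def)
qed

end
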